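(* Let $X$ be a complex Banach space and $T\in\mathcal{B}(X)$. The following statements are equivalent: 1) Browder's theorem holds for $T$; 2) generalized Browder's theorem holds for $T$; 3) $T$ and $T^*$ have SVEP at every $\lambda\notin\sigma_{gD\mathcal{W}}(T)$; 4) $\sigma_{gD}(T)=\sigma_{gD\mathcal{W}}(T)$.
   Context: $\mathcal{B}(X)$ is the algebra of bounded linear operators on $X$; $T^*$ is the adjoint of $T$ acting on the dual space; $N(T)$, $R(T)$ are kernel and range. $(M,N)\in Red(T)$ means that $M,N$ are closed $T$-invariant subspaces with $X=M\oplus N$. $T$ is upper semi-Fredholm if $\dim N(T)<\infty$ and $R(T)$ is closed; lower semi-Fredholm if $\operatorname{codim}R(T)<\infty$; Fredholm if both; $ind(T)=\dim N(T)-\operatorname{codim}R(T)$; Weyl if Fredholm of index $0$. The ascent is $a(T)=\min\{p: N(T^p)=N(T^{p+1})\}$ and the descent is $d(T)=\min\{q: R(T^q)=R(T^{q+1})\}$ ($\infty$ if no such integer exists). $T$ is Browder if it is Fredholm with $a(T)<\infty$ and $d(T)<\infty$. $\sigma_W(T)$ and $\sigma_B(T)$ are the sets of $\lambda\in\mathbb{C}$ such that $T-\lambda I$ is not Weyl, respectively not Browder. Browder's theorem holds for $T$ if $\sigma_W(T)=\sigma_B(T)$. $T$ is B-Weyl if for some integer $n\ge 0$ the range $R(T^n)$ is closed and the restriction $T_n$ of $T$ to $R(T^n)$ is a Fredholm operator of index zero; $\sigma_{BW}(T)=\{\lambda\in\mathbb{C}: T-\lambda I\text{ is not B-Weyl}\}$.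 Generalized Browder's theorem holds for $T$ if $\sigma_{BW}(T)=\sigma(T)\setminus\Pi(T)$, where $\Pi(T)$ is the set of all poles of the resolvent of $T$. $T$ is generalized Drazin invertible (resp. pseudo B-Weyl) if there exists $(M,N)\in Red(T)$ such that $T_{|M}$ is invertible (resp. Weyl) and $T_{|N}$ is quasi-nilpotent. $\sigma_{gD}(T)$ (resp. $\sigma_{gD\mathcal{W}}(T)$) is the set of $\lambda\in\mathbb{C}$ such that $T-\lambda I$ is not generalized Drazin invertible (resp. not pseudo B-Weyl). An operator $T$ has SVEP (the single valued extension property) at $\lambda_0\in\mathbb{C}$ if for every connected open neighbourhood $U$ of $\lambda_0$ the only analytic function $f:U\to X$ with $(T-zI)f(z)=0$ for all $z\in U$ is $f\equiv 0$ (for $T^*$, with $X$ replaced by its dual). *)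

theory Defs
  imports "HOL-Analysis.Analysis" "HOL-Library.Extended_Nat"
begin

section \<open>Complex Banach spaces\<close>

class scaleC = scaleR +
  fixes scaleC :: "complex \<Rightarrow> 'a \<Rightarrow> 'a"  (infixr \<open>*\<^sub>C\<close> 75)
  assumes scaleR_scaleC: "scaleR r x = scaleC (complex_of_real r) x"

class complex_vector = scaleC + real_vector +
  assumes scaleC_add_right: "a *\<^sub>C (x + y) = a *\<^sub>C x + a *\<^sub>C y"
    and scaleC_add_left: "(a + b) *\<^sub>C x = a *\<^sub>C x + b *\<^sub>C x"
    and scaleC_scaleC: "a *\<^sub>C b *\<^sub>C x = (a * b) *\<^sub>C x"
    and scaleC_one: "1 *\<^sub>C x = x"

class complex_normed_vector = complex_vector + real_normed_vector +
  assumes norm_scaleC: "norm (a *\<^sub>C x) = cmod a * norm x"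

class complex_banach = complex_normed_vector + complete_space

subclass (in complex_banach) banach ..

global_interpretation complex_vector:
  vector_space "scaleC :: complex \<Rightarrow> 'a \<Rightarrow> 'a::complex_vector"
  by standard (simp_all add: scaleC_add_right scaleC_add_left scaleC_scaleC scaleC_one)

instantiation complex :: complex_banach
begin

definition scaleC_complex :: "complex \<Rightarrow> complex \<Rightarrow> complex"
  where "scaleC_complex a x = a * x"

instance
  by standard (simp_all add: scaleC_complex_def scaleR_conv_of_real algebra_simps norm_mult)

end

lemma bounded_linear_scaleC:
  "bounded_linear (\<lambda>x::'a::complex_normed_vector. c *\<^sub>C x)"
proof
  show "c *\<^sub>C (x + y) = c *\<^sub>C x + c *\<^sub>C y" for x y :: 'a
    by (rule scaleC_add_right)
  show "c *\<^sub>C r *\<^sub>R x = r *\<^sub>R c *\<^sub>C x" for r and x :: 'a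
    by (simp add: scaleR_scaleC scaleC_scaleC mult.commute)
  show "\<exists>K. \<forall>x::'a. norm (c *\<^sub>C x) \<le> norm x * K"
    by (intro exI[of _ "cmod c"]) (simp add: norm_scaleC mult.commute)
qed


section \<open>Bounded complex-linear operators\<close>

definition bounded_clinear :: "('a::complex_normed_vector \<Rightarrow> 'b::complex_normed_vector) \<Rightarrow> bool"
  where "bounded_clinear f \<longleftrightarrow> bounded_linear f \<and> (\<forall>c x. f (c *\<^sub>C x) = c *\<^sub>C f x)"

typedef (overloaded) ('a, 'b) cblinfun (\<open>(_ \<Rightarrow>\<^sub>C\<^sub>L /_)\<close> [22, 21] 21) =
  "{f::'a::complex_normed_vector \<Rightarrow> 'b::complex_normed_vector. bounded_clinear f}"
  morphisms cblinfun_apply CBlinfun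
  by (intro exI[of _ "\<lambda>_. 0"]) (simp add: bounded_clinear_def)

declare [[coercion
  "cblinfun_apply :: ('a::complex_normed_vector \<Rightarrow>\<^sub>C\<^sub>L 'b::complex_normed_vector) \<Rightarrow> 'a \<Rightarrow> 'b"]]

setup_lifting type_definition_cblinfun

lemma cblinfun_eqI: "(\<And>x. cblinfun_apply f x = cblinfun_apply g x) \<Longrightarrow> f = g"
  by transfer auto

lemma bounded_clinear_cblinfun: "bounded_clinear (cblinfun_apply f)"
  using cblinfun_apply[of f] by simp

lemma bounded_linear_cblinfun: "bounded_linear (cblinfun_apply f)"
  using bounded_clinear_cblinfun[of f] by (simp add: bounded_clinear_def)

instantiation cblinfun :: (complex_normed_vector, complex_normed_vector) complex_normed_vector
begin

lift_definition norm_cblinfun :: "'a \<Rightarrow>\<^sub>C\<^sub>L 'b \<Rightarrow> real" is onorm .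

lift_definition zero_cblinfun :: "'a \<Rightarrow>\<^sub>C\<^sub>L 'b" is "\<lambda>x. 0"
  by (simp add: bounded_clinear_def)

lift_definition plus_cblinfun :: "'a \<Rightarrow>\<^sub>C\<^sub>L 'b \<Rightarrow> 'a \<Rightarrow>\<^sub>C\<^sub>L 'b \<Rightarrow> 'a \<Rightarrow>\<^sub>C\<^sub>L 'b"
  is "\<lambda>f g x. f x + g x"
  by (simp add: bounded_clinear_def bounded_linear_add scaleC_add_right)

lift_definition minus_cblinfun :: "'a \<Rightarrow>\<^sub>C\<^sub>L 'b \<Rightarrow> 'a \<Rightarrow>\<^sub>C\<^sub>L 'b \<Rightarrow> 'a \<Rightarrow>\<^sub>C\<^sub>L 'b"
  is "\<lambda>f g x. f x - g x"
  by (simp add: bounded_clinear_def bounded_linear_sub complex_vector.scale_right_diff_distrib)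

lift_definition uminus_cblinfun :: "'a \<Rightarrow>\<^sub>C\<^sub>L 'b \<Rightarrow> 'a \<Rightarrow>\<^sub>C\<^sub>L 'b" is "\<lambda>f x. - f x"
  by (simp add: bounded_clinear_def bounded_linear_minus)

lift_definition scaleC_cblinfun :: "complex \<Rightarrow> 'a \<Rightarrow>\<^sub>C\<^sub>L 'b \<Rightarrow> 'a \<Rightarrow>\<^sub>C\<^sub>L 'b" is "\<lambda>c f x. c *\<^sub>C f x"
  by (auto simp: bounded_clinear_def scaleC_scaleC mult.commute
      intro: bounded_linear_compose[OF bounded_linear_scaleC])

definition scaleR_cblinfun :: "real \<Rightarrow> 'a \<Rightarrow>\<^sub>C\<^sub>L 'b \<Rightarrow> 'a \<Rightarrow>\<^sub>C\<^sub>L 'b"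
  where "scaleR_cblinfun r f = complex_of_real r *\<^sub>C f"

definition dist_cblinfun :: "'a \<Rightarrow>\<^sub>C\<^sub>L 'b \<Rightarrow> 'a \<Rightarrow>\<^sub>C\<^sub>L 'b \<Rightarrow> real"
  where "dist_cblinfun f g = norm (f - g)"

definition sgn_cblinfun :: "'a \<Rightarrow>\<^sub>C\<^sub>L 'b \<Rightarrow> 'a \<Rightarrow>\<^sub>C\<^sub>L 'b"
  where "sgn_cblinfun f = inverse (norm f) *\<^sub>R f"

definition uniformity_cblinfun :: "(('a \<Rightarrow>\<^sub>C\<^sub>L 'b) \<times> ('a \<Rightarrow>\<^sub>C\<^sub>L 'b)) filter"
  where "uniformity_cblinfun = (INF e\<in>{0 <..}. principal {(x, y). dist x y < e})"

definition open_cblinfun :: "('a \<Rightarrow>\<^sub>C\<^sub>L 'b) set \<Rightarrow> bool"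
  where "open_cblinfun S = (\<forall>x\<in>S. \<forall>\<^sub>F (x', y) in uniformity. x' = x \<longrightarrow> y \<in> S)"

lemma onorm_scaleC:
  fixes f :: "'c::complex_normed_vector \<Rightarrow> 'd::complex_normed_vector"
  assumes "bounded_linear f"
  shows "onorm (\<lambda>x. c *\<^sub>C f x) = cmod c * onorm f"
proof -
  have "onorm (\<lambda>x. c *\<^sub>C f x) = onorm (\<lambda>x. cmod c *\<^sub>R f x)"
    by (simp add: onorm_def norm_scaleC)
  then show ?thesis
    by (simp add: onorm_scaleR[OF assms])
qed

instance
proof
  fix a b c :: "'a \<Rightarrow>\<^sub>C\<^sub>L 'b" and r s :: real and z w :: complex
  show "r *\<^sub>R a = complex_of_real r *\<^sub>C a"
    by (simp add: scaleR_cblinfun_def)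
  show "a + b + c = a + (b + c)" "a + b = b + a" "0 + a = a" "- a + a = 0" "a - b = a + - b"
    by (transfer; simp add: fun_eq_iff algebra_simps)+
  show "r *\<^sub>R (a + b) = r *\<^sub>R a + r *\<^sub>R b" "(r + s) *\<^sub>R a = r *\<^sub>R a + s *\<^sub>R a"
    "r *\<^sub>R s *\<^sub>R a = (r * s) *\<^sub>R a" "1 *\<^sub>R a = a"
    unfolding scaleR_cblinfun_def
    by (transfer; simp add: fun_eq_iff scaleC_add_right scaleC_add_left scaleC_scaleC scaleC_one)+
  show "z *\<^sub>C (a + b) = z *\<^sub>C a + z *\<^sub>C b" "(z + w) *\<^sub>C a = z *\<^sub>C a + w *\<^sub>C a"
    "z *\<^sub>C w *\<^sub>C a = (z * w) *\<^sub>C a" "1 *\<^sub>C a = a"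
    by (transfer; simp add: fun_eq_iff scaleC_add_right scaleC_add_left scaleC_scaleC scaleC_one)+
  show "norm (z *\<^sub>C a) = cmod z * norm a"
    by transfer (simp add: bounded_clinear_def onorm_scaleC)
  show "norm (r *\<^sub>R a) = \<bar>r\<bar> * norm a"
    unfolding scaleR_cblinfun_def by transfer (simp add: bounded_clinear_def onorm_scaleC)
  show "norm a = 0 \<longleftrightarrow> a = 0"
    by transfer (auto simp: bounded_clinear_def onorm_eq_0 fun_eq_iff)
  show "norm (a + b) \<le> norm a + norm b"
    by transfer (simp add: bounded_clinear_def onorm_triangle)
  show "dist a b = norm (a - b)" by (rule dist_cblinfun_def)
  show "sgn a = inverse (norm a) *\<^sub>R a" by (rule sgn_cblinfun_def)
  show "(uniformity :: (('a \<Rightarrow>\<^sub>C\<^sub>L 'b) \<times> ('a \<Rightarrow>\<^sub>C\<^sub>L 'b)) filter)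
      = (INF e\<in>{0 <..}. principal {(x, y). dist x y < e})"
    by (rule uniformity_cblinfun_def)
  show "open U \<longleftrightarrow> (\<forall>x\<in>U. \<forall>\<^sub>F (x', y) in uniformity. x' = x \<longrightarrow> y \<in> U)" for U :: "('a \<Rightarrow>\<^sub>C\<^sub>L 'b) set"
    by (rule open_cblinfun_def)
qed

end

instance cblinfun :: (complex_normed_vector, complex_banach) complex_banach
proof
  fix X :: "nat \<Rightarrow> 'a \<Rightarrow>\<^sub>C\<^sub>L 'b"
  assume X: "Cauchy X"
  define B :: "('a \<Rightarrow>\<^sub>C\<^sub>L 'b) \<Rightarrow> 'a \<Rightarrow>\<^sub>L 'b" where "B f = Blinfun (cblinfun_apply f)" for f
  have B: "blinfun_apply (B f) = cblinfun_apply f" for f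
    unfolding B_def by (rule bounded_linear_Blinfun_apply) (rule bounded_linear_cblinfun)
  have dist_B: "dist (B f) (B g) = dist f g" for f g
    by (simp add: dist_norm norm_blinfun.rep_eq norm_cblinfun.rep_eq
        minus_blinfun.rep_eq minus_cblinfun.rep_eq B)
  have "Cauchy (\<lambda>n. B (X n))"
    using X by (simp add: Cauchy_def dist_B)
  then obtain L where L: "(\<lambda>n. B (X n)) \<longlonglongrightarrow> L"
    using Cauchy_convergent_iff convergent_def by blast
  have Lx: "(\<lambda>n. cblinfun_apply (X n) x) \<longlonglongrightarrow> blinfun_apply L x" for x
    using bounded_linear.tendsto[OF blinfun.bounded_linear_left[of x] L] by (simp add: B)
  have "blinfun_apply L (c *\<^sub>C x) = c *\<^sub>C blinfun_apply L x" for c x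
  proof (rule LIMSEQ_unique[OF Lx])
    have "cblinfun_apply (X n) (c *\<^sub>C x) = c *\<^sub>C cblinfun_apply (X n) x" for n
      using bounded_clinear_cblinfun[of "X n"] by (simp add: bounded_clinear_def)
    then show "(\<lambda>n. cblinfun_apply (X n) (c *\<^sub>C x)) \<longlonglongrightarrow> c *\<^sub>C blinfun_apply L x"
      using bounded_linear.tendsto[OF bounded_linear_scaleC[of c] Lx[of x]] by simp
  qed
  then have "bounded_clinear (blinfun_apply L)"
    by (simp add: bounded_clinear_def blinfun.bounded_linear_right)
  then have "B (CBlinfun (blinfun_apply L)) = L"
    by (intro blinfun_eqI) (simp add: B CBlinfun_inverse)
  then have "X \<longlonglongrightarrow> CBlinfun (blinfun_apply L)"
    using L by (simp add: tendsto_iff flip: dist_B)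
  then show "convergent X"
    by (auto simp: convergent_def)
qed

lift_definition id_cblinfun :: "'a::complex_normed_vector \<Rightarrow>\<^sub>C\<^sub>L 'a" is "\<lambda>x. x"
  by (simp add: bounded_clinear_def)

lift_definition cblinfun_compose ::
    "'b::complex_normed_vector \<Rightarrow>\<^sub>C\<^sub>L 'c::complex_normed_vector \<Rightarrow>
     'a::complex_normed_vector \<Rightarrow>\<^sub>C\<^sub>L 'b \<Rightarrow> 'a \<Rightarrow>\<^sub>C\<^sub>L 'c"  (infixl \<open>o\<^sub>C\<^sub>L\<close> 55)
  is "\<lambda>f g x. f (g x)"
  by (simp add: bounded_clinear_def bounded_linear_compose)

lemma norm_cblinfun_compose: "norm (f o\<^sub>C\<^sub>L g) \<le> norm f * norm g"
  by transfer (use onorm_compose in \<open>auto simp: bounded_clinear_def comp_def\<close>)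

text \<open>The Banach-space adjoint, on the dual space \<^typ>\<open>'a \<Rightarrow>\<^sub>C\<^sub>L complex\<close>.\<close>

lift_definition banach_adjoint :: "'a::complex_normed_vector \<Rightarrow>\<^sub>C\<^sub>L 'a \<Rightarrow>
    ('a \<Rightarrow>\<^sub>C\<^sub>L complex) \<Rightarrow>\<^sub>C\<^sub>L ('a \<Rightarrow>\<^sub>C\<^sub>L complex)"
  is "\<lambda>T \<phi>. \<phi> o\<^sub>C\<^sub>L T"
proof -
  fix T :: "'a \<Rightarrow>\<^sub>C\<^sub>L 'a"
  have "bounded_linear (\<lambda>\<phi> :: 'a \<Rightarrow>\<^sub>C\<^sub>L complex. \<phi> o\<^sub>C\<^sub>L T)"
  proof
    show "(f + g) o\<^sub>C\<^sub>L T = (f o\<^sub>C\<^sub>L T) + (g o\<^sub>C\<^sub>L T)" for f g :: "'a \<Rightarrow>\<^sub>C\<^sub>L complex"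
      by transfer simp
    show "(r *\<^sub>R f) o\<^sub>C\<^sub>L T = r *\<^sub>R (f o\<^sub>C\<^sub>L T)" for r and f :: "'a \<Rightarrow>\<^sub>C\<^sub>L complex"
      unfolding scaleR_scaleC by transfer simp
    show "\<exists>K. \<forall>f :: 'a \<Rightarrow>\<^sub>C\<^sub>L complex. norm (f o\<^sub>C\<^sub>L T) \<le> norm f * K"
      by (intro exI[of _ "norm T"] allI norm_cblinfun_compose)
  qed
  moreover have "(c *\<^sub>C f) o\<^sub>C\<^sub>L T = c *\<^sub>C (f o\<^sub>C\<^sub>L T)" for c and f :: "'a \<Rightarrow>\<^sub>C\<^sub>L complex"
    by transfer simp
  ultimately show "bounded_clinear (\<lambda>\<phi> :: 'a \<Rightarrow>\<^sub>C\<^sub>L complex. \<phi> o\<^sub>C\<^sub>L T)"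
    by (simp add: bounded_clinear_def)
qed


section \<open>Dimension and codimension\<close>

definition fin_dim :: "'a::complex_vector set \<Rightarrow> bool"
  where "fin_dim V \<longleftrightarrow> (\<exists>B. finite B \<and> V \<subseteq> complex_vector.span B)"

text \<open>For subspaces \<open>R \<subseteq> M\<close>, the dimension of the quotient \<open>M / R\<close>, i.e. the least number of
  vectors whose cosets span it. The value of \<open>codim\<close> is meaningful only if \<open>fin_codim\<close> holds.
  The lemma below relates it to algebraic complements.\<close>

definition fin_codim :: "'a::complex_vector set \<Rightarrow> 'a set \<Rightarrow> bool"
  where "fin_codim M R \<longleftrightarrow> (\<exists>B\<subseteq>M. finite B \<and> complex_vector.span (R \<union> B) = M)"

definition codim :: "'a::complex_vector set \<Rightarrow> 'a set \<Rightarrow> nat"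
  where "codim M R =
    (LEAST n. \<exists>B\<subseteq>M. finite B \<and> card B = n \<and> complex_vector.span (R \<union> B) = M)"

lemma codim_eq_dim_complement:
  fixes M R C :: "'a::complex_vector set"
  assumes R: "complex_vector.subspace R" and C: "complex_vector.subspace C"
    and int: "C \<inter> R = {0}" and sum: "{c + r |c r. c \<in> C \<and> r \<in> R} = M" and fin: "fin_dim C"
  shows "fin_codim M R" and "codim M R = complex_vector.dim C"
proof -
  note span_R = complex_vector.span_eq_iff[THEN iffD2, OF R]
  obtain B0 where B0: "B0 \<subseteq> C" "complex_vector.independent B0" "C \<subseteq> complex_vector.span B0"
      "card B0 = complex_vector.dim C"
    using complex_vector.basis_exists[of C] by blast
  have "finite B0"
  proof -
    obtain F where "finite F" "C \<subseteq> complex_vector.span F"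
      using fin by (auto simp: fin_dim_def)
    then show ?thesis
      using complex_vector.independent_span_bound[of F B0] B0 by blast
  qed
  have span_B0: "complex_vector.span B0 = C"
    by (metis B0(1,3) C complex_vector.span_minimal subset_antisym)
  have B0M: "B0 \<subseteq> M" "complex_vector.span (R \<union> B0) = M"
  proof -
    have "0 \<in> R" using R by (rule complex_vector.subspace_0)
    then have "C \<subseteq> M" using sum by force
    then show "B0 \<subseteq> M" using B0(1) by blast
    have "complex_vector.span (R \<union> B0) = {r + c |r c. r \<in> R \<and> c \<in> C}"
      by (auto simp: complex_vector.span_Un span_R span_B0)
    also have "\<dots> = M"
      unfolding sum[symmetric] by (auto simp: add.commute) (metis add.commute)+
    finally show "complex_vector.span (R \<union> B0) = M" .
  qed
  with \<open>finite B0\<close> show "fin_codim M R"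
    by (auto simp: fin_codim_def)
  have lower: "complex_vector.dim C \<le> card B"
    if B: "B \<subseteq> M" "finite B" "complex_vector.span (R \<union> B) = M" for B
  proof -
    have "\<forall>b\<in>B. \<exists>c. c \<in> C \<and> b - c \<in> R"
      using B(1) unfolding sum[symmetric] by fastforce
    then obtain p where p: "\<And>b. b \<in> B \<Longrightarrow> p b \<in> C \<and> b - p b \<in> R"
      by metis
    have pB: "complex_vector.span (p ` B) \<subseteq> C"
      using p C by (intro complex_vector.span_minimal) auto
    have ex: "\<exists>q \<in> complex_vector.span (p ` B). x - q \<in> R" if "x \<in> complex_vector.span B" for x
      using that
    proof (induction rule: complex_vector.span_induct_alt)
      case base
      show ?case
        using complex_vector.span_zero complex_vector.subspace_0[OF R] by force
    next
      case (step c b y)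
      then obtain q where q: "q \<in> complex_vector.span (p ` B)" "y - q \<in> R" by blast
      have "c *\<^sub>C p b + q \<in> complex_vector.span (p ` B)"
        using step.hyps(1) q(1)
        by (blast intro: complex_vector.span_add complex_vector.span_scale complex_vector.span_base)
      moreover have "c *\<^sub>C (b - p b) + (y - q) \<in> R"
        using p step.hyps q R by (intro complex_vector.subspace_add complex_vector.subspace_scale) auto
      then have "(c *\<^sub>C b + y) - (c *\<^sub>C p b + q) \<in> R"
        by (simp add: complex_vector.scale_right_diff_distrib algebra_simps)
      ultimately show ?case by blast
    qed
    have "C \<subseteq> complex_vector.span (p ` B)"
    proof
      fix c assume "c \<in> C"
      then have "c \<in> complex_vector.span (R \<union> B)"
        unfolding B(3) sum[symmetric] using complex_vector.subspace_0[OF R] by force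
      then obtain r b where rb: "c = r + b" "r \<in> R" "b \<in> complex_vector.span B"
        by (auto simp: complex_vector.span_Un span_R)
      obtain q where q: "q \<in> complex_vector.span (p ` B)" "b - q \<in> R"
        using ex rb(3) by blast
      have "c - q = r + (b - q)" using rb(1) by simp
      then have "c - q \<in> R" using rb(2) q(2) R complex_vector.subspace_add by metis
      moreover have "c - q \<in> C"
        using \<open>c \<in> C\<close> q(1) pB C complex_vector.subspace_diff by blast
      ultimately have "c - q \<in> C \<inter> R" by blast
      then have "c - q = 0" unfolding int by blast
      then have "c = q" by (rule eq_iff_diff_eq_0[THEN iffD2])
      then show "c \<in> complex_vector.span (p ` B)" using q by simp
    qed
    then have "complex_vector.dim C \<le> card (p ` B)"
      using B(2) by (intro complex_vector.dim_le_card) auto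
    also have "\<dots> \<le> card B" using B(2) by (rule card_image_le)
    finally show ?thesis .
  qed
  show "codim M R = complex_vector.dim C"
    unfolding codim_def
    by (rule Least_equality) (use B0M B0(4) \<open>finite B0\<close> lower in blast)+
qed


section \<open>Restrictions to invariant subspaces\<close>

text \<open>A notion with suffix \<open>_on M\<close> is the corresponding notion for the restriction of \<open>T\<close> to the
  closed \<open>T\<close>-invariant subspace \<open>M\<close>, seen as an operator from \<open>M\<close> to \<open>M\<close>; for \<open>M = UNIV\<close> it is
  the notion for \<open>T\<close> itself. Since \<open>M\<close> is closed, a subset of \<open>M\<close> is closed in \<open>M\<close> iff it is
  closed.\<close>

definition kernel_on :: "'a::complex_normed_vector set \<Rightarrow> 'a \<Rightarrow>\<^sub>C\<^sub>L 'a \<Rightarrow> 'a set"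
  where "kernel_on M T = {x \<in> M. T x = 0}"

definition bounded_operator_on :: "'a::complex_normed_vector set \<Rightarrow> ('a \<Rightarrow> 'a) \<Rightarrow> bool"
  where "bounded_operator_on M S \<longleftrightarrow>
    (\<forall>x\<in>M. S x \<in> M) \<and>
    (\<forall>x\<in>M. \<forall>y\<in>M. S (x + y) = S x + S y) \<and>
    (\<forall>c. \<forall>x\<in>M. S (c *\<^sub>C x) = c *\<^sub>C S x) \<and>
    (\<exists>K. \<forall>x\<in>M. norm (S x) \<le> K * norm x)"

definition invertible_on :: "'a::complex_normed_vector set \<Rightarrow> 'a \<Rightarrow>\<^sub>C\<^sub>L 'a \<Rightarrow> bool"
  where "invertible_on M T \<longleftrightarrow>
    (\<exists>S. bounded_operator_on M S \<and> (\<forall>x\<in>M. S (T x) = x \<and> T (S x) = x))"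

definition spectrum_on :: "'a::complex_normed_vector set \<Rightarrow> 'a \<Rightarrow>\<^sub>C\<^sub>L 'a \<Rightarrow> complex set"
  where "spectrum_on M T = {\<mu>. \<not> invertible_on M (T - \<mu> *\<^sub>C id_cblinfun)}"

text \<open>Inclusion rather than equality, as the spectrum on the zero space is empty.\<close>

definition quasinilpotent_on :: "'a::complex_normed_vector set \<Rightarrow> 'a \<Rightarrow>\<^sub>C\<^sub>L 'a \<Rightarrow> bool"
  where "quasinilpotent_on M T \<longleftrightarrow> spectrum_on M T \<subseteq> {0}"

definition upper_semi_Fredholm_on :: "'a::complex_normed_vector set \<Rightarrow> 'a \<Rightarrow>\<^sub>C\<^sub>L 'a \<Rightarrow> bool"
  where "upper_semi_Fredholm_on M T \<longleftrightarrow> fin_dim (kernel_on M T) \<and> closed (T ` M)"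

definition lower_semi_Fredholm_on :: "'a::complex_normed_vector set \<Rightarrow> 'a \<Rightarrow>\<^sub>C\<^sub>L 'a \<Rightarrow> bool"
  where "lower_semi_Fredholm_on M T \<longleftrightarrow> fin_codim M (T ` M)"

definition Fredholm_on :: "'a::complex_normed_vector set \<Rightarrow> 'a \<Rightarrow>\<^sub>C\<^sub>L 'a \<Rightarrow> bool"
  where "Fredholm_on M T \<longleftrightarrow> upper_semi_Fredholm_on M T \<and> lower_semi_Fredholm_on M T"

definition index_on :: "'a::complex_normed_vector set \<Rightarrow> 'a \<Rightarrow>\<^sub>C\<^sub>L 'a \<Rightarrow> int"
  where "index_on M T = int (complex_vector.dim (kernel_on M T)) - int (codim M (T ` M))"

definition Weyl_on :: "'a::complex_normed_vector set \<Rightarrow> 'a \<Rightarrow>\<^sub>C\<^sub>L 'a \<Rightarrow> bool"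
  where "Weyl_on M T \<longleftrightarrow> Fredholm_on M T \<and> index_on M T = 0"

definition Red :: "'a::complex_normed_vector \<Rightarrow>\<^sub>C\<^sub>L 'a \<Rightarrow> ('a set \<times> 'a set) set"
  where "Red T = {(M, N).
    complex_vector.subspace M \<and> closed M \<and> T ` M \<subseteq> M \<and>
    complex_vector.subspace N \<and> closed N \<and> T ` N \<subseteq> N \<and>
    M \<inter> N = {0} \<and> {x + y |x y. x \<in> M \<and> y \<in> N} = UNIV}"


section \<open>Classes of operators and spectra\<close>

abbreviation spectrum :: "'a::complex_normed_vector \<Rightarrow>\<^sub>C\<^sub>L 'a \<Rightarrow> complex set"
  where "spectrum T \<equiv> spectrum_on UNIV T"

lemma invertible_on_UNIV_iff:
  fixes T :: "'a::complex_normed_vector \<Rightarrow>\<^sub>C\<^sub>L 'a"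
  shows "invertible_on UNIV T \<longleftrightarrow> (\<exists>S. S o\<^sub>C\<^sub>L T = id_cblinfun \<and> T o\<^sub>C\<^sub>L S = id_cblinfun)"
proof
  assume "invertible_on UNIV T"
  then obtain S where S: "bounded_operator_on UNIV S" "\<And>x. S (T x) = x" "\<And>x. T (S x) = x"
    by (auto simp: invertible_on_def)
  obtain K where "\<And>x. norm (S x) \<le> K * norm x"
    using S(1) by (auto simp: bounded_operator_on_def)
  then have "norm (S x) \<le> norm x * K" for x
    by (metis mult.commute)
  then have "bounded_linear S"
    using S(1) unfolding bounded_operator_on_def
    by (intro bounded_linear_intro[where K = K]) (auto simp: scaleR_scaleC)
  then have "bounded_clinear S"
    using S(1) by (simp add: bounded_clinear_def bounded_operator_on_def)
  then have "CBlinfun S o\<^sub>C\<^sub>L T = id_cblinfun \<and> T o\<^sub>C\<^sub>L CBlinfun S = id_cblinfun"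
    using S(2,3) by (auto intro!: cblinfun_eqI
        simp: cblinfun_compose.rep_eq id_cblinfun.rep_eq CBlinfun_inverse)
  then show "\<exists>S. S o\<^sub>C\<^sub>L T = id_cblinfun \<and> T o\<^sub>C\<^sub>L S = id_cblinfun" by blast
next
  assume "\<exists>S. S o\<^sub>C\<^sub>L T = id_cblinfun \<and> T o\<^sub>C\<^sub>L S = id_cblinfun"
  then obtain S where S: "S o\<^sub>C\<^sub>L T = id_cblinfun" "T o\<^sub>C\<^sub>L S = id_cblinfun" by blast
  have "cblinfun_apply S (T x) = x" "T (S x) = x" for x
    using S by (metis cblinfun_compose.rep_eq id_cblinfun.rep_eq)+
  moreover have "bounded_operator_on UNIV (cblinfun_apply S)"
    using bounded_clinear_cblinfun[of S] bounded_linear.bounded[OF bounded_linear_cblinfun[of S]]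
    by (auto simp: bounded_operator_on_def bounded_clinear_def linear_simps mult.commute)
  ultimately show "invertible_on UNIV T"
    unfolding invertible_on_def by blast
qed

definition ascent :: "'a::complex_normed_vector \<Rightarrow>\<^sub>C\<^sub>L 'a \<Rightarrow> enat"
  where "ascent T = (INF p\<in>{p::nat.
    {x. (cblinfun_apply T ^^ p) x = 0} = {x. (cblinfun_apply T ^^ (p + 1)) x = 0}}. enat p)"

definition descent :: "'a::complex_normed_vector \<Rightarrow>\<^sub>C\<^sub>L 'a \<Rightarrow> enat"
  where "descent T = (INF q\<in>{q::nat.
    range (cblinfun_apply T ^^ q) = range (cblinfun_apply T ^^ (q + 1))}. enat q)"

definition Browder :: "'a::complex_normed_vector \<Rightarrow>\<^sub>C\<^sub>L 'a \<Rightarrow> bool"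
  where "Browder T \<longleftrightarrow> Fredholm_on UNIV T \<and> ascent T < \<infinity> \<and> descent T < \<infinity>"

definition B_Weyl :: "'a::complex_normed_vector \<Rightarrow>\<^sub>C\<^sub>L 'a \<Rightarrow> bool"
  where "B_Weyl T \<longleftrightarrow> (\<exists>n::nat. closed (range (cblinfun_apply T ^^ n)) \<and>
    Weyl_on (range (cblinfun_apply T ^^ n)) T)"

definition generalized_Drazin_invertible :: "'a::complex_normed_vector \<Rightarrow>\<^sub>C\<^sub>L 'a \<Rightarrow> bool"
  where "generalized_Drazin_invertible T \<longleftrightarrow>
    (\<exists>(M, N) \<in> Red T. invertible_on M T \<and> quasinilpotent_on N T)"

definition pseudo_B_Weyl :: "'a::complex_normed_vector \<Rightarrow>\<^sub>C\<^sub>L 'a \<Rightarrow> bool"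
  where "pseudo_B_Weyl T \<longleftrightarrow>
    (\<exists>(M, N) \<in> Red T. Weyl_on M T \<and> quasinilpotent_on N T)"

definition Weyl_spectrum :: "'a::complex_normed_vector \<Rightarrow>\<^sub>C\<^sub>L 'a \<Rightarrow> complex set"
  where "Weyl_spectrum T = {\<mu>. \<not> Weyl_on UNIV (T - \<mu> *\<^sub>C id_cblinfun)}"

definition Browder_spectrum :: "'a::complex_normed_vector \<Rightarrow>\<^sub>C\<^sub>L 'a \<Rightarrow> complex set"
  where "Browder_spectrum T = {\<mu>. \<not> Browder (T - \<mu> *\<^sub>C id_cblinfun)}"

definition B_Weyl_spectrum :: "'a::complex_normed_vector \<Rightarrow>\<^sub>C\<^sub>L 'a \<Rightarrow> complex set"
  where "B_Weyl_spectrum T = {\<mu>. \<not> B_Weyl (T - \<mu> *\<^sub>C id_cblinfun)}"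

definition gD_spectrum :: "'a::complex_normed_vector \<Rightarrow>\<^sub>C\<^sub>L 'a \<Rightarrow> complex set"
  where "gD_spectrum T = {\<mu>. \<not> generalized_Drazin_invertible (T - \<mu> *\<^sub>C id_cblinfun)}"

definition gDW_spectrum :: "'a::complex_normed_vector \<Rightarrow>\<^sub>C\<^sub>L 'a \<Rightarrow> complex set"
  where "gDW_spectrum T = {\<mu>. \<not> pseudo_B_Weyl (T - \<mu> *\<^sub>C id_cblinfun)}"


section \<open>Analytic vector-valued functions, poles of the resolvent, SVEP\<close>

definition canalytic_on :: "(complex \<Rightarrow> 'a::complex_normed_vector) \<Rightarrow> complex set \<Rightarrow> bool"
  where "canalytic_on f U \<longleftrightarrow>
    open U \<and> (\<forall>z\<in>U. \<exists>D. (f has_derivative (\<lambda>h. h *\<^sub>C D)) (at z))"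

text \<open>A pole of order \<open>p \<ge> 1\<close>. The library's \<open>is_pole\<close>, divergence of the norm to infinity, is
  too weak for vector-valued functions: the resolvent of every quasi-nilpotent operator
  satisfies it at 0.\<close>

definition is_pole_vec :: "(complex \<Rightarrow> 'a::complex_normed_vector) \<Rightarrow> complex \<Rightarrow> bool"
  where "is_pole_vec f z0 \<longleftrightarrow>
    (\<exists>p::nat. \<exists>r>0. \<exists>g. p \<ge> 1 \<and> canalytic_on g (ball z0 r) \<and> g z0 \<noteq> 0 \<and>
      (\<forall>z \<in> ball z0 r - {z0}. f z = (1 / (z - z0) ^ p) *\<^sub>C g z))"

definition resolvent :: "'a::complex_normed_vector \<Rightarrow>\<^sub>C\<^sub>L 'a \<Rightarrow> complex \<Rightarrow> 'a \<Rightarrow>\<^sub>C\<^sub>L 'a"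
  where "resolvent T z = (THE S. S o\<^sub>C\<^sub>L (z *\<^sub>C id_cblinfun - T) = id_cblinfun \<and>
    (z *\<^sub>C id_cblinfun - T) o\<^sub>C\<^sub>L S = id_cblinfun)"

text \<open>As \<^term>\<open>resolvent T\<close> is meaningful only off the spectrum, isolatedness is required
  explicitly.\<close>

definition resolvent_poles :: "'a::complex_normed_vector \<Rightarrow>\<^sub>C\<^sub>L 'a \<Rightarrow> complex set"
  where "resolvent_poles T = {\<mu> \<in> spectrum T.
    (\<exists>r>0. spectrum T \<inter> ball \<mu> r = {\<mu>}) \<and> is_pole_vec (resolvent T) \<mu>}"

definition SVEP_at :: "'a::complex_normed_vector \<Rightarrow>\<^sub>C\<^sub>L 'a \<Rightarrow> complex \<Rightarrow> bool"
  where "SVEP_at T z0 \<longleftrightarrow>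
    (\<forall>U f. open U \<and> connected U \<and> z0 \<in> U \<and> canalytic_on f U \<and>
      (\<forall>z\<in>U. (T - z *\<^sub>C id_cblinfun) (f z) = 0) \<longrightarrow> (\<forall>z\<in>U. f z = 0))"

definition Browders_theorem :: "'a::complex_normed_vector \<Rightarrow>\<^sub>C\<^sub>L 'a \<Rightarrow> bool"
  where "Browders_theorem T \<longleftrightarrow> Weyl_spectrum T = Browder_spectrum T"

definition generalized_Browders_theorem :: "'a::complex_normed_vector \<Rightarrow>\<^sub>C\<^sub>L 'a \<Rightarrow> bool"
  where "generalized_Browders_theorem T \<longleftrightarrow> B_Weyl_spectrum T = spectrum T - resolvent_poles T"

end

theory Submission
  imports Defs "HOL-Complex_Analysis.Complex_Analysis"
begin

text \<open>
  Translating by \<open>\<mu>\<close>, all four statements can be read at the point \<open>0\<close>. The proof rests on a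
  dichotomy for an operator \<open>T\<close> that is Weyl on a closed invariant subspace \<open>M\<close>
  (\<open>Weyl_on_dichotomy\<close>): either \<open>T\<close> maps some \<open>T\<^sup>p M\<close> bijectively onto itself, or there is an
  analytic function \<open>f\<close> without zeros near \<open>0\<close> such that \<open>T (f z) = z f z\<close>. Indeed the spaces
  \<open>T\<^sup>k M\<close> are closed and \<open>T\<close> is again Weyl on each of them. If \<open>T\<close> is injective on one of them, it
  is bijective there, as its index is \<open>0\<close>. Otherwise the finite-dimensional spaces
  \<open>N(T) \<inter> T\<^sup>k M\<close> become stationary and different from \<open>0\<close>; then \<open>T\<close> maps the closed intersection
  \<open>I\<close> of all \<open>T\<^sup>k M\<close> onto itself, and the open mapping theorem gives \<open>x\<^sub>0 \<noteq> 0\<close> in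
  \<open>N(T) \<inter> I\<close> and preimages \<open>T x\<^sub>n\<^sub>+\<^sub>1 = x\<^sub>n\<close> of geometric growth, so that \<open>f z = \<Sum> z\<^sup>n x\<^sub>n\<close> works.

  In the first case \<open>M\<close> is the direct sum of \<open>T\<^sup>p M\<close> and a subspace on which \<open>T\<close> is nilpotent.
  Hence a pseudo B-Weyl operator in the first case is generalized Drazin invertible
  (\<open>generalized_Drazin_of_bij_iter\<close>), a Weyl operator in the first case is Browder, and a B-Weyl
  operator in the first case has at \<open>0\<close> a pole of the resolvent or a point of the resolvent set
  (\<open>resolvent_pole_of_bij_iter\<close>). In the second case SVEP fails at \<open>0\<close>, and \<open>T - z\<close> is not
  injective for any \<open>z\<close> near \<open>0\<close>.

  Each of the four statements excludes the second case. SVEP does so directly. A generalized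
  Drazin invertible operator, and an operator for which \<open>0\<close> is a pole, have \<open>T - z\<close> bijective for
  small \<open>z \<noteq> 0\<close>. If Browder's theorem holds and \<open>T\<close> is pseudo B-Weyl or B-Weyl, then the Weyl
  property of the part of \<open>T\<close> is stable under small perturbations (\<open>Weyl_on_stable\<close>) and passes
  from the part to the whole space for \<open>T - z\<close> with \<open>z \<noteq> 0\<close> (\<open>Weyl_on_extend\<close>); so some \<open>T - z\<close>
  is Browder, and \<open>T - z - w\<close> is bijective for small \<open>w \<noteq> 0\<close>
  (\<open>Weyl_on_bij_iter_of_Browder\<close>). Conversely, generalized Drazin invertibility gives SVEP of \<open>T\<close>
  and of its adjoint, because \<open>T - z\<close> is bijective for small \<open>z \<noteq> 0\<close> and the identity theorem
  applies.

  Invariant subspaces need not be complemented, so everything is proved relative to a closed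
  subspace. Two tools of functional analysis are developed for this: separation of points by
  bounded functionals (\<open>functional_separates\<close>) and the open mapping theorem on closed subspaces
  (\<open>bounded_preimages\<close>).
\<close>

section \<open>Linear algebra of complex subspaces\<close>

abbreviation csubspace :: "'a::complex_vector set \<Rightarrow> bool"
  where "csubspace \<equiv> complex_vector.subspace"

abbreviation cspan :: "'a::complex_vector set \<Rightarrow> 'a set"
  where "cspan \<equiv> complex_vector.span"

abbreviation cdim :: "'a::complex_vector set \<Rightarrow> nat"
  where "cdim \<equiv> complex_vector.dim"

abbreviation cindependent :: "'a::complex_vector set \<Rightarrow> bool"
  where "cindependent \<equiv> complex_vector.independent"

abbreviation clinear :: "('a::complex_vector \<Rightarrow> 'b::complex_vector) \<Rightarrow> bool"
  where "clinear \<equiv> Vector_Spaces.linear (*\<^sub>C) (*\<^sub>C)"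

abbreviation set_sum :: "'a::plus set \<Rightarrow> 'a set \<Rightarrow> 'a set"  (infixl \<open>\<boxplus>\<close> 65)
  where "A \<boxplus> B \<equiv> {x + y |x y. x \<in> A \<and> y \<in> B}"

global_interpretation complex_pair: vector_space_pair
  "scaleC :: complex \<Rightarrow> 'a \<Rightarrow> 'a::complex_vector"
  "scaleC :: complex \<Rightarrow> 'b \<Rightarrow> 'b::complex_vector"
  by unfold_locales

lemma clinearI:
  assumes "\<And>x y. f (x + y) = f x + f y" and "\<And>c x. f (c *\<^sub>C x) = c *\<^sub>C f x"
  shows "clinear f"
  using assms by (simp add: Vector_Spaces.linear_iff complex_vector.vector_space_axioms)

lemma clinear_cblinfun: "clinear (cblinfun_apply T)"
  using bounded_clinear_cblinfun[of T]
  by (intro clinearI) (auto simp: bounded_clinear_def linear_simps)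

lemma
  shows cblin_add: "cblinfun_apply T (x + y) = T x + T y"
    and cblin_diff: "cblinfun_apply T (x - y) = T x - T y"
    and cblin_neg: "cblinfun_apply T (- x) = - T x"
    and cblin_0: "cblinfun_apply T 0 = 0"
    and cblin_scaleC: "cblinfun_apply T (c *\<^sub>C x) = c *\<^sub>C T x"
    and cblin_sum: "cblinfun_apply T (sum g A) = (\<Sum>a\<in>A. T (g a))"
  using complex_pair.linear_add[OF clinear_cblinfun[of T]]
    complex_pair.linear_diff[OF clinear_cblinfun[of T]]
    complex_pair.linear_neg[OF clinear_cblinfun[of T]]
    complex_pair.linear_0[OF clinear_cblinfun[of T]]
    complex_pair.linear_scale[OF clinear_cblinfun[of T]]
    complex_pair.linear_sum[OF clinear_cblinfun[of T]]
  by auto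

lemmas cblin_simps = cblin_add cblin_diff cblin_neg cblin_0 cblin_scaleC

lemmas csub_0 = complex_vector.subspace_0
  and csub_add = complex_vector.subspace_add
  and csub_diff = complex_vector.subspace_diff
  and csub_scale = complex_vector.subspace_scale
  and csub_neg = complex_vector.subspace_neg
  and csub_inter = complex_vector.subspace_inter
  and csub_UNIV = complex_vector.subspace_UNIV

lemma csubspace_iff:
  "csubspace V \<longleftrightarrow> 0 \<in> V \<and> (\<forall>x\<in>V. \<forall>y\<in>V. x + y \<in> V) \<and> (\<forall>c. \<forall>x\<in>V. c *\<^sub>C x \<in> V)"
  by (simp add: complex_vector.subspace_def)

lemma clinear_subspace_image: "clinear f \<Longrightarrow> csubspace V \<Longrightarrow> csubspace (f ` V)"
  by (rule complex_pair.linear_subspace_image)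

lemma clinear_subspace_vimage:
  assumes "clinear f" "csubspace V" "csubspace W" shows "csubspace {x\<in>V. f x \<in> W}"
  using assms(2,3) unfolding csubspace_iff
  by (auto simp: complex_pair.linear_add[OF assms(1)] complex_pair.linear_scale[OF assms(1)]
      complex_pair.linear_0[OF assms(1)])

lemma csubspace_sum: "csubspace A \<Longrightarrow> csubspace B \<Longrightarrow> csubspace (A \<boxplus> B)"
  by (rule complex_vector.subspace_sums)

lemma fin_dim_basis:
  assumes "csubspace V" "fin_dim V"
  obtains B where "finite B" "cindependent B" "cspan B = V" "card B = cdim V"
proof -
  obtain B where B: "B \<subseteq> V" "cindependent B" "V \<subseteq> cspan B" "card B = cdim V"
    using complex_vector.basis_exists[of V] by blast
  obtain F where "finite F" "V \<subseteq> cspan F"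
    using assms(2) by (auto simp: fin_dim_def)
  then have "finite B"
    using complex_vector.independent_span_bound[of F B] B by blast
  moreover have "cspan B = V"
    using B assms(1) by (metis complex_vector.span_minimal subset_antisym)
  ultimately show ?thesis using B that by blast
qed

lemma fin_dim_subset: "V \<subseteq> W \<Longrightarrow> fin_dim W \<Longrightarrow> fin_dim V"
  unfolding fin_dim_def by blast

lemma fin_dim_image:
  assumes "clinear f" "fin_dim V" shows "fin_dim (f ` V)"
proof -
  obtain F where F: "finite F" "V \<subseteq> cspan F"
    using assms(2) by (auto simp: fin_dim_def)
  then have "f ` V \<subseteq> cspan (f ` F)"
    using complex_pair.linear_span_image[OF assms(1)] by blast
  then show ?thesis using F(1) unfolding fin_dim_def by blast
qed

lemma fin_dim_sum:
  assumes "fin_dim A" "fin_dim B" shows "fin_dim (A \<boxplus> B)"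
proof -
  obtain F G where F: "finite F" "A \<subseteq> cspan F" and G: "finite G" "B \<subseteq> cspan G"
    using assms by (auto simp: fin_dim_def)
  have "A \<boxplus> B \<subseteq> cspan (F \<union> G)"
    using F(2) G(2) by (auto simp: complex_vector.span_Un)
  then show ?thesis using F(1) G(1) unfolding fin_dim_def by blast
qed

text \<open>By induction on \<open>B\<close>: a vector of \<open>B\<close> in the span of \<open>A\<close> and the earlier vectors would differ from
  an element of their span by an element of \<open>cspan A \<inter> cspan B\<close>.\<close>

lemma independent_Un_of_span_Int:
  assumes "finite B" "cindependent A" "cindependent B" "cspan A \<inter> cspan B = {0}"
  shows "cindependent (A \<union> B) \<and> A \<inter> B = {}"
  using assms
proof (induction B)
  case empty
  then show ?case by simp
next
  case (insert b B)
  have "cspan B \<subseteq> cspan (insert b B)"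
    by (intro complex_vector.span_mono) auto
  then have "cspan A \<inter> cspan B = {0}"
    using insert.prems(3) complex_vector.span_zero by blast
  moreover have "cindependent B"
    using insert.prems(2) by (rule complex_vector.independent_mono) auto
  ultimately have IH: "cindependent (A \<union> B)" "A \<inter> B = {}"
    using insert.IH insert.prems(1) by blast+
  have bB: "b \<notin> cspan B"
    using insert.prems(2) insert.hyps(2) by (simp add: complex_vector.independent_insert)
  have "b \<notin> cspan (A \<union> B)"
  proof
    assume "b \<in> cspan (A \<union> B)"
    then obtain u v where uv: "b = u + v" "u \<in> cspan A" "v \<in> cspan B"
      by (auto simp: complex_vector.span_Un)
    have "u = b - v" using uv(1) by simp
    moreover have "v \<in> cspan (insert b B)"
      using uv(3) complex_vector.span_mono[of B "insert b B"] by blast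
    moreover have "b \<in> cspan (insert b B)"
      by (rule complex_vector.span_base) simp
    ultimately have "u \<in> cspan (insert b B)"
      using complex_vector.span_diff by metis
    with uv(2) have "u \<in> cspan A \<inter> cspan (insert b B)" by simp
    then have "u = 0" using insert.prems(3) by auto
    then show False using uv bB by simp
  qed
  moreover from this have "b \<notin> A" by (metis UnI1 complex_vector.span_base)
  ultimately show ?case
    using IH by (simp add: complex_vector.independent_insert)
qed

lemma dim_direct_sum:
  assumes A: "csubspace A" "fin_dim A" and B: "csubspace B" "fin_dim B" and AB: "A \<inter> B = {0}"
  shows "cdim (A \<boxplus> B) = cdim A + cdim B"
proof -
  obtain a where a: "finite a" "cindependent a" "cspan a = A" "card a = cdim A"
    using fin_dim_basis[OF A] .
  obtain b where b: "finite b" "cindependent b" "cspan b = B" "card b = cdim B"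
    using fin_dim_basis[OF B] .
  have ind: "cindependent (a \<union> b)" "a \<inter> b = {}"
    using independent_Un_of_span_Int[of b a] a b AB by auto
  have "cdim (A \<boxplus> B) = card (a \<union> b)"
    using complex_vector.dim_span_eq_card_independent[OF ind(1)]
    by (simp add: complex_vector.span_Un a b)
  then show ?thesis using card_Un_disjoint[OF a(1) b(1) ind(2)] a(4) b(4) by simp
qed

text \<open>Complements of \<open>U\<close> are produced as images of a linear map \<open>p\<close> that kills \<open>U\<close> and is the identity
  modulo \<open>U\<close>. Having the map and not only the complement shows that the complement is spanned by
  finitely many vectors as soon as the whole space is so modulo \<open>U\<close>.\<close>

lemma projection_along:
  assumes "csubspace U"
  shows "\<exists>p. clinear p \<and> (\<forall>x\<in>U. p x = 0) \<and> (\<forall>x. x - p x \<in> U)"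
proof -
  have "clinear (\<lambda>x::'a. x)" by (rule clinearI) auto
  then obtain g where g: "g ` UNIV \<subseteq> U" "clinear g" "\<And>v. v \<in> U \<Longrightarrow> g v = v"
    using complex_pair.linear_exists_left_inverse_on[of "\<lambda>x. x" U] assms by (auto simp: inj_on_def)
  have "clinear (\<lambda>x. x - g x)"
    by (rule clinearI)
      (simp_all add: complex_pair.linear_add[OF g(2)] complex_pair.linear_scale[OF g(2)]
        complex_vector.scale_right_diff_distrib)
  then show ?thesis using g by (intro exI[of _ "\<lambda>x. x - g x"]) auto
qed

lemma complement_of_projection:
  assumes p: "clinear p" "\<forall>x\<in>U. p x = 0" "\<forall>x. x - p x \<in> U"
    and "csubspace U" "csubspace W" "U \<subseteq> W"
  shows "csubspace (p ` W)" "p ` W \<subseteq> W" "p ` W \<inter> U = {0}" "p ` W \<boxplus> U = W"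
proof -
  show "csubspace (p ` W)" using p(1) assms(5) by (rule clinear_subspace_image)
  show pW: "p ` W \<subseteq> W"
  proof clarify
    fix x assume "x \<in> W"
    then have "x - (x - p x) \<in> W"
      using p(3)[rule_format, of x] assms(5,6) csub_diff[of W x "x - p x"] by blast
    then show "p x \<in> W" by simp
  qed
  have "y = 0" if y: "y \<in> p ` W" "y \<in> U" for y
  proof -
    obtain x where x: "y = p x" using y(1) by blast
    have "p (x - p x) = 0" using p(2,3) by blast
    then have "p x = p (p x)" by (simp add: complex_pair.linear_diff[OF p(1)])
    then show ?thesis using p(2) y(2) x by metis
  qed
  then show "p ` W \<inter> U = {0}"
    using csub_0[OF assms(4)] csub_0[OF \<open>csubspace (p ` W)\<close>]
    by blast
  show "p ` W \<boxplus> U = W"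
  proof
    show "p ` W \<boxplus> U \<subseteq> W"
      using pW assms(5,6) by (auto intro!: csub_add)
    show "W \<subseteq> p ` W \<boxplus> U"
    proof
      fix x assume "x \<in> W"
      moreover have "x = p x + (x - p x)" by simp
      ultimately show "x \<in> p ` W \<boxplus> U" using p(3)[rule_format, of x] by blast
    qed
  qed
qed

lemma subspace_complement:
  assumes "csubspace U" "csubspace W" "U \<subseteq> W"
  obtains D where "csubspace D" "D \<subseteq> W" "D \<inter> U = {0}" "D \<boxplus> U = W"
proof -
  obtain p where p: "clinear p" "\<forall>x\<in>U. p x = 0" "\<forall>x. x - p x \<in> U"
    using projection_along[OF assms(1)] by blast
  show ?thesis by (rule that) (rule complement_of_projection[OF p assms])+
qed

lemma fin_codim_complement:
  assumes "csubspace R" "csubspace M" "R \<subseteq> M" "fin_codim M R"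
  obtains D where "csubspace D" "fin_dim D" "D \<subseteq> M" "D \<inter> R = {0}" "D \<boxplus> R = M"
    "codim M R = cdim D"
proof -
  obtain p where p: "clinear p" "\<forall>x\<in>R. p x = 0" "\<forall>x. x - p x \<in> R"
    using projection_along[OF assms(1)] by blast
  note D = complement_of_projection[OF p assms(1-3)]
  obtain B where B: "finite B" "cspan (R \<union> B) = M"
    using assms(4) by (auto simp: fin_codim_def)
  have "p ` M = cspan (p ` (R \<union> B))"
    using complex_pair.linear_span_image[OF p(1)] B(2) by metis
  also have "\<dots> \<subseteq> cspan (insert 0 (p ` B))"
    using p(2) by (intro complex_vector.span_mono) auto
  finally have "fin_dim (p ` M)"
    using B(1) unfolding fin_dim_def by (intro exI[of _ "insert 0 (p ` B)"]) simp
  then have "codim M R = cdim (p ` M)"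
    by (rule codim_eq_dim_complement(2)[OF assms(1) D(1) D(3) D(4)])
  then show ?thesis
    by (rule that[OF D(1) \<open>fin_dim (p ` M)\<close> D(2) D(3) D(4)])
qed

lemma injective_on_complement:
  assumes "clinear f" "csubspace U" "U \<subseteq> V" "U \<inter> {x\<in>V. f x = 0} = {0}"
    "U \<boxplus> {x\<in>V. f x = 0} = V"
  shows "inj_on f U" "f ` U = f ` V"
proof -
  show "inj_on f U"
  proof (rule inj_onI)
    fix x y assume xy: "x \<in> U" "y \<in> U" "f x = f y"
    then have "x - y \<in> U \<inter> {x\<in>V. f x = 0}"
      using assms(2,3) csub_diff[OF assms(2)]
      by (auto simp: complex_pair.linear_diff[OF assms(1)])
    then show "x = y" using assms(4) by auto
  qed
  have "f x \<in> f ` U" if "x \<in> V" for x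
  proof -
    have "x \<in> U \<boxplus> {x\<in>V. f x = 0}" using that assms(5) by simp
    then obtain u k where "x = u + k" "u \<in> U" "f k = 0" by blast
    then show ?thesis by (simp add: complex_pair.linear_add[OF assms(1)])
  qed
  then show "f ` U = f ` V" using assms(3) by blast
qed

lemma dim_injective_image:
  assumes "clinear f" "csubspace U" "fin_dim U" "inj_on f U"
  shows "cdim (f ` U) = cdim U"
proof -
  obtain B where B: "finite B" "cindependent B" "cspan B = U" "card B = cdim U"
    using fin_dim_basis[OF assms(2,3)] .
  have "cindependent (f ` B)"
    using complex_pair.linear_independent_injective_image[OF assms(1) B(2)] B(3) assms(4) by blast
  then have "cdim (cspan (f ` B)) = card (f ` B)"
    by (rule complex_vector.dim_span_eq_card_independent)
  moreover have "cspan (f ` B) = f ` U"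
    using complex_pair.linear_span_image[OF assms(1)] B(3) by metis
  moreover have "inj_on f B"
    using assms(4) B(3) complex_vector.span_superset inj_on_subset by metis
  ultimately show ?thesis using B(4) by (simp add: card_image)
qed

lemma clinear_kernel_subspace: "clinear f \<Longrightarrow> csubspace V \<Longrightarrow> csubspace {x\<in>V. f x = 0}"
  using clinear_subspace_vimage[of f V "{0}"] by simp

lemma rank_nullity:
  assumes f: "clinear f" and V: "csubspace V" "fin_dim V"
  shows "cdim V = cdim {x\<in>V. f x = 0} + cdim (f ` V)"
proof -
  let ?K = "{x\<in>V. f x = 0}"
  have K: "csubspace ?K" using f V(1) by (rule clinear_kernel_subspace)
  obtain U where U: "csubspace U" "U \<subseteq> V" "U \<inter> ?K = {0}" "U \<boxplus> ?K = V"
    by (rule subspace_complement[OF K V(1)]) auto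
  have fd: "fin_dim U" "fin_dim ?K" using U(2) V(2) fin_dim_subset[of _ V] by auto
  have "cdim V = cdim U + cdim ?K"
    using dim_direct_sum[OF U(1) fd(1) K fd(2) U(3)] U(4) by simp
  moreover have "cdim (f ` V) = cdim U"
    using injective_on_complement[OF f U(1-4)] dim_injective_image[OF f U(1) fd(1)] by metis
  ultimately show ?thesis by simp
qed

text \<open>A complement of the kernel is the image of \<open>f ` V\<close> under a left inverse of \<open>f\<close>.\<close>

lemma fin_dim_of_kernel_image:
  assumes f: "clinear f" and V: "csubspace V" and "fin_dim {x\<in>V. f x = 0}" "fin_dim (f ` V)"
  shows "fin_dim V"
proof -
  let ?K = "{x\<in>V. f x = 0}"
  have K: "csubspace ?K" using f V(1) by (rule clinear_kernel_subspace)
  obtain U where U: "csubspace U" "U \<subseteq> V" "U \<inter> ?K = {0}" "U \<boxplus> ?K = V"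
    by (rule subspace_complement[OF K V(1)]) auto
  note inj = injective_on_complement[OF f U(1-4)]
  obtain g where g: "clinear g" "\<And>v. v \<in> U \<Longrightarrow> g (f v) = v"
    using complex_pair.linear_exists_left_inverse_on[OF f U(1) inj(1)] by blast
  have "U = g ` f ` U" using g(2) by force
  then have "fin_dim U" using fin_dim_image[OF g(1) assms(4)] inj(2) by simp
  then show ?thesis using fin_dim_sum[OF _ assms(3), of U] U(4) by simp
qed

section \<open>Separation of points by bounded functionals\<close>

text \<open>Positive homogeneity is required only as an inequality, which is easier to verify for infima; the
  equality follows by applying it to the inverse factor.\<close>

definition sublinear :: "('a::real_vector \<Rightarrow> real) \<Rightarrow> bool"
  where "sublinear q \<longleftrightarrow> (\<forall>x y. q (x + y) \<le> q x + q y) \<and> (\<forall>c\<ge>0. \<forall>x. q (c *\<^sub>R x) \<le> c * q x)"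

lemma sublinear_0: "sublinear q \<Longrightarrow> q 0 = 0"
proof -
  assume q: "sublinear q"
  have "q (0 *\<^sub>R 0) \<le> 0 * q 0" "q (0 + 0) \<le> q 0 + q 0"
    using q unfolding sublinear_def by (blast, blast)
  then show ?thesis by simp
qed

lemma sublinear_ge: "sublinear q \<Longrightarrow> - q (- x) \<le> q x"
proof -
  assume q: "sublinear q"
  have "q (x + - x) \<le> q x + q (- x)" using q unfolding sublinear_def by blast
  then show ?thesis using sublinear_0[OF q] by simp
qed

lemma sublinear_scale:
  assumes q: "sublinear q" and c: "0 \<le> c" shows "q (c *\<^sub>R x) = c * q x"
proof (cases "c = 0")
  case True
  then show ?thesis using sublinear_0[OF q] by simp
next
  case False
  have "q (inverse c *\<^sub>R (c *\<^sub>R x)) \<le> inverse c * q (c *\<^sub>R x)"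
    using q c unfolding sublinear_def by (meson inverse_nonnegative_iff_nonnegative)
  then have "c * q x \<le> q (c *\<^sub>R x)"
    using False c by (simp add: field_simps)
  moreover have "q (c *\<^sub>R x) \<le> c * q x" using q c unfolding sublinear_def by blast
  ultimately show ?thesis by simp
qed

text \<open>The value at \<open>- y\<close> is at most \<open>- q y\<close>, so the passage from \<open>q\<close> to this function makes it more
  linear in the direction \<open>y\<close>. A sublinear function that this passage does not change for any \<open>y\<close>
  is additive.\<close>

definition sublinear_shift :: "('a::real_vector \<Rightarrow> real) \<Rightarrow> 'a \<Rightarrow> 'a \<Rightarrow> real"
  where "sublinear_shift q y x = (INF t\<in>{0..}. q (x + t *\<^sub>R y) - t * q y)"

lemma sublinear_shift_bdd:
  assumes q: "sublinear q"
  shows "bdd_below ((\<lambda>t. q (x + t *\<^sub>R y) - t * q y) ` {0..})"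
proof (rule bdd_belowI2)
  fix t :: real assume "t \<in> {0..}"
  then have "q (t *\<^sub>R y) = t * q y" using sublinear_scale[OF q] by simp
  moreover have "q ((x + t *\<^sub>R y) + - x) \<le> q (x + t *\<^sub>R y) + q (- x)"
    using q unfolding sublinear_def by blast
  ultimately show "- q (- x) \<le> q (x + t *\<^sub>R y) - t * q y" by simp
qed

lemma sublinear_shift_le:
  assumes q: "sublinear q" and "0 \<le> t"
  shows "sublinear_shift q y x \<le> q (x + t *\<^sub>R y) - t * q y"
  unfolding sublinear_shift_def
  by (rule cINF_lower[OF sublinear_shift_bdd[OF q]]) (use assms in simp)

lemma sublinear_shift_greatest:
  assumes "\<And>t. 0 \<le> t \<Longrightarrow> b \<le> q (x + t *\<^sub>R y) - t * q y"
  shows "b \<le> sublinear_shift q y x"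
  unfolding sublinear_shift_def by (rule cINF_greatest) (use assms in auto)

lemma sublinear_sublinear_shift:
  assumes q: "sublinear q" shows "sublinear (sublinear_shift q y)"
  unfolding sublinear_def
proof (intro conjI allI impI)
  fix x z
  have *: "sublinear_shift q y (x + z) \<le> (q (x + s *\<^sub>R y) - s * q y) + (q (z + t *\<^sub>R y) - t * q y)"
    if st: "0 \<le> s" "0 \<le> t" for s t
  proof -
    have "sublinear_shift q y (x + z) \<le> q ((x + z) + (s + t) *\<^sub>R y) - (s + t) * q y"
      using st by (intro sublinear_shift_le[OF q]) simp
    also have "(x + z) + (s + t) *\<^sub>R y = (x + s *\<^sub>R y) + (z + t *\<^sub>R y)"
      by (simp add: algebra_simps)
    also have "q \<dots> \<le> q (x + s *\<^sub>R y) + q (z + t *\<^sub>R y)"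
      using q unfolding sublinear_def by blast
    finally show ?thesis by (simp add: algebra_simps)
  qed
  have "sublinear_shift q y (x + z) - sublinear_shift q y z \<le> sublinear_shift q y x"
  proof (rule sublinear_shift_greatest)
    fix s :: real assume s: "0 \<le> s"
    have "sublinear_shift q y (x + z) - (q (x + s *\<^sub>R y) - s * q y) \<le> sublinear_shift q y z"
      using *[OF s] by (intro sublinear_shift_greatest) (simp add: algebra_simps)
    then show "sublinear_shift q y (x + z) - sublinear_shift q y z \<le> q (x + s *\<^sub>R y) - s * q y"
      by simp
  qed
  then show "sublinear_shift q y (x + z) \<le> sublinear_shift q y x + sublinear_shift q y z" by simp
next
  fix c :: real and x assume c: "0 \<le> c"
  show "sublinear_shift q y (c *\<^sub>R x) \<le> c * sublinear_shift q y x"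
  proof (cases "c = 0")
    case True
    then show ?thesis
      using sublinear_shift_le[OF q, of 0 y 0] sublinear_0[OF q] by simp
  next
    case False
    have "inverse c * sublinear_shift q y (c *\<^sub>R x) \<le> sublinear_shift q y x"
    proof (rule sublinear_shift_greatest)
      fix t :: real assume t: "0 \<le> t"
      have "sublinear_shift q y (c *\<^sub>R x) \<le> q (c *\<^sub>R x + (c * t) *\<^sub>R y) - (c * t) * q y"
        using t c by (intro sublinear_shift_le[OF q]) simp
      also have "c *\<^sub>R x + (c * t) *\<^sub>R y = c *\<^sub>R (x + t *\<^sub>R y)"
        by (simp add: algebra_simps)
      also have "q \<dots> = c * q (x + t *\<^sub>R y)" by (rule sublinear_scale[OF q c])
      finally show "inverse c * sublinear_shift q y (c *\<^sub>R x) \<le> q (x + t *\<^sub>R y) - t * q y"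
        using False c by (simp add: field_simps)
    qed
    then show ?thesis using False c by (simp add: field_simps)
  qed
qed

text \<open>Zorn's lemma for the reversed pointwise order: the pointwise infimum of a chain is finite, since all
  its members are at least \<open>- p (- x)\<close> at \<open>x\<close>, and it is sublinear because any two members have a
  common lower bound in the chain.\<close>

lemma minimal_sublinear_exists:
  assumes p: "sublinear p"
  obtains m where "sublinear m" "m \<le> p" "\<And>q. sublinear q \<Longrightarrow> q \<le> m \<Longrightarrow> q = m"
proof -
  define A where "A = {q. sublinear q \<and> q \<le> p}"
  define P where "P = (\<lambda>a b :: 'a \<Rightarrow> real. b \<le> a)"
  have "\<exists>m\<in>A. \<forall>a\<in>A. P m a \<longrightarrow> a = m"
  proof (rule predicate_Zorn)
    show "partial_order_on A (relation_of P A)"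
      by (auto simp: partial_order_on_def preorder_on_def refl_on_def trans_def antisym_def
          relation_of_def P_def)
    fix C assume C: "C \<in> Chains (relation_of P A)"
    then have CA: "C \<subseteq> A" unfolding Chains_def relation_of_def by auto
    have tot: "a \<le> b \<or> b \<le> a" if "a \<in> C" "b \<in> C" for a b
      using C that unfolding Chains_def relation_of_def P_def by auto
    show "\<exists>u\<in>A. \<forall>a\<in>C. P a u"
    proof (cases "C = {}")
      case True
      then show ?thesis using p by (auto simp: A_def)
    next
      case False
      define u where "u x = (INF q\<in>C. q x)" for x
      have bdd: "bdd_below ((\<lambda>q. q x) ` C)" for x
      proof (rule bdd_belowI2)
        fix q assume "q \<in> C"
        then have "sublinear q" "q (- x) \<le> p (- x)" using CA by (auto simp: A_def le_fun_def)
        then show "- p (- x) \<le> q x" using sublinear_ge[of q x] by linarith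
      qed
      have u_le: "u x \<le> q x" if "q \<in> C" for q x
        unfolding u_def by (rule cINF_lower[OF bdd that])
      have u_gr: "b \<le> u x" if "\<And>q. q \<in> C \<Longrightarrow> b \<le> q x" for b x
        unfolding u_def by (rule cINF_greatest[OF False that])
      have "sublinear u"
        unfolding sublinear_def
      proof (intro conjI allI impI)
        fix x y
        have *: "u (x + y) \<le> q1 x + q2 y" if q12: "q1 \<in> C" "q2 \<in> C" for q1 q2
        proof -
          obtain q where q: "q \<in> C" "q \<le> q1" "q \<le> q2"
            using tot[OF q12] q12 by blast
          then have "sublinear q" using CA by (auto simp: A_def)
          then have "q (x + y) \<le> q x + q y" unfolding sublinear_def by blast
          also have "\<dots> \<le> q1 x + q2 y" using q(2,3) by (intro add_mono) (auto simp: le_fun_def)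
          finally show ?thesis using u_le[OF q(1), of "x + y"] by linarith
        qed
        have "u (x + y) - u y \<le> u x"
        proof (rule u_gr)
          fix q1 assume q1: "q1 \<in> C"
          have "u (x + y) - q1 x \<le> u y"
            using *[OF q1] by (intro u_gr) (simp add: algebra_simps)
          then show "u (x + y) - u y \<le> q1 x" by simp
        qed
        then show "u (x + y) \<le> u x + u y" by simp
      next
        fix c :: real and x assume c: "0 \<le> c"
        show "u (c *\<^sub>R x) \<le> c * u x"
        proof (cases "c = 0")
          case True
          obtain q where q: "q \<in> C" using False by blast
          then have "sublinear q" using CA by (auto simp: A_def)
          then show ?thesis using True u_le[OF q, of 0] sublinear_0[of q] by simp
        next
          case False
          have "inverse c * u (c *\<^sub>R x) \<le> u x"
          proof (rule u_gr)
            fix q assume q: "q \<in> C"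
            then have "sublinear q" using CA by (auto simp: A_def)
            then have "q (c *\<^sub>R x) = c * q x" using c by (rule sublinear_scale)
            then show "inverse c * u (c *\<^sub>R x) \<le> q x"
              using u_le[OF q, of "c *\<^sub>R x"] False c by (simp add: field_simps)
          qed
          then show ?thesis using False c by (simp add: field_simps)
        qed
      qed
      moreover have "u \<le> p"
      proof -
        obtain q where q: "q \<in> C" using False by blast
        then have "q \<le> p" using CA by (auto simp: A_def)
        then show ?thesis using u_le[OF q] by (auto simp: le_fun_def intro: order_trans)
      qed
      ultimately have "u \<in> A" by (simp add: A_def)
      then show ?thesis using u_le by (auto simp: P_def le_fun_def)
    qed
  qed
  then obtain m where m: "m \<in> A" "\<forall>a\<in>A. a \<le> m \<longrightarrow> a = m" unfolding P_def by blast
  have "q = m" if "sublinear q" "q \<le> m" for q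
    using m that by (auto simp: A_def dest: order_trans)
  then show ?thesis using m(1) that[of m] by (auto simp: A_def)
qed

text \<open>By minimality \<open>sublinear_shift m y = m\<close> for every \<open>y\<close>; comparing values for the parameter \<open>t = 1\<close>
  gives superadditivity.\<close>

lemma minimal_sublinear_linear:
  fixes m :: "'a::real_vector \<Rightarrow> real"
  assumes m: "sublinear m" and min: "\<And>q. sublinear q \<Longrightarrow> q \<le> m \<Longrightarrow> q = m"
  shows "linear m"
proof -
  have shift: "sublinear_shift m y = m" for y
  proof (rule min)
    show "sublinear (sublinear_shift m y)" using m by (rule sublinear_sublinear_shift)
    show "sublinear_shift m y \<le> m"
      using sublinear_shift_le[OF m, of 0 y] by (simp add: le_fun_def)
  qed
  have add: "m (x + y) = m x + m y" for x y
  proof (rule antisym)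
    show "m (x + y) \<le> m x + m y" using m unfolding sublinear_def by blast
    show "m x + m y \<le> m (x + y)"
      using sublinear_shift_le[OF m, of 1 y x] shift[of y] by simp
  qed
  have neg: "m (- x) = - m x" for x
    using add[of x "- x"] sublinear_0[OF m] by simp
  show ?thesis
  proof (rule linearI)
    show "m (x + y) = m x + m y" for x y by (rule add)
    fix c x
    show "m (c *\<^sub>R x) = c *\<^sub>R m x"
    proof (cases "0 \<le> c")
      case True
      then show ?thesis using sublinear_scale[OF m] by simp
    next
      case False
      have "m (c *\<^sub>R x) = m (- ((- c) *\<^sub>R x))" by simp
      also have "\<dots> = - m ((- c) *\<^sub>R x)" by (rule neg)
      also have "m ((- c) *\<^sub>R x) = (- c) * m x"
        using False by (intro sublinear_scale[OF m]) simp
      finally show ?thesis by simp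
    qed
  qed
qed

text \<open>The sublinear function \<open>sublinear_shift norm x0\<close> lies below the norm and is at most \<open>- norm x0\<close> at
  \<open>- x0\<close>. Any linear functional below it is therefore bounded and at least \<open>norm x0\<close> at \<open>x0\<close>.\<close>

lemma real_functional_separates:
  fixes x0 :: "'a::real_normed_vector"
  assumes "x0 \<noteq> 0"
  obtains f :: "'a \<Rightarrow> real" where "bounded_linear f" "f x0 \<noteq> 0"
proof -
  have "sublinear (norm :: 'a \<Rightarrow> real)"
    unfolding sublinear_def by (auto simp: norm_triangle_ineq)
  note shift = sublinear_sublinear_shift[OF this, of x0] sublinear_shift_le[OF this, of _ x0]
  obtain m where m: "sublinear m" "m \<le> sublinear_shift norm x0"
      "\<And>q. sublinear q \<Longrightarrow> q \<le> m \<Longrightarrow> q = m"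
    using minimal_sublinear_exists[OF shift(1)] by blast
  have lin: "linear m" using m(1,3) by (rule minimal_sublinear_linear)
  have le: "m x \<le> norm x" for x
    using m(2) shift(2)[of 0 x] by (simp add: le_fun_def) (meson order_trans)
  have "\<bar>m x\<bar> \<le> norm x" for x
    using le[of x] le[of "- x"] linear_neg[OF lin, of x] by simp
  then have "bounded_linear m"
    using lin by (intro bounded_linear_intro[where K = 1])
      (auto simp: linear_add linear_scale)
  moreover have "m (- x0) \<le> - norm x0"
    using m(2) shift(2)[of 1 "- x0"] by (simp add: le_fun_def) (smt (verit, best))
  then have "m x0 \<noteq> 0"
    using assms linear_neg[OF lin, of x0] by auto
  ultimately show ?thesis by (rule that)
qed

lemma bounded_clinear_CBlinfun_apply:
  "bounded_clinear f \<Longrightarrow> cblinfun_apply (CBlinfun f) = f"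
  by (simp add: CBlinfun_inverse)

text \<open>The complex functional \<open>f x - \<i> f (\<i> x)\<close> has the separating real functional \<open>f\<close> as its real
  part.\<close>

lemma functional_separates:
  fixes x0 :: "'a::complex_normed_vector"
  assumes "x0 \<noteq> 0"
  obtains \<phi> :: "'a \<Rightarrow>\<^sub>C\<^sub>L complex" where "\<phi> x0 \<noteq> 0"
proof -
  obtain f :: "'a \<Rightarrow> real" where f: "bounded_linear f" "f x0 \<noteq> 0"
    using real_functional_separates[OF assms] .
  interpret f: bounded_linear f by fact
  define g where "g x = Complex (f x) (- f (\<i> *\<^sub>C x))" for x
  have lin: "g (x + y) = g x + g y" for x y
    by (simp add: g_def complex_eq_iff f.add scaleC_add_right)
  have fr: "f (complex_of_real r *\<^sub>C x) = r * f x" for r x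
    using f.scaleR[of r x] by (simp add: scaleR_scaleC)
  have sc: "g (c *\<^sub>C x) = c *\<^sub>C g x" for c x
  proof -
    have c: "c = complex_of_real (Re c) + \<i> * complex_of_real (Im c)" by (simp add: complex_eq_iff)
    have "c *\<^sub>C x = complex_of_real (Re c) *\<^sub>C x + complex_of_real (Im c) *\<^sub>C \<i> *\<^sub>C x"
      by (subst c, subst scaleC_add_left) (simp add: scaleC_scaleC mult.commute)
    then have 1: "f (c *\<^sub>C x) = Re c * f x + Im c * f (\<i> *\<^sub>C x)"
      by (simp only: f.add fr)
    have "\<i> * c = complex_of_real (- Im c) + complex_of_real (Re c) * \<i>"
      by (simp add: complex_eq_iff)
    then have "\<i> *\<^sub>C c *\<^sub>C x = complex_of_real (- Im c) *\<^sub>C x + complex_of_real (Re c) *\<^sub>C \<i> *\<^sub>C x"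
      by (simp only: scaleC_scaleC scaleC_add_left)
    then have 2: "f (\<i> *\<^sub>C c *\<^sub>C x) = - Im c * f x + Re c * f (\<i> *\<^sub>C x)"
      by (simp only: f.add fr)
    show ?thesis
      unfolding g_def 1 2 by (simp add: complex_eq_iff scaleC_complex_def)
  qed
  obtain K where K: "\<And>x. norm (f x) \<le> norm x * K" using f.bounded by blast
  have "norm (g x) \<le> norm x * (K + K)" for x
  proof -
    have "norm (g x) \<le> \<bar>f x\<bar> + \<bar>f (\<i> *\<^sub>C x)\<bar>"
      unfolding g_def by (rule order_trans[OF cmod_le]) simp
    also have "\<dots> \<le> norm x * K + norm (\<i> *\<^sub>C x) * K"
      using K[of x] K[of "\<i> *\<^sub>C x"] by simp
    also have "\<dots> = norm x * (K + K)" by (simp add: norm_scaleC algebra_simps)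
    finally show ?thesis .
  qed
  then have "bounded_clinear g"
    unfolding bounded_clinear_def
    by (intro conjI bounded_linear_intro[where K = "K + K"] allI) (simp_all add: lin sc scaleR_scaleC)
  then have "cblinfun_apply (CBlinfun g) x0 \<noteq> 0"
    using f(2) by (simp add: bounded_clinear_CBlinfun_apply g_def complex_eq_iff)
  then show ?thesis by (rule that)
qed

lemma cblinfun_sum_apply: "cblinfun_apply (\<Sum>i\<in>A. F i) x = (\<Sum>i\<in>A. cblinfun_apply (F i) x)"
  by (induction A rule: infinite_finite_induct)
    (auto simp: zero_cblinfun.rep_eq plus_cblinfun.rep_eq)

text \<open>Adding a vector \<open>e\<close>, the component \<open>u\<close> of \<open>e\<close> on which all previous functionals vanish is not zero.
  A functional with value \<open>1\<close> at \<open>u\<close> is corrected to vanish on the previous vectors, and then the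
  previous functionals are corrected to vanish at \<open>e\<close>.\<close>

lemma dual_basis:
  fixes B :: "'a::complex_normed_vector set"
  assumes "finite B" "cindependent B"
  shows "\<exists>\<phi>. \<forall>b\<in>B. \<forall>c\<in>B. cblinfun_apply (\<phi> b :: 'a \<Rightarrow>\<^sub>C\<^sub>L complex) c = (if b = c then 1 else 0)"
  using assms
proof (induction B)
  case empty
  then show ?case by simp
next
  case (insert e B)
  have "cindependent B" using insert.prems by (rule complex_vector.independent_mono) auto
  then obtain \<phi> :: "'a \<Rightarrow> 'a \<Rightarrow>\<^sub>C\<^sub>L complex" where
    \<phi>: "\<And>b c. b \<in> B \<Longrightarrow> c \<in> B \<Longrightarrow> \<phi> b c = (if b = c then 1 else 0)"
    using insert.IH by blast
  define u where "u = e - (\<Sum>b\<in>B. \<phi> b e *\<^sub>C b)"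
  have "e \<notin> cspan B" using insert by (simp add: complex_vector.independent_insert)
  moreover have "(\<Sum>b\<in>B. \<phi> b e *\<^sub>C b) \<in> cspan B"
    by (intro complex_vector.span_sum complex_vector.span_scale complex_vector.span_base)
  ultimately have "u \<noteq> 0" unfolding u_def by auto
  then obtain \<psi>0 :: "'a \<Rightarrow>\<^sub>C\<^sub>L complex" where \<psi>0: "\<psi>0 u \<noteq> 0" by (rule functional_separates)
  define \<psi> where "\<psi> = (1 / \<psi>0 u) *\<^sub>C \<psi>0"
  have \<psi>: "\<psi> u = 1" using \<psi>0 by (simp add: \<psi>_def scaleC_cblinfun.rep_eq scaleC_complex_def)
  define \<eta> where "\<eta> = \<psi> - (\<Sum>b\<in>B. \<psi> b *\<^sub>C \<phi> b)"
  have \<eta>: "\<eta> x = \<psi> x - (\<Sum>b\<in>B. \<psi> b * \<phi> b x)" for x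
    by (simp add: \<eta>_def minus_cblinfun.rep_eq cblinfun_sum_apply scaleC_cblinfun.rep_eq
        scaleC_complex_def)
  have \<eta>B: "\<eta> c = 0" if "c \<in> B" for c
  proof -
    have "(\<Sum>b\<in>B. \<psi> b * \<phi> b c) = (\<Sum>b\<in>B. if b = c then \<psi> b else 0)"
      using \<phi> that by (intro sum.cong) auto
    then show ?thesis using that insert.hyps(1) by (simp add: \<eta> sum.delta)
  qed
  have \<eta>e: "\<eta> e = 1"
    using \<psi> by (simp add: \<eta> u_def cblin_diff cblin_sum cblin_scaleC scaleC_complex_def mult.commute)
  define \<phi>' where "\<phi>' b = (if b = e then \<eta> else \<phi> b - \<phi> b e *\<^sub>C \<eta>)" for b
  have "\<phi>' b c = (if b = c then 1 else 0)" if bc: "b \<in> insert e B" "c \<in> insert e B" for b c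
    using bc insert.hyps(2) \<phi> \<eta>B \<eta>e
    by (auto simp: \<phi>'_def minus_cblinfun.rep_eq scaleC_cblinfun.rep_eq scaleC_complex_def)
  then show ?case by blast
qed

lemma dual_basis_expansion:
  fixes B :: "'a::complex_normed_vector set"
  assumes "finite B"
    and \<phi>: "\<And>b c. b \<in> B \<Longrightarrow> c \<in> B \<Longrightarrow> cblinfun_apply (\<phi> b) c = (if b = c then 1 else 0)"
    and "x \<in> cspan B"
  shows "x = (\<Sum>b\<in>B. \<phi> b x *\<^sub>C b)"
proof -
  have "clinear (\<lambda>x. \<Sum>b\<in>B. \<phi> b x *\<^sub>C b)"
    by (rule clinearI)
      (simp_all add: cblin_simps scaleC_add_left sum.distrib complex_vector.scale_sum_right
        scaleC_complex_def scaleC_scaleC)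
  moreover have "clinear (\<lambda>x::'a. x)" by (rule clinearI) auto
  moreover have "c = (\<Sum>b\<in>B. \<phi> b c *\<^sub>C b)" if "c \<in> B" for c
  proof -
    have "(\<Sum>b\<in>B. \<phi> b c *\<^sub>C b) = (\<Sum>b\<in>B. if b = c then b else 0)"
      using \<phi> that by (intro sum.cong) (auto simp: scaleC_one)
    then show ?thesis using that assms(1) by (simp add: sum.delta)
  qed
  ultimately show ?thesis
    using complex_pair.linear_eq_on[of "\<lambda>x. x" "\<lambda>x. \<Sum>b\<in>B. \<phi> b x *\<^sub>C b" x B] assms(3) by blast
qed

lemma continuous_on_cblinfun [continuous_intros]:
  "continuous_on S f \<Longrightarrow> continuous_on S (\<lambda>x. cblinfun_apply T (f x))"
  by (rule bounded_linear.continuous_on[OF bounded_linear_cblinfun])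

lemma bounded_linear_scaleC_left: "bounded_linear (\<lambda>c. c *\<^sub>C (x::'a::complex_normed_vector))"
  by (rule bounded_linear_intro[where K = "norm x"])
    (auto simp: scaleC_add_left norm_scaleC scaleR_scaleC scaleC_scaleC scaleC_complex_def)

text \<open>The dual basis describes \<open>V\<close> by the equation \<open>x = (\<Sum>b\<in>B. \<phi> b x *\<^sub>C b)\<close>, both sides of which are
  continuous.\<close>

lemma fin_dim_closed:
  fixes V :: "'a::complex_normed_vector set"
  assumes "csubspace V" "fin_dim V"
  shows "closed V"
proof -
  obtain B where B: "finite B" "cindependent B" "cspan B = V"
    using fin_dim_basis[OF assms] by blast
  obtain \<phi> :: "'a \<Rightarrow> 'a \<Rightarrow>\<^sub>C\<^sub>L complex" where
    \<phi>: "\<And>b c. b \<in> B \<Longrightarrow> c \<in> B \<Longrightarrow> \<phi> b c = (if b = c then 1 else 0)"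
    using dual_basis[OF B(1,2)] by blast
  have "V = {x. x = (\<Sum>b\<in>B. \<phi> b x *\<^sub>C b)}"
  proof (intro equalityI subsetI CollectI)
    fix x assume "x \<in> V"
    then show "x = (\<Sum>b\<in>B. \<phi> b x *\<^sub>C b)"
      using dual_basis_expansion[OF B(1), of \<phi> x] \<phi> B(3) by blast
  next
    fix x assume "x \<in> {x. x = (\<Sum>b\<in>B. \<phi> b x *\<^sub>C b)}"
    moreover have "(\<Sum>b\<in>B. \<phi> b x *\<^sub>C b) \<in> cspan B"
      by (intro complex_vector.span_sum complex_vector.span_scale complex_vector.span_base)
    ultimately show "x \<in> V" using B(3) by simp
  qed
  moreover have "closed {x. x = (\<Sum>b\<in>B. \<phi> b x *\<^sub>C b)}"
    by (intro closed_Collect_eq continuous_intros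
        bounded_linear.continuous_on[OF bounded_linear_scaleC_left])
  ultimately show ?thesis by simp
qed

section \<open>The open mapping theorem on closed subspaces\<close>

lemma csubspace_imp_subspace: "csubspace M \<Longrightarrow> subspace M"
  unfolding subspace_def by (auto simp: csubspace_iff scaleR_scaleC)

lemma completely_metrizable_closed:
  fixes R :: "'a::complete_space set"
  assumes "closed R" shows "completely_metrizable_space (top_of_set R)"
proof -
  have "completely_metrizable_space (euclidean :: 'a topology)"
    by (rule completely_metrizable_space_euclidean)
  then show ?thesis
    using assms by (intro completely_metrizable_space_closedin) auto
qed

text \<open>By Baire's theorem in the closed space \<open>f ` M\<close>, the closure of the image of some ball contains a
  relative ball. Its points \<open>y0 + z\<close> and \<open>y0\<close> are approximated by images of the ball, so \<open>z\<close> is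
  approximated by differences of such images. An error relative to \<open>norm y\<close> is what makes successive
  approximation converge.\<close>

lemma almost_open_image:
  fixes f :: "'a::banach \<Rightarrow> 'b::banach"
  assumes f: "bounded_linear f" and M: "subspace M" and R: "closed (f ` M)"
  obtains K where "K > 0"
    "\<And>y. y \<in> f ` M \<Longrightarrow> \<exists>x\<in>M. norm x \<le> K * norm y \<and> norm (f x - y) \<le> norm y / 2"
proof -
  interpret f: bounded_linear f by fact
  define R where "R = f ` M"
  have Rsub: "subspace R" unfolding R_def
    using M f.linear_axioms linear_subspace_image by blast
  define C where "C n = R \<inter> closure (f ` (M \<inter> cball 0 (real n)))" for n
  have "\<exists>n. top_of_set R interior_of C n \<noteq> {}"
  proof (rule ccontr)
    assume "\<not> ?thesis"
    then have "top_of_set R interior_of \<Union>(range C) = {}"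
      using completely_metrizable_closed[OF R] unfolding R_def[symmetric]
      by (intro Baire_category_alt) (auto simp: C_def closedin_closed)
    moreover have "\<Union>(range C) = R"
    proof
      show "R \<subseteq> \<Union>(range C)"
      proof
        fix y assume "y \<in> R"
        then obtain x where x: "x \<in> M" "y = f x" by (auto simp: R_def)
        obtain n where "norm x \<le> real n" using real_arch_simple by blast
        then have "y \<in> C n"
          using x \<open>y \<in> R\<close> closure_subset[of "f ` (M \<inter> cball 0 (real n))"] by (auto simp: C_def)
        then show "y \<in> \<Union>(range C)" by blast
      qed
    qed (auto simp: C_def)
    moreover have "top_of_set R interior_of R = R"
      using interior_of_topspace[of "top_of_set R"] by simp
    moreover have "0 \<in> R" using Rsub by (rule subspace_0)
    ultimately show False by simp
  qed
  then obtain n y0 where "y0 \<in> top_of_set R interior_of C n" by blast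
  then obtain U where U: "openin (top_of_set R) U" "y0 \<in> U" "U \<subseteq> C n"
    by (auto simp: interior_of_def)
  then have y0R: "y0 \<in> R" by (auto simp: C_def)
  obtain e where e: "e > 0" "ball y0 e \<inter> R \<subseteq> U"
    using U(1,2) unfolding openin_contains_ball by blast
  have approx: "\<exists>x\<in>M. norm x \<le> real n \<and> norm (f x - z) < d" if "z \<in> R" "dist y0 z < e" "d > 0" for z d
  proof -
    have "z \<in> closure (f ` (M \<inter> cball 0 (real n)))"
      using e(2) U(3) that(1,2) unfolding C_def by (auto simp: subset_iff)
    then obtain w where "w \<in> f ` (M \<inter> cball 0 (real n))" "dist w z < d"
      using \<open>d > 0\<close> closure_approachable by blast
    then show ?thesis by (auto simp: dist_norm)
  qed
  define K where "K = (2 * real n + 1) * (2 / e)"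
  have "K > 0" using e(1) by (simp add: K_def)
  moreover have "\<exists>x\<in>M. norm x \<le> K * norm y \<and> norm (f x - y) \<le> norm y / 2" if y: "y \<in> f ` M" for y
  proof (cases "y = 0")
    case True
    then show ?thesis using subspace_0[OF M] by (intro bexI[of _ 0]) auto
  next
    case False
    define c where "c = e / (2 * norm y)"
    have c: "c > 0" using e(1) False by (simp add: c_def)
    have cy: "c *\<^sub>R y \<in> R" using y Rsub by (simp add: R_def subspace_scale)
    have ncy: "norm (c *\<^sub>R y) = e / 2" using c False e(1) by (simp add: c_def)
    define d where "d = c * norm y / 4"
    have d: "d > 0" using c False by (simp add: d_def)
    obtain u where u: "u \<in> M" "norm u \<le> real n" "norm (f u - (y0 + c *\<^sub>R y)) < d"
      using approx[of "y0 + c *\<^sub>R y" d] y0R cy Rsub d ncy e(1)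
      by (auto simp: subspace_add dist_norm)
    obtain v where v: "v \<in> M" "norm v \<le> real n" "norm (f v - y0) < d"
      using approx[of y0 d] y0R d e(1) by auto
    define x where "x = inverse c *\<^sub>R (u - v)"
    have "x \<in> M" using u(1) v(1) M by (simp add: x_def subspace_diff subspace_scale)
    moreover have "norm x \<le> K * norm y"
    proof -
      have "norm x = inverse c * norm (u - v)" using c by (simp add: x_def)
      also have "\<dots> \<le> inverse c * (2 * real n + 1)"
        using c u(2) v(2) norm_triangle_ineq4[of u v] by (intro mult_left_mono) auto
      also have "\<dots> = K * norm y" by (simp add: K_def c_def)
      finally show ?thesis .
    qed
    moreover have "norm (f x - y) \<le> norm y / 2"
    proof -
      have "f x - y = inverse c *\<^sub>R ((f u - (y0 + c *\<^sub>R y)) - (f v - y0))"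
        using c by (simp add: x_def f.scaleR f.diff algebra_simps)
      then have "norm (f x - y) = inverse c * norm ((f u - (y0 + c *\<^sub>R y)) - (f v - y0))"
        using c by simp
      also have "\<dots> \<le> inverse c * (2 * d)"
        using c u(3) v(3) norm_triangle_ineq4[of "f u - (y0 + c *\<^sub>R y)" "f v - y0"]
        by (intro mult_left_mono) auto
      also have "\<dots> = norm y / 2" using c by (simp add: d_def)
      finally show ?thesis .
    qed
    ultimately show ?thesis by blast
  qed
  ultimately show ?thesis by (rule that)
qed

text \<open>Applying the approximate solution repeatedly to the remaining error \<open>r k\<close> halves the error each
  time; the corrections \<open>g (r k)\<close> form a geometric series whose sum is an exact preimage.\<close>

lemma bounded_preimages:
  fixes f :: "'a::banach \<Rightarrow> 'b::banach"
  assumes f: "bounded_linear f" and M: "subspace M" "closed M" and R: "closed (f ` M)"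
  obtains K where "K > 0" "\<And>y. y \<in> f ` M \<Longrightarrow> \<exists>x\<in>M. f x = y \<and> norm x \<le> K * norm y"
proof -
  interpret f: bounded_linear f by fact
  obtain K where K: "K > 0"
    "\<And>y. y \<in> f ` M \<Longrightarrow> \<exists>x\<in>M. norm x \<le> K * norm y \<and> norm (f x - y) \<le> norm y / 2"
    using almost_open_image[OF f M(1) R] by blast
  then obtain g where g: "\<And>y. y \<in> f ` M \<Longrightarrow> g y \<in> M"
    "\<And>y. y \<in> f ` M \<Longrightarrow> norm (g y) \<le> K * norm y"
    "\<And>y. y \<in> f ` M \<Longrightarrow> norm (f (g y) - y) \<le> norm y / 2"
    by metis
  have Rsub: "subspace (f ` M)"
    using M(1) f.linear_axioms linear_subspace_image by blast
  have "\<exists>x\<in>M. f x = y \<and> norm x \<le> (2 * K) * norm y" if y: "y \<in> f ` M" for y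
  proof -
    define r where "r k = ((\<lambda>z. z - f (g z)) ^^ k) y" for k
    have r0: "r 0 = y" and rS: "r (Suc k) = r k - f (g (r k))" for k by (simp_all add: r_def)
    have rR: "r k \<in> f ` M" for k
      by (induction k) (use y g(1) Rsub in \<open>auto simp: r0 rS intro!: subspace_diff\<close>)
    have rn: "norm (r k) \<le> norm y * (1/2) ^ k" for k
    proof (induction k)
      case (Suc k)
      have "norm (r (Suc k)) \<le> norm (r k) / 2"
        using g(3)[OF rR[of k]] by (simp add: rS norm_minus_commute)
      then show ?case using Suc by simp
    qed (simp add: r0)
    have gn: "norm (g (r k)) \<le> K * norm y * (1/2) ^ k" for k
    proof -
      have "norm (g (r k)) \<le> K * norm (r k)" by (rule g(2)[OF rR])
      also have "\<dots> \<le> K * (norm y * (1/2) ^ k)" using rn K(1) by (intro mult_left_mono) auto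
      finally show ?thesis by (simp add: mult.assoc)
    qed
    have geo: "(\<lambda>k. K * norm y * (1/2) ^ k) sums (K * norm y * 2)"
      using sums_mult[OF geometric_sums[of "1/2 :: real"], of "K * norm y"] by simp
    have sn: "summable (\<lambda>k. norm (g (r k)))"
      by (rule summable_comparison_test'[OF sums_summable[OF geo], of 0]) (use gn in simp)
    have s: "summable (\<lambda>k. g (r k))" using sn by (rule summable_norm_cancel)
    define x where "x = (\<Sum>k. g (r k))"
    have lim: "(\<lambda>n. \<Sum>k<n. g (r k)) \<longlonglongrightarrow> x"
      using s unfolding x_def by (rule summable_LIMSEQ)
    have "x \<in> M"
      by (rule closed_sequentially[OF M(2) _ lim])
        (intro subspace_sum[OF M(1)] g(1) rR)
    moreover have "f x = y"
    proof (rule LIMSEQ_unique)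
      show "(\<lambda>n. f (\<Sum>k<n. g (r k))) \<longlonglongrightarrow> f x" by (rule f.tendsto[OF lim])
      have "f (\<Sum>k<n. g (r k)) = y - r n" for n
        by (induction n) (simp_all add: f.add r0 rS)
      moreover have "(\<lambda>n. norm y * (1/2) ^ n) \<longlonglongrightarrow> norm y * 0"
        by (intro tendsto_mult_left LIMSEQ_realpow_zero) auto
      then have "(\<lambda>n. norm y * (1/2) ^ n) \<longlonglongrightarrow> 0" by simp
      then have "r \<longlonglongrightarrow> 0"
        by (rule Lim_null_comparison[rotated]) (rule always_eventually, rule allI, rule rn)
      then have "(\<lambda>n. y - r n) \<longlonglongrightarrow> y - 0" by (intro tendsto_diff tendsto_const)
      ultimately show "(\<lambda>n. f (\<Sum>k<n. g (r k))) \<longlonglongrightarrow> y" by simp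
    qed
    moreover have "norm x \<le> (2 * K) * norm y"
    proof -
      have "norm x \<le> (\<Sum>k. norm (g (r k)))" unfolding x_def using sn by (rule summable_norm)
      also have "\<dots> \<le> (\<Sum>k. K * norm y * (1/2) ^ k)"
        by (rule suminf_le[OF gn sn sums_summable[OF geo]])
      also have "\<dots> = K * norm y * 2" using sums_unique[OF geo] by simp
      finally show ?thesis by simp
    qed
    ultimately show ?thesis by blast
  qed
  then show ?thesis using that[of "2 * K"] K(1) by simp
qed

lemma subspace_Times: "subspace A \<Longrightarrow> subspace B \<Longrightarrow> subspace (A \<times> B)"
  unfolding subspace_def by (auto simp: zero_prod_def)

text \<open>The map \<open>(x, c) \<mapsto> f x + c\<close> on \<open>M \<times> C\<close> has bounded preimages, and the component \<open>c\<close> of a preimage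
  is determined by the sum because \<open>C\<close> meets \<open>f ` M\<close> only in \<open>0\<close>.\<close>

lemma complementary_component_bound:
  fixes f :: "'a::banach \<Rightarrow> 'b::banach"
  assumes f: "bounded_linear f" and M: "subspace M" "closed M"
    and C: "subspace C" "closed C" "C \<inter> f ` M = {0}" and sum: "closed (f ` M \<boxplus> C)"
  obtains K where "K > 0" "\<And>x c. x \<in> M \<Longrightarrow> c \<in> C \<Longrightarrow> norm c \<le> K * norm (f x + c)"
proof -
  interpret f: bounded_linear f by fact
  define h where "h = (\<lambda>p. f (fst p) + snd p)"
  have h: "bounded_linear h" unfolding h_def
    by (intro bounded_linear_add bounded_linear_compose[OF f] bounded_linear_fst bounded_linear_snd)
  have im: "h ` (M \<times> C) = f ` M \<boxplus> C" by (force simp: h_def)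
  obtain K where K: "K > 0" "\<And>y. y \<in> h ` (M \<times> C) \<Longrightarrow> \<exists>x\<in>M \<times> C. h x = y \<and> norm x \<le> K * norm y"
    using bounded_preimages[OF h subspace_Times[OF M(1) C(1)] closed_Times[OF M(2) C(2)]] sum im
    by metis
  have "norm c \<le> K * norm (f x + c)" if xc: "x \<in> M" "c \<in> C" for x c
  proof -
    have "f x + c \<in> h ` (M \<times> C)" unfolding im using xc by blast
    then obtain q where q: "q \<in> M \<times> C" "h q = f x + c" "norm q \<le> K * norm (f x + c)"
      using K(2) by blast
    obtain x' c' where "q = (x', c')" by fastforce
    with q have x': "x' \<in> M" "c' \<in> C" "f x' + c' = f x + c"
        "norm (x', c') \<le> K * norm (f x + c)"
      by (auto simp: h_def)
    have "c - c' = f (x' - x)" using x'(3) by (simp add: f.diff algebra_simps)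
    moreover have "c - c' \<in> C" "x' - x \<in> M"
      using xc x'(1,2) subspace_diff[OF C(1)] subspace_diff[OF M(1)] by auto
    ultimately have "c - c' \<in> C \<inter> f ` M" by auto
    then have "c = c'" using C(3) by auto
    then show ?thesis using order_trans[OF norm_snd_le x'(4)] by simp
  qed
  then show ?thesis using K(1) that by blast
qed

text \<open>If \<open>f u\<^sub>n\<close> converges to \<open>f x + c\<close>, the bound for the component in \<open>C\<close> applied to
  \<open>f (x - u\<^sub>n) + c\<close> forces \<open>c = 0\<close>.\<close>

lemma closed_image_of_closed_complement:
  fixes f :: "'a::banach \<Rightarrow> 'b::banach"
  assumes f: "bounded_linear f" and M: "subspace M" "closed M"
    and C: "subspace C" "closed C" "C \<inter> f ` M = {0}" and sum: "closed (f ` M \<boxplus> C)"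
  shows "closed (f ` M)"
proof -
  interpret f: bounded_linear f by fact
  obtain K where K: "K > 0" "\<And>x c. x \<in> M \<Longrightarrow> c \<in> C \<Longrightarrow> norm c \<le> K * norm (f x + c)"
    using complementary_component_bound[OF assms] by blast
  have "l \<in> f ` M" if s: "\<forall>n. s n \<in> f ` M" "s \<longlonglongrightarrow> l" for s l
  proof -
    have "0 \<in> C" using C(1) by (rule subspace_0)
    then have "s n \<in> f ` M \<boxplus> C" for n using s(1) by force
    then have "l \<in> f ` M \<boxplus> C" using sum s(2) closed_sequentially by blast
    then obtain x c where l: "l = f x + c" "x \<in> M" "c \<in> C" by blast
    have "norm c \<le> K * norm (l - s n)" for n
    proof -
      obtain u where u: "u \<in> M" "s n = f u" using s(1) by blast
      then have "l - s n = f (x - u) + c" by (simp add: l(1) f.diff)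
      then show ?thesis using K(2)[of "x - u" c] u(1) l(2,3) subspace_diff[OF M(1)] by simp
    qed
    moreover have "(\<lambda>n. K * norm (l - s n)) \<longlonglongrightarrow> K * norm (l - l)"
      by (intro tendsto_intros s(2))
    ultimately have "norm c \<le> K * norm (l - l)"
      by (intro LIMSEQ_le_const) auto
    then have "c = 0" by simp
    then show ?thesis using l by simp
  qed
  then show ?thesis unfolding closed_sequential_limits by blast
qed

text \<open>The algebraic projection along \<open>N\<close> is bounded by the estimate for components in a closed
  complement, applied to the identity on \<open>N\<close>.\<close>

lemma bounded_projection:
  fixes M N :: "'a::complex_banach set"
  assumes M: "csubspace M" "closed M" and N: "csubspace N" "closed N"
    and MN: "M \<inter> N = {0}" "M \<boxplus> N = UNIV"
  obtains P :: "'a \<Rightarrow>\<^sub>C\<^sub>L 'a" where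
    "\<And>x. P x \<in> M" "\<And>x. x - P x \<in> N" "\<And>x. x \<in> M \<Longrightarrow> P x = x" "\<And>x. x \<in> N \<Longrightarrow> P x = 0"
proof -
  have ex: "\<exists>m. m \<in> M \<and> x - m \<in> N" for x
  proof -
    have "x \<in> M \<boxplus> N" using MN(2) by simp
    then show ?thesis by force
  qed
  then obtain p where p: "\<And>x. p x \<in> M" "\<And>x. x - p x \<in> N" by metis
  have uniq: "p x = m" if "m \<in> M" "x - m \<in> N" for x m
  proof -
    have "p x - m \<in> M" using p(1) that(1) M(1) csub_diff by blast
    moreover have "(x - m) - (x - p x) \<in> N"
      using p(2) that(2) N(1) csub_diff by blast
    ultimately have "p x - m \<in> M \<inter> N" by simp
    then show ?thesis using MN(1) by simp
  qed
  have M': "subspace M" and N': "subspace N" using M(1) N(1) csubspace_imp_subspace by auto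
  have NM: "(\<lambda>x. x) ` N \<boxplus> M = UNIV"
  proof -
    have "x \<in> N \<boxplus> M" for x
    proof -
      have "x = (x - p x) + p x" by simp
      then show ?thesis using p by blast
    qed
    then show ?thesis by auto
  qed
  obtain K where K: "\<And>x c. x \<in> N \<Longrightarrow> c \<in> M \<Longrightarrow> norm c \<le> K * norm (x + c)"
    using complementary_component_bound[OF bounded_linear_ident N' N(2) M' M(2)] MN(1) NM
    by (metis closed_UNIV image_ident)
  have add: "p (x + y) = p x + p y" for x y
  proof (rule uniq)
    show "p x + p y \<in> M" using p(1) M(1) csub_add by blast
    have "(x - p x) + (y - p y) \<in> N" using p(2) N(1) csub_add by blast
    then show "x + y - (p x + p y) \<in> N" by (simp add: algebra_simps)
  qed
  have scale: "p (c *\<^sub>C x) = c *\<^sub>C p x" for c x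
  proof (rule uniq)
    show "c *\<^sub>C p x \<in> M" using p(1) M(1) csub_scale by blast
    have "c *\<^sub>C (x - p x) \<in> N" using p(2) N(1) csub_scale by blast
    then show "c *\<^sub>C x - c *\<^sub>C p x \<in> N" by (simp add: complex_vector.scale_right_diff_distrib)
  qed
  have "norm (p x) \<le> norm x * K" for x
    using K[OF p(2)[of x] p(1)[of x]] by (simp add: mult.commute)
  then have "bounded_clinear p"
    unfolding bounded_clinear_def
    by (intro conjI bounded_linear_intro[where K = K] allI) (simp_all add: add scale scaleR_scaleC)
  then have P: "cblinfun_apply (CBlinfun p) = p" by (rule bounded_clinear_CBlinfun_apply)
  show ?thesis
  proof (rule that[of "CBlinfun p"], unfold P)
    show "p x \<in> M" "x - p x \<in> N" for x by (rule p)+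
    show "p x = x" if "x \<in> M" for x
      using uniq[OF that] csub_0[OF N(1)] by simp
    show "p x = 0" if "x \<in> N" for x
      using uniq[OF csub_0[OF M(1)], of x] that by simp
  qed
qed

lemma bounded_inverse:
  fixes T :: "'a::complex_banach \<Rightarrow>\<^sub>C\<^sub>L 'a"
  assumes M: "csubspace M" "closed M" and bij: "bij_betw T M M"
  obtains K where "K > 0" "\<And>x. x \<in> M \<Longrightarrow> norm x \<le> K * norm (T x)"
proof -
  have im: "T ` M = M" using bij by (rule bij_betw_imp_surj_on)
  obtain K where K: "K > 0" "\<And>y. y \<in> T ` M \<Longrightarrow> \<exists>x\<in>M. T x = y \<and> norm x \<le> K * norm y"
    using bounded_preimages[OF bounded_linear_cblinfun csubspace_imp_subspace[OF M(1)] M(2), of T]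
      im M(2) by metis
  have "norm x \<le> K * norm (T x)" if "x \<in> M" for x
    using K(2)[of "T x"] that bij by (metis bij_betw_def imageI inj_on_def)
  then show ?thesis using that K(1) by blast
qed

lemma invertible_on_iff_bij_betw:
  fixes T :: "'a::complex_banach \<Rightarrow>\<^sub>C\<^sub>L 'a"
  assumes M: "csubspace M" "closed M" and inv: "T ` M \<subseteq> M"
  shows "invertible_on M T \<longleftrightarrow> bij_betw T M M"
proof
  assume "invertible_on M T"
  then obtain S where S: "\<And>x. x \<in> M \<Longrightarrow> S x \<in> M" "\<And>x. x \<in> M \<Longrightarrow> S (T x) = x"
      "\<And>x. x \<in> M \<Longrightarrow> T (S x) = x"
    unfolding invertible_on_def bounded_operator_on_def by blast
  show "bij_betw T M M"
    by (rule bij_betw_byWitness[where f' = S]) (use S inv in auto)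
next
  assume bij: "bij_betw T M M"
  define S where "S = inv_into M T"
  have S: "S x \<in> M" "T (S x) = x" "S (T x) = x" if "x \<in> M" for x
    using bij that unfolding S_def bij_betw_def
    by (auto simp: inv_into_into f_inv_into_f inv_into_f_f)
  have eq: "S y = x" if "x \<in> M" "T x = y" for x y using S(3)[OF that(1)] that(2) by simp
  obtain K where K: "K > 0" "\<And>x. x \<in> M \<Longrightarrow> norm x \<le> K * norm (T x)"
    using bounded_inverse[OF M bij] by blast
  have "bounded_operator_on M S"
    unfolding bounded_operator_on_def
  proof (intro conjI ballI allI)
    show "S x \<in> M" if "x \<in> M" for x using S(1) that .
    show "S (x + y) = S x + S y" if "x \<in> M" "y \<in> M" for x y
      using S that M(1) by (intro eq) (auto simp: cblin_simps csub_add)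
    show "S (c *\<^sub>C x) = c *\<^sub>C S x" if "x \<in> M" for c x
      using S that M(1) by (intro eq) (auto simp: cblin_simps csub_scale)
    show "\<exists>K. \<forall>x\<in>M. norm (S x) \<le> K * norm x"
      using K(2)[OF S(1)] S(2) by (intro exI[of _ K]) auto
  qed
  then show "invertible_on M T" unfolding invertible_on_def using S(2,3) by blast
qed

abbreviation shifted :: "'a::complex_normed_vector \<Rightarrow>\<^sub>C\<^sub>L 'a \<Rightarrow> complex \<Rightarrow> 'a \<Rightarrow> 'a"
  where "shifted T z \<equiv> cblinfun_apply (T - z *\<^sub>C id_cblinfun)"

section \<open>Power series with vector coefficients\<close>

lemma shift_apply: "shifted T z x = T x - z *\<^sub>C x"
  by (simp add: minus_cblinfun.rep_eq scaleC_cblinfun.rep_eq id_cblinfun.rep_eq)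

lemma shift_shift: "(T - z *\<^sub>C id_cblinfun) - w *\<^sub>C id_cblinfun = T - (z + w) *\<^sub>C id_cblinfun"
  by (simp add: scaleC_add_left)

lemma set_sum_commute:
  fixes A :: "'a::ab_semigroup_add set"
  shows "A \<boxplus> B = B \<boxplus> A"
proof -
  have "A \<boxplus> B \<subseteq> B \<boxplus> A" for A B :: "'a set"
  proof clarify
    fix x y assume "x \<in> A" "y \<in> B"
    then show "\<exists>y' x'. x + y = y' + x' \<and> y' \<in> B \<and> x' \<in> A"
      using add.commute[of x y] by blast
  qed
  then show ?thesis by blast
qed

lemma shift_invariant:
  fixes T :: "'a::complex_normed_vector \<Rightarrow>\<^sub>C\<^sub>L 'a"
  assumes "csubspace M" "T ` M \<subseteq> M" shows "shifted T z ` M \<subseteq> M"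
  using assms by (auto simp: shift_apply intro!: csub_diff csub_scale)

lemma power_series_summable:
  fixes x :: "nat \<Rightarrow> 'a::complex_banach"
  assumes bd: "\<And>n. norm (x n) \<le> K * C ^ n" and "C > 0" "cmod z < 1 / C"
  shows "summable (\<lambda>n. z ^ n *\<^sub>C x n)"
proof (rule summable_comparison_test'[where N = 0 and g = "\<lambda>n. K * (cmod z * C) ^ n"])
  have "cmod z * C < 1" using assms(2,3) by (simp add: field_simps)
  then show "summable (\<lambda>n. K * (cmod z * C) ^ n)"
    using assms(2) by (intro summable_mult summable_geometric) simp
  fix n
  have "cmod z ^ n * norm (x n) \<le> cmod z ^ n * (K * C ^ n)"
    by (intro mult_left_mono bd) simp
  then show "norm (z ^ n *\<^sub>C x n) \<le> K * (cmod z * C) ^ n"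
    by (simp add: norm_scaleC norm_power power_mult_distrib mult_ac)
qed

text \<open>On a smaller ball of radius \<open>r\<close> the termwise derivatives \<open>d n z\<close> are dominated by the convergent
  series \<open>M n\<close>, so that the series may be differentiated term by term.\<close>

lemma power_series_canalytic:
  fixes x :: "nat \<Rightarrow> 'a::complex_banach"
  assumes bd: "\<And>n. norm (x n) \<le> K * C ^ n" and C: "C > 0"
  shows "canalytic_on (\<lambda>z. \<Sum>n. z ^ n *\<^sub>C x n) (ball 0 (1 / C))"
  unfolding canalytic_on_def
proof (intro conjI ballI)
  fix z0 :: complex assume "z0 \<in> ball 0 (1 / C)"
  then obtain r where r: "cmod z0 < r" "r < 1 / C"
    using dense[of "cmod z0" "1 / C"] by auto
  have r0: "0 < r" using r(1) by (rule order_le_less_trans[OF norm_ge_zero])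
  have rC: "r * C < 1" using r(2) C by (simp add: field_simps)
  define d where "d n z = (of_nat n * z ^ (n - 1)) *\<^sub>C x n" for n and z :: complex
  define M where "M n = K * C * (of_nat n * (r * C) ^ (n - 1))" for n :: nat
  have "summable (\<lambda>n. of_nat (Suc n) * (r * C) ^ n)"
    using geometric_deriv_sums[of "r * C"] rC r0 C by (auto intro: sums_summable)
  then have "summable (\<lambda>n. M (Suc n))"
    unfolding M_def by (intro summable_mult) simp
  then have sM: "summable M" by (simp add: summable_Suc_iff)
  have dM: "norm (d n z) \<le> M n" if "z \<in> ball 0 r" for n z
  proof (cases n)
    case 0
    then show ?thesis by (simp add: d_def M_def)
  next
    case (Suc m)
    have "norm (d n z) = of_nat n * cmod z ^ m * norm (x n)"
      by (simp add: d_def norm_scaleC norm_mult norm_power Suc del: of_nat_Suc)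
    also have "\<dots> \<le> of_nat n * r ^ m * (K * C ^ n)"
      using that bd[of n] r0 by (intro mult_mono power_mono) auto
    also have "\<dots> = M n" by (simp add: M_def Suc power_mult_distrib mult_ac del: of_nat_Suc)
    finally show ?thesis .
  qed
  have ul: "uniform_limit (ball 0 r) (\<lambda>n z. \<Sum>i<n. d i z) (\<lambda>z. \<Sum>i. d i z) sequentially"
    using dM sM by (rule Weierstrass_m_test)
  have der: "((\<lambda>z. z ^ n *\<^sub>C x n) has_derivative (\<lambda>h. h *\<^sub>C d n z)) (at z within S)" for n z S
  proof -
    have "((\<lambda>z. z ^ n) has_derivative (\<lambda>h. of_nat n * z ^ (n - 1) * h)) (at z within S)"
      unfolding has_field_derivative_def[symmetric] by (auto intro!: derivative_eq_intros)
    then have "((\<lambda>z. z ^ n *\<^sub>C x n) has_derivative (\<lambda>h. (of_nat n * z ^ (n - 1) * h) *\<^sub>C x n)) (at z within S)"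
      by (rule bounded_linear.has_derivative[OF bounded_linear_scaleC_left])
    then show ?thesis by (simp add: d_def scaleC_scaleC mult_ac)
  qed
  have "\<exists>g. \<forall>z\<in>ball 0 r. (\<lambda>n. z ^ n *\<^sub>C x n) sums (g z) \<and>
      (g has_derivative (\<lambda>h. h *\<^sub>C (\<Sum>i. d i z))) (at z within ball 0 r)"
  proof (rule has_derivative_series[where f' = "\<lambda>n z h. h *\<^sub>C d n z"])
    show "convex (ball (0::complex) r)" by simp
    show "((\<lambda>z. z ^ n *\<^sub>C x n) has_derivative (\<lambda>h. h *\<^sub>C d n z)) (at z within ball 0 r)" for n z
      by (rule der)
    show "0 \<in> ball (0::complex) r" using r0 by simp
    show "(\<lambda>n. 0 ^ n *\<^sub>C x n) sums (\<Sum>n. 0 ^ n *\<^sub>C x n)"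
      using power_series_summable[OF bd C, of 0] C by (simp add: summable_sums)
    fix e :: real assume "e > 0"
    then have "\<forall>\<^sub>F n in sequentially. \<forall>z\<in>ball 0 r. dist (\<Sum>i<n. d i z) (\<Sum>i. d i z) < e"
      using ul by (simp add: uniform_limit_iff)
    then show "\<forall>\<^sub>F n in sequentially. \<forall>z\<in>ball 0 r. \<forall>h.
        norm ((\<Sum>i<n. h *\<^sub>C d i z) - h *\<^sub>C (\<Sum>i. d i z)) \<le> e * norm h"
    proof (rule eventually_mono, intro ballI allI)
      fix n and z h :: complex
      assume "\<forall>z\<in>ball 0 r. dist (\<Sum>i<n. d i z) (\<Sum>i. d i z) < e" "z \<in> ball 0 r"
      then have le: "norm ((\<Sum>i<n. d i z) - (\<Sum>i. d i z)) \<le> e" by (force simp: dist_norm)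
      have "norm ((\<Sum>i<n. h *\<^sub>C d i z) - h *\<^sub>C (\<Sum>i. d i z))
          = cmod h * norm ((\<Sum>i<n. d i z) - (\<Sum>i. d i z))"
        by (simp only: complex_vector.scale_sum_right[symmetric]
            complex_vector.scale_right_diff_distrib[symmetric] norm_scaleC)
      then show "norm ((\<Sum>i<n. h *\<^sub>C d i z) - h *\<^sub>C (\<Sum>i. d i z)) \<le> e * norm h"
        using mult_left_mono[OF le, of "cmod h"] by (simp add: mult.commute)
    qed
  qed
  then obtain g where g: "\<And>z. z \<in> ball 0 r \<Longrightarrow> (\<lambda>n. z ^ n *\<^sub>C x n) sums (g z)"
      "\<And>z. z \<in> ball 0 r \<Longrightarrow> (g has_derivative (\<lambda>h. h *\<^sub>C (\<Sum>i. d i z))) (at z within ball 0 r)"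
    by blast
  have "z0 \<in> ball 0 r" using r(1) by simp
  then have "(g has_derivative (\<lambda>h. h *\<^sub>C (\<Sum>i. d i z0))) (at z0)"
    using g(2)[of z0] at_within_open[of z0 "ball 0 r"] by (metis open_ball)
  then have "((\<lambda>z. \<Sum>n. z ^ n *\<^sub>C x n) has_derivative (\<lambda>h. h *\<^sub>C (\<Sum>i. d i z0))) (at z0)"
    by (rule has_derivative_transform_within_open[OF _ open_ball[of 0 r]])
      (use \<open>z0 \<in> ball 0 r\<close> sums_unique[OF g(1)] in auto)
  then show "\<exists>D. ((\<lambda>z. \<Sum>n. z ^ n *\<^sub>C x n) has_derivative (\<lambda>h. h *\<^sub>C D)) (at z0)" by blast
qed simp

text \<open>The formula is a shift of the summation index. It says that \<open>L - z\<close> maps a formal series whose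
  coefficients satisfy \<open>L (x (Suc n)) = x n\<close> to the constant \<open>L (x 0)\<close>; with one exceptional index
  it produces a power of \<open>z\<close>, which is how the principal part of a resolvent arises.\<close>

lemma power_series_shift:
  fixes x :: "nat \<Rightarrow> 'a::complex_banach"
  assumes L: "bounded_clinear L"
    and bd: "\<And>n. norm (x n) \<le> K * C ^ n" and C: "C > 0" and z: "cmod z < 1 / C"
  shows "L (\<Sum>n. z ^ n *\<^sub>C x n) - z *\<^sub>C (\<Sum>n. z ^ n *\<^sub>C x n)
    = L (x 0) + (\<Sum>n. z ^ Suc n *\<^sub>C (L (x (Suc n)) - x n))"
proof -
  have Lb: "bounded_linear L" and Lc: "\<And>c x. L (c *\<^sub>C x) = c *\<^sub>C L x"
    using L by (auto simp: bounded_clinear_def)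
  note sum = power_series_summable[OF bd C z]
  have sL: "summable (\<lambda>n. z ^ n *\<^sub>C L (x n))"
    using bounded_linear.summable[OF Lb sum] by (simp add: Lc)
  then have sL': "summable (\<lambda>n. z ^ Suc n *\<^sub>C L (x (Suc n)))"
    by (simp only: summable_Suc_iff[of "\<lambda>n. z ^ n *\<^sub>C L (x n)"])
  have "L (\<Sum>n. z ^ n *\<^sub>C x n) = (\<Sum>n. z ^ n *\<^sub>C L (x n))"
    using bounded_linear.suminf[OF Lb sum] by (simp add: Lc)
  also have "\<dots> = L (x 0) + (\<Sum>n. z ^ Suc n *\<^sub>C L (x (Suc n)))"
    using suminf_split_head[OF sL] by (simp add: scaleC_one)
  finally have 1: "L (\<Sum>n. z ^ n *\<^sub>C x n) = L (x 0) + (\<Sum>n. z ^ Suc n *\<^sub>C L (x (Suc n)))" .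
  have 2: "z *\<^sub>C (\<Sum>n. z ^ n *\<^sub>C x n) = (\<Sum>n. z ^ Suc n *\<^sub>C x n)"
    using bounded_linear.suminf[OF bounded_linear_scaleC sum, of z] by (simp add: scaleC_scaleC)
  have s2: "summable (\<lambda>n. z ^ Suc n *\<^sub>C x n)"
    using bounded_linear.summable[OF bounded_linear_scaleC sum, of z] by (simp add: scaleC_scaleC)
  show ?thesis
    unfolding 1 2 using suminf_diff[OF sL' s2]
    by (simp add: complex_vector.scale_right_diff_distrib)
qed

lemma power_series_solution:
  fixes x :: "nat \<Rightarrow> 'a::complex_banach"
  assumes "bounded_clinear L" and step: "\<And>n. L (x (Suc n)) = x n"
    and "\<And>n. norm (x n) \<le> K * C ^ n" "C > 0" "cmod z < 1 / C"
  shows "L (\<Sum>n. z ^ n *\<^sub>C x n) - z *\<^sub>C (\<Sum>n. z ^ n *\<^sub>C x n) = L (x 0)"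
  using power_series_shift[OF assms(1,3-5)] by (simp add: step)

lemma power_series_0: "(\<Sum>n. 0 ^ n *\<^sub>C x n) = (x 0 :: 'a::complex_banach)"
proof -
  have "(\<lambda>n. 0 ^ n *\<^sub>C x n) sums (\<Sum>n\<in>{0}. 0 ^ n *\<^sub>C x n)"
    by (rule sums_finite) auto
  then show ?thesis by (simp add: sums_iff scaleC_one)
qed

lemma power_series_in_subspace:
  fixes x :: "nat \<Rightarrow> 'a::complex_banach"
  assumes M: "csubspace M" "closed M" and x: "\<And>n. x n \<in> M"
    and bd: "\<And>n. norm (x n) \<le> K * C ^ n" and C: "C > 0" and z: "cmod z < 1 / C"
  shows "(\<Sum>n. z ^ n *\<^sub>C x n) \<in> M"
  by (rule closed_sequentially[OF M(2) _ summable_LIMSEQ[OF power_series_summable[OF bd C z]]])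
    (auto intro!: complex_vector.subspace_sum[OF M(1)] csub_scale[OF M(1)] x)

lemma bij_betw_subspace_iff:
  fixes T :: "'a::complex_normed_vector \<Rightarrow>\<^sub>C\<^sub>L 'a"
  assumes M: "csubspace M" and T: "T ` M \<subseteq> M"
  shows "bij_betw (cblinfun_apply T) M M \<longleftrightarrow> (\<forall>x\<in>M. T x = 0 \<longrightarrow> x = 0) \<and> M \<subseteq> T ` M"
proof
  assume b: "bij_betw (cblinfun_apply T) M M"
  have "x = 0" if "x \<in> M" "T x = 0" for x
  proof -
    have "T x = T 0" using that(2) by (simp add: cblin_0)
    then show ?thesis using b that(1) csub_0[OF M]
      unfolding bij_betw_def inj_on_def by blast
  qed
  then show "(\<forall>x\<in>M. T x = 0 \<longrightarrow> x = 0) \<and> M \<subseteq> T ` M"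
    using b by (auto simp: bij_betw_def)
next
  assume a: "(\<forall>x\<in>M. T x = 0 \<longrightarrow> x = 0) \<and> M \<subseteq> T ` M"
  have "inj_on (cblinfun_apply T) M"
  proof (rule inj_onI)
    fix x y assume "x \<in> M" "y \<in> M" "T x = T y"
    then have "x - y \<in> M" "T (x - y) = 0"
      using csub_diff[OF M] by (auto simp: cblin_diff)
    then show "x = y" using a by auto
  qed
  then show "bij_betw (cblinfun_apply T) M M" using a T by (auto simp: bij_betw_def)
qed

text \<open>For \<open>y \<in> M\<close> the Neumann series \<open>\<Sum> z\<^sup>n T\<^sup>-\<^sup>n\<^sup>-\<^sup>1 y\<close>, formed with the inverse on \<open>M\<close>, solves
  \<open>(T - z) w = y\<close>; the lower bound for \<open>T\<close> on \<open>M\<close> gives injectivity.\<close>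

lemma bij_betw_perturb:
  fixes T :: "'a::complex_banach \<Rightarrow>\<^sub>C\<^sub>L 'a"
  assumes M: "csubspace M" "closed M" and bij: "bij_betw T M M"
  obtains r where "r > 0" "\<And>z. cmod z < r \<Longrightarrow> bij_betw (shifted T z) M M"
proof -
  obtain K where K: "K > 0" "\<And>x. x \<in> M \<Longrightarrow> norm x \<le> K * norm (T x)"
    using bounded_inverse[OF M bij] by blast
  define S where "S = inv_into M T"
  have S: "S x \<in> M" "T (S x) = x" if "x \<in> M" for x
    using bij that unfolding S_def bij_betw_def
    by (auto simp: inv_into_into f_inv_into_f)
  have inv: "T ` M \<subseteq> M" using bij by (simp add: bij_betw_def)
  have "bij_betw (shifted T z) M M" if z: "cmod z < 1 / K" for z
    unfolding bij_betw_subspace_iff[OF M(1) shift_invariant[OF M(1) inv]]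
  proof (intro conjI ballI impI subsetI)
    fix x assume x: "x \<in> M" "shifted T z x = 0"
    then have "norm x \<le> K * norm (z *\<^sub>C x)" using K(2)[OF x(1)] by (simp add: shift_apply)
    then have "norm x * 1 \<le> norm x * (K * cmod z)" by (simp add: norm_scaleC mult_ac)
    moreover have "K * cmod z < 1" using z K(1) by (simp add: field_simps)
    ultimately show "x = 0"
      by (metis mult_le_cancel_left norm_le_zero_iff not_le)
  next
    fix y assume y: "y \<in> M"
    define x where "x n = (S ^^ Suc n) y" for n
    have xM: "x n \<in> M" for n
      by (induction n) (use S(1) y in \<open>auto simp: x_def\<close>)
    have Tx: "T (x (Suc n)) = x n" for n
    proof -
      have "x (Suc n) = S (x n)" by (simp add: x_def)
      then show ?thesis using S(2) xM by simp
    qed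
    have Tx0: "T (x 0) = y" using S(2) y by (simp add: x_def)
    have bd: "norm (x n) \<le> (K * norm y) * K ^ n" for n
    proof (induction n)
      case 0
      then show ?case using K(2)[OF xM[of 0]] Tx0 by simp
    next
      case (Suc n)
      have "norm (x (Suc n)) \<le> K * norm (x n)" using K(2)[OF xM[of "Suc n"]] Tx by simp
      also have "\<dots> \<le> K * ((K * norm y) * K ^ n)" using Suc K(1) by simp
      finally show ?case by (simp add: mult_ac)
    qed
    define w where "w = (\<Sum>n. z ^ n *\<^sub>C x n)"
    have "w \<in> M" unfolding w_def by (rule power_series_in_subspace[OF M xM bd K(1) z])
    moreover have "shifted T z w = y"
      using power_series_solution[OF bounded_clinear_cblinfun Tx bd K(1) z] Tx0
      by (simp add: w_def shift_apply)
    ultimately show "y \<in> shifted T z ` M" by blast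
  qed
  then show ?thesis using that[of "1 / K"] K(1) by simp
qed

section \<open>Weyl operators on an invariant subspace\<close>

text \<open>Under these conditions \<open>T\<close> induces a bijection from \<open>M\<close> modulo \<open>V\<close> onto \<open>M\<close> modulo \<open>W\<close>, so the index of
  \<open>T\<close> on \<open>M\<close> is the index \<open>cdim V - cdim W\<close> of its part from \<open>V\<close> to \<open>W\<close>. All proofs of the Weyl property
  below use this criterion with suitable \<open>V\<close> and \<open>W\<close>.\<close>

lemma Weyl_onI:
  fixes T :: "'a::complex_banach \<Rightarrow>\<^sub>C\<^sub>L 'a"
  assumes M: "csubspace M" "closed M" "T ` M \<subseteq> M"
    and V: "csubspace V" "fin_dim V" "V \<subseteq> M" and W: "csubspace W" "fin_dim W" "W \<subseteq> M"
    and dim: "cdim V = cdim W" and TV: "T ` V \<subseteq> W"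
    and ker: "\<And>x. x \<in> M \<Longrightarrow> T x = 0 \<Longrightarrow> x \<in> V"
    and sum: "M \<subseteq> T ` M \<boxplus> W" and int: "T ` M \<inter> W \<subseteq> T ` V"
  shows "Weyl_on M T"
proof -
  have TM: "csubspace (T ` M)" by (rule clinear_subspace_image[OF clinear_cblinfun M(1)])
  have TV': "csubspace (T ` V)" by (rule clinear_subspace_image[OF clinear_cblinfun V(1)])
  obtain D where D: "csubspace D" "D \<subseteq> W" "D \<inter> T ` V = {0}" "D \<boxplus> T ` V = W"
    by (rule subspace_complement[OF TV' W(1) TV])
  have fD: "fin_dim D" using D(2) W(2) by (rule fin_dim_subset)
  have fTV: "fin_dim (T ` V)" using TV W(2) by (rule fin_dim_subset)
  have "D \<inter> T ` M \<subseteq> D \<inter> T ` V" using D(2) int by blast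
  then have "D \<inter> T ` M = {0}"
    using D(3) csub_0[OF D(1)] csub_0[OF TM] by auto
  moreover have DTM: "D \<boxplus> T ` M = M"
  proof
    show "D \<boxplus> T ` M \<subseteq> M"
      using D(2) W(3) M csub_add[OF M(1)] by blast
    show "M \<subseteq> D \<boxplus> T ` M"
    proof
      fix x assume "x \<in> M"
      then obtain t w where x: "x = t + w" "t \<in> T ` M" "w \<in> W" using sum by blast
      have "w \<in> D \<boxplus> T ` V" using x(3) D(4) by simp
      then obtain d v where w: "w = d + v" "d \<in> D" "v \<in> T ` V" by blast
      have "t + v \<in> T ` M"
        using x(2) w(3) V(3) csub_add[OF TM] by blast
      moreover have "x = d + (t + v)" using x(1) w(1) by (simp add: algebra_simps)
      ultimately show "x \<in> D \<boxplus> T ` M" using w(2) by blast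
    qed
  qed
  ultimately have codim: "fin_codim M (T ` M)" "codim M (T ` M) = cdim D"
    using codim_eq_dim_complement[OF TM D(1)] fD by auto
  have kerV: "kernel_on M T = {x \<in> V. T x = 0}"
    using ker V(3) by (auto simp: kernel_on_def)
  have "fin_dim (kernel_on M T)"
    using V(2) fin_dim_subset[of "kernel_on M T" V] by (auto simp: kerV)
  moreover have "cdim D = cdim (kernel_on M T)"
  proof -
    have "cdim W = cdim D + cdim (T ` V)"
      using dim_direct_sum[OF D(1) fD TV' fTV D(3)] D(4) by simp
    moreover have "cdim V = cdim (kernel_on M T) + cdim (T ` V)"
      using rank_nullity[OF clinear_cblinfun V(1,2), of T] by (simp add: kerV)
    ultimately show ?thesis using dim by simp
  qed
  moreover have "closed (T ` M)"
  proof (rule closed_image_of_closed_complement[OF bounded_linear_cblinfun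
        csubspace_imp_subspace[OF M(1)] M(2) csubspace_imp_subspace[OF D(1)]])
    show "closed D" by (rule fin_dim_closed[OF D(1) fD])
    show "D \<inter> T ` M = {0}" by fact
    show "closed (T ` M \<boxplus> D)" unfolding set_sum_commute[of "T ` M"] DTM by (rule M(2))
  qed
  ultimately show ?thesis
    using codim by (simp add: Weyl_on_def Fredholm_on_def upper_semi_Fredholm_on_def
        lower_semi_Fredholm_on_def index_on_def)
qed

lemma Weyl_onE:
  fixes T :: "'a::complex_banach \<Rightarrow>\<^sub>C\<^sub>L 'a"
  assumes M: "csubspace M" "T ` M \<subseteq> M" and W: "Weyl_on M T"
  obtains D where "csubspace D" "fin_dim D" "D \<subseteq> M" "D \<inter> T ` M = {0}" "D \<boxplus> T ` M = M"
    "cdim D = cdim {x\<in>M. T x = 0}" "fin_dim {x\<in>M. T x = 0}" "closed (T ` M)"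
proof -
  have TM: "csubspace (T ` M)" by (rule clinear_subspace_image[OF clinear_cblinfun M(1)])
  have w: "fin_dim {x\<in>M. T x = 0}" "closed (T ` M)" "fin_codim M (T ` M)"
      "codim M (T ` M) = cdim {x\<in>M. T x = 0}"
    using W by (simp_all add: Weyl_on_def Fredholm_on_def upper_semi_Fredholm_on_def
        lower_semi_Fredholm_on_def index_on_def kernel_on_def)
  obtain D where D: "csubspace D" "fin_dim D" "D \<subseteq> M" "D \<inter> T ` M = {0}" "D \<boxplus> T ` M = M"
      "codim M (T ` M) = cdim D"
    by (rule fin_codim_complement[OF TM M w(3)])
  show ?thesis using D(6) w(4) by (intro that[OF D(1-5) _ w(1,2)]) simp
qed

lemma fin_dim_0: "fin_dim {0}"
  unfolding fin_dim_def by (intro exI[of _ "{}"]) simp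

lemma csubspace_0: "csubspace {0}"
  by (simp add: csubspace_iff)

lemma bij_betw_imp_Weyl_on:
  fixes T :: "'a::complex_banach \<Rightarrow>\<^sub>C\<^sub>L 'a"
  assumes M: "csubspace M" "closed M" and bij: "bij_betw T M M"
  shows "Weyl_on M T"
proof (rule Weyl_onI[where V = "{0}" and W = "{0}"])
  have im: "T ` M = M" using bij by (simp add: bij_betw_def)
  then show "T ` M \<subseteq> M" by simp
  show "x \<in> {0}" if "x \<in> M" "T x = 0" for x
    using bij that im unfolding bij_betw_subspace_iff[OF M(1) equalityD1[OF im]] by simp
  show "M \<subseteq> T ` M \<boxplus> {0}" using im by auto
qed (use M csub_0[OF M(1)] in \<open>auto simp: fin_dim_0 csubspace_0 cblin_0\<close>)

text \<open>The criterion applies to \<open>W\<close> and its preimage under \<open>S\<close>: modulo \<open>W\<close>, the operator \<open>T\<close> agrees with the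
  bijection \<open>S\<close>.\<close>

lemma Weyl_on_perturb_finite_rank:
  fixes T :: "'a::complex_banach \<Rightarrow>\<^sub>C\<^sub>L 'a"
  assumes M: "csubspace M" "closed M" "T ` M \<subseteq> M" and bij: "bij_betw S M M" and S: "clinear S"
    and W: "csubspace W" "fin_dim W" "W \<subseteq> M" and diff: "\<And>x. x \<in> M \<Longrightarrow> S x - T x \<in> W"
  shows "Weyl_on M T"
proof (rule Weyl_onI[OF M, where V = "{x\<in>M. S x \<in> W}" and W = W])
  let ?V = "{x\<in>M. S x \<in> W}"
  have inj: "inj_on S M" and im: "S ` M = M" using bij by (auto simp: bij_betw_def)
  show V: "csubspace ?V" by (rule clinear_subspace_vimage[OF S M(1) W(1)])
  have SV: "S ` ?V = W" using im W(3) by force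
  have inj': "inj_on S ?V" by (rule inj_on_subset[OF inj]) auto
  have "{x\<in>?V. S x = 0} \<subseteq> {0}"
    using inj complex_pair.linear_0[OF S] csub_0[OF M(1)]
    by (auto simp: inj_on_def)
  then have "fin_dim {x\<in>?V. S x = 0}" using fin_dim_0 by (rule fin_dim_subset)
  then show fV: "fin_dim ?V"
    by (rule fin_dim_of_kernel_image[OF S V]) (simp add: SV W(2))
  show "cdim ?V = cdim W" using dim_injective_image[OF S V fV inj'] SV by simp
  have TS: "T x = S x - (S x - T x)" for x by simp
  show "T ` ?V \<subseteq> W"
  proof clarify
    fix x assume "x \<in> M" "S x \<in> W"
    then have "S x - (S x - T x) \<in> W" using diff by (blast intro: csub_diff[OF W(1)])
    then show "T x \<in> W" by simp
  qed
  show "x \<in> ?V" if "x \<in> M" "T x = 0" for x using diff[OF that(1)] that by simp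
  show "M \<subseteq> T ` M \<boxplus> W"
  proof
    fix y assume "y \<in> M"
    then obtain x where "x \<in> M" "y = S x" using im by blast
    moreover have "S x = T x + (S x - T x)" by simp
    ultimately show "y \<in> T ` M \<boxplus> W" using diff by blast
  qed
  show "T ` M \<inter> W \<subseteq> T ` ?V"
  proof clarify
    fix x assume x: "x \<in> M" "T x \<in> W"
    then have "T x + (S x - T x) \<in> W" using diff by (intro csub_add[OF W(1)]) auto
    then show "T x \<in> T ` ?V" using x by auto
  qed
qed (use W in auto)

text \<open>Index \<open>0\<close> means that the kernel and a complement \<open>D\<close> of the range are isomorphic. The operator \<open>F\<close>
  is a bounded projection onto the kernel, built from a dual basis, followed by an isomorphism onto
  \<open>D\<close>.\<close>

lemma Weyl_on_finite_rank_modification: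
  fixes T :: "'a::complex_banach \<Rightarrow>\<^sub>C\<^sub>L 'a"
  assumes M: "csubspace M" "closed M" "T ` M \<subseteq> M" and Weyl: "Weyl_on M T"
  obtains D F where "csubspace D" "fin_dim D" "D \<subseteq> M" "\<forall>x. cblinfun_apply F x \<in> D"
    "bij_betw (cblinfun_apply (T + F)) M M"
proof -
  let ?K = "{x\<in>M. T x = 0}"
  obtain D where D: "csubspace D" "fin_dim D" "D \<subseteq> M" "D \<inter> T ` M = {0}" "D \<boxplus> T ` M = M"
    "cdim D = cdim ?K" "fin_dim ?K" by (rule Weyl_onE[OF M(1,3) Weyl])
  have K: "csubspace ?K" by (rule clinear_kernel_subspace[OF clinear_cblinfun M(1)])
  obtain B where B: "finite B" "cindependent B" "cspan B = ?K" "card B = cdim ?K"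
    using fin_dim_basis[OF K D(7)] .
  obtain B' where B': "finite B'" "cindependent B'" "cspan B' = D" "card B' = cdim D"
    using fin_dim_basis[OF D(1,2)] .
  have "B \<subseteq> ?K" "B' \<subseteq> D" using B(3) B'(3) complex_vector.span_superset by auto
  then obtain j where j: "clinear j" "j ` ?K = D" "inj_on j ?K"
    using complex_pair.finite_basis_to_basis_subspace_isomorphism[of ?K D B B'] K D(1,6) B B' by auto
  obtain \<phi> :: "'a \<Rightarrow> 'a \<Rightarrow>\<^sub>C\<^sub>L complex" where
    \<phi>: "\<And>b c. b \<in> B \<Longrightarrow> c \<in> B \<Longrightarrow> \<phi> b c = (if b = c then 1 else 0)"
    using dual_basis[OF B(1,2)] by blast
  define P where "P x = (\<Sum>b\<in>B. \<phi> b x *\<^sub>C b)" for x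
  define f where "f x = (\<Sum>b\<in>B. \<phi> b x *\<^sub>C j b)" for x
  have jP: "f x = j (P x)" for x
    by (simp add: f_def P_def complex_pair.linear_sum[OF j(1)] complex_pair.linear_scale[OF j(1)])
  have PK: "P x \<in> ?K" for x
    unfolding P_def B(3)[symmetric]
    by (intro complex_vector.span_sum complex_vector.span_scale complex_vector.span_base)
  have Pid: "P x = x" if "x \<in> ?K" for x
    using dual_basis_expansion[OF B(1), of \<phi> x] \<phi> that B(3) by (auto simp: P_def)
  have "bounded_linear f"
    unfolding f_def
    by (intro bounded_linear_sum bounded_linear_compose[OF bounded_linear_scaleC_left]
        bounded_linear_cblinfun)
  moreover have "f (c *\<^sub>C x) = c *\<^sub>C f x" for c x
    by (simp add: f_def cblin_scaleC complex_vector.scale_sum_right scaleC_scaleC scaleC_complex_def)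
  ultimately have "bounded_clinear f" by (simp add: bounded_clinear_def)
  then have F: "cblinfun_apply (CBlinfun f) = f" by (rule bounded_clinear_CBlinfun_apply)
  have fD: "f x \<in> D" for x using jP PK j(2) by auto
  have TF: "cblinfun_apply (T + CBlinfun f) x = T x + f x" for x
    by (simp add: plus_cblinfun.rep_eq F)
  have Padd: "P (x + y) = P x + P y" for x y
    by (simp add: P_def cblin_add scaleC_add_left sum.distrib)
  have inv: "cblinfun_apply (T + CBlinfun f) ` M \<subseteq> M"
    using M(3) fD D(3) by (auto simp: TF intro!: csub_add[OF M(1)])
  have "bij_betw (cblinfun_apply (T + CBlinfun f)) M M"
    unfolding bij_betw_subspace_iff[OF M(1) inv]
  proof (intro conjI ballI impI subsetI)
    fix x assume x: "x \<in> M" "cblinfun_apply (T + CBlinfun f) x = 0"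
    then have "T x = - f x" by (simp add: TF eq_neg_iff_add_eq_0)
    moreover have "- f x \<in> D" using fD csub_neg[OF D(1)] by blast
    ultimately have "T x \<in> D" by simp
    moreover have "T x \<in> T ` M" using x(1) by (rule imageI)
    ultimately have "T x \<in> D \<inter> T ` M" by blast
    then have Tx: "T x = 0" using D(4) by blast
    then have "x \<in> ?K" using x(1) by simp
    then have "j x = 0" using Tx x(2) Pid by (simp add: TF jP)
    then have "j x = j 0" using complex_pair.linear_0[OF j(1)] by simp
    then show "x = 0"
      using j(3) \<open>x \<in> ?K\<close> csub_0[OF K] by (blast dest: inj_onD)
  next
    fix y assume "y \<in> M"
    then have "y \<in> D \<boxplus> T ` M" using D(5) by simp
    then obtain d x where y: "y = d + T x" "d \<in> D" "x \<in> M" by blast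
    have "d - f x \<in> j ` ?K" unfolding j(2) using y(2) fD csub_diff[OF D(1)] by blast
    then obtain k where k: "k \<in> ?K" "j k = d - f x" by auto
    have f1: "f (x + k) = f x + j k"
      by (simp add: jP Padd Pid[OF k(1)] complex_pair.linear_add[OF j(1)])
    have "cblinfun_apply (T + CBlinfun f) (x + k) = y"
      unfolding TF f1 k(2) using k(1) y(1) by (simp add: cblin_add)
    moreover have "x + k \<in> M" using y(3) k(1) csub_add[OF M(1)] by blast
    ultimately show "y \<in> cblinfun_apply (T + CBlinfun f) ` M" by blast
  qed
  then show ?thesis using that[OF D(1-3), of "CBlinfun f"] fD F by simp
qed

text \<open>If \<open>T + F\<close> is bijective on \<open>M\<close> and \<open>F\<close> has finite rank, then \<open>T + F - z\<close> is still bijective for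
  small \<open>z\<close>, and \<open>T - z\<close> differs from it by finite rank.\<close>

lemma Weyl_on_stable:
  fixes T :: "'a::complex_banach \<Rightarrow>\<^sub>C\<^sub>L 'a"
  assumes M: "csubspace M" "closed M" "T ` M \<subseteq> M" and Weyl: "Weyl_on M T"
  obtains r where "r > 0" "\<And>z. cmod z < r \<Longrightarrow> Weyl_on M (T - z *\<^sub>C id_cblinfun)"
proof -
  obtain D F where D: "csubspace D" "fin_dim D" "D \<subseteq> M" "\<forall>x. cblinfun_apply F x \<in> D"
    "bij_betw (cblinfun_apply (T + F)) M M" by (rule Weyl_on_finite_rank_modification[OF assms])
  obtain r where r: "r > 0" "\<And>z. cmod z < r \<Longrightarrow> bij_betw (cblinfun_apply ((T + F) - z *\<^sub>C id_cblinfun)) M M"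
    using bij_betw_perturb[OF M(1,2) D(5)] by blast
  have "Weyl_on M (T - z *\<^sub>C id_cblinfun)" if "cmod z < r" for z
    by (rule Weyl_on_perturb_finite_rank[OF M(1,2) shift_invariant[OF M(1,3)] r(2)[OF that]
          clinear_cblinfun D(1-3)])
      (simp add: shift_apply plus_cblinfun.rep_eq D(4))
  then show ?thesis using that r(1) by blast
qed

text \<open>With \<open>L = T ` M\<close>, the kernel \<open>K\<close> and a complement \<open>D\<close> of \<open>L\<close>, the criterion on \<open>L\<close> is met by
  \<open>L \<inter> (K + D)\<close> and \<open>T ` D\<close>. Their dimensions agree: \<open>K + D\<close> is the direct sum of \<open>L \<inter> (K + D)\<close> and
  \<open>D\<close>, while rank and nullity of \<open>T\<close> on \<open>K + D\<close> are \<open>cdim (T ` D)\<close> and \<open>cdim K = cdim D\<close>.\<close>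

lemma Weyl_on_image:
  fixes T :: "'a::complex_banach \<Rightarrow>\<^sub>C\<^sub>L 'a"
  assumes M: "csubspace M" "closed M" "T ` M \<subseteq> M" and Weyl: "Weyl_on M T"
  shows "closed (T ` M)" "Weyl_on (T ` M) T"
proof -
  let ?K = "{x\<in>M. T x = 0}" and ?L = "T ` M"
  obtain D where D: "csubspace D" "fin_dim D" "D \<subseteq> M" "D \<inter> ?L = {0}" "D \<boxplus> ?L = M"
    "cdim D = cdim ?K" "fin_dim ?K" "closed ?L" by (rule Weyl_onE[OF M(1,3) Weyl])
  show "closed ?L" by (rule D(8))
  have K: "csubspace ?K" by (rule clinear_kernel_subspace[OF clinear_cblinfun M(1)])
  have L: "csubspace ?L" by (rule clinear_subspace_image[OF clinear_cblinfun M(1)])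
  let ?E = "?K \<boxplus> D"
  have E: "csubspace ?E" "fin_dim ?E" using csubspace_sum[OF K D(1)] fin_dim_sum[OF D(7,2)] .
  have KE: "k \<in> ?E" if "k \<in> ?K" for k
  proof -
    have "k = k + 0" by simp
    then show ?thesis using that csub_0[OF D(1)] by blast
  qed
  have DE: "d \<in> ?E" if "d \<in> D" for d
  proof -
    have "d = 0 + d" by simp
    then show ?thesis using that csub_0[OF K] by blast
  qed
  have TE: "T ` ?E = T ` D"
  proof
    show "T ` ?E \<subseteq> T ` D" by (auto simp: cblin_add)
    show "T ` D \<subseteq> T ` ?E" using DE by blast
  qed
  have EM: "?E \<subseteq> M" using D(3) csub_add[OF M(1)] by blast
  let ?V = "?L \<inter> ?E"
  have V: "csubspace ?V" using L E(1) by (rule csub_inter)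
  show "Weyl_on ?L T"
  proof (rule Weyl_onI[OF L D(8), where V = ?V and W = "T ` D"])
    show "T ` ?L \<subseteq> ?L" using M(3) by blast
    show "csubspace ?V" by (rule V)
    show fV: "fin_dim ?V" using E(2) by (rule fin_dim_subset[rotated]) auto
    show TD: "csubspace (T ` D)" by (rule clinear_subspace_image[OF clinear_cblinfun D(1)])
    show "fin_dim (T ` D)" by (rule fin_dim_image[OF clinear_cblinfun D(2)])
    show "?V \<subseteq> ?L" "T ` D \<subseteq> ?L" using D(3) by auto
    have "?V \<boxplus> D = ?E"
    proof
      show "?V \<boxplus> D \<subseteq> ?E" using DE csub_add[OF E(1)] by blast
      show "?E \<subseteq> ?V \<boxplus> D"
      proof
        fix x assume x: "x \<in> ?E"
        then have "x \<in> D \<boxplus> ?L" using EM D(5) by blast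
        then obtain d l where dl: "x = d + l" "d \<in> D" "l \<in> ?L" by blast
        have "l = x - d" using dl(1) by simp
        then have "l \<in> ?E" using x DE[OF dl(2)] csub_diff[OF E(1)] by blast
        moreover have "x = l + d" using dl(1) by simp
        ultimately show "x \<in> ?V \<boxplus> D" using dl by blast
      qed
    qed
    moreover have "?V \<inter> D = {0}"
      using D(4) csub_0[OF V] csub_0[OF D(1)] by blast
    ultimately have "cdim ?E = cdim ?V + cdim D"
      using dim_direct_sum[OF V fV D(1,2)] by simp
    moreover have "{x \<in> ?E. T x = 0} = ?K" using EM KE by blast
    then have "cdim ?E = cdim ?K + cdim (T ` D)"
      using rank_nullity[OF clinear_cblinfun E, of T] TE by simp
    ultimately show "cdim ?V = cdim (T ` D)" using D(6) by simp
    show "T ` ?V \<subseteq> T ` D" using TE by blast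
    show "x \<in> ?V" if "x \<in> ?L" "T x = 0" for x
      using that M(3) KE by blast
    show "?L \<subseteq> T ` ?L \<boxplus> T ` D"
    proof
      fix y assume "y \<in> ?L"
      then obtain x where x: "x \<in> M" "y = T x" by blast
      then have "x \<in> D \<boxplus> ?L" using D(5) by simp
      then obtain d l where dl: "x = d + l" "d \<in> D" "l \<in> ?L" by blast
      have "y = T l + T d" using x(2) dl(1) by (simp add: cblin_add)
      then show "y \<in> T ` ?L \<boxplus> T ` D" using dl by blast
    qed
    show "T ` ?L \<inter> T ` D \<subseteq> T ` ?V"
    proof
      fix y assume "y \<in> T ` ?L \<inter> T ` D"
      then obtain l d where ld: "l \<in> ?L" "d \<in> D" "y = T l" "T l = T d" by auto
      have "l - d \<in> M" using ld(1,2) M(3) D(3) csub_diff[OF M(1)] by blast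
      then have "l - d \<in> ?K" using ld(4) by (simp add: cblin_diff)
      moreover have "l = (l - d) + d" by simp
      ultimately have "l \<in> ?E" using ld(2) by blast
      then show "y \<in> T ` ?V" using ld by blast
    qed
  qed
qed

text \<open>The last two assumptions say that \<open>T\<close> induces a bijection of the quotient by \<open>Y\<close>; the subspaces
  witnessing the Weyl property on \<open>Y\<close> then witness it on the whole space.\<close>

lemma Weyl_on_extend:
  fixes T :: "'a::complex_banach \<Rightarrow>\<^sub>C\<^sub>L 'a"
  assumes Y: "csubspace Y" "T ` Y \<subseteq> Y" and Weyl: "Weyl_on Y T"
    and pre: "\<And>x. T x \<in> Y \<Longrightarrow> x \<in> Y" and sum: "range T \<boxplus> Y = UNIV"
  shows "Weyl_on UNIV T"
proof -
  let ?K = "{x\<in>Y. T x = 0}"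
  obtain D where D: "csubspace D" "fin_dim D" "D \<subseteq> Y" "D \<inter> T ` Y = {0}" "D \<boxplus> T ` Y = Y"
    "cdim D = cdim ?K" "fin_dim ?K" by (rule Weyl_onE[OF Y Weyl])
  have K: "csubspace ?K" by (rule clinear_kernel_subspace[OF clinear_cblinfun Y(1)])
  show ?thesis
  proof (rule Weyl_onI[where V = ?K and W = D])
    show "T ` ?K \<subseteq> D" using csub_0[OF D(1)] by auto
    show "x \<in> ?K" if "T x = 0" for x
      using pre[of x] that csub_0[OF Y(1)] by simp
    show "UNIV \<subseteq> range T \<boxplus> D"
    proof
      fix x
      have "x \<in> range T \<boxplus> Y" using sum by simp
      then obtain u y where x: "x = T u + y" "y \<in> Y" by blast
      have "y \<in> D \<boxplus> T ` Y" using x(2) D(5) by simp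
      then obtain d v where y: "y = d + T v" "d \<in> D" by blast
      have "x = T (u + v) + d" using x(1) y(1) by (simp add: cblin_add algebra_simps)
      then show "x \<in> range T \<boxplus> D" using y(2) by blast
    qed
    show "range T \<inter> D \<subseteq> T ` ?K"
    proof
      fix y assume y: "y \<in> range T \<inter> D"
      then obtain x where x: "y = T x" by blast
      then have "x \<in> Y" using pre[of x] y D(3) by blast
      then have "y = 0" using x y D(4) by blast
      then show "y \<in> T ` ?K" using csub_0[OF K] by (force simp: cblin_0)
    qed
  qed (use D K in \<open>auto simp: csub_UNIV\<close>)
qed

section \<open>The dichotomy for Weyl operators\<close>

abbreviation iter :: "'a::complex_normed_vector \<Rightarrow>\<^sub>C\<^sub>L 'a \<Rightarrow> nat \<Rightarrow> 'a \<Rightarrow> 'a"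
  where "iter T n \<equiv> cblinfun_apply T ^^ n"

lemma clinear_iter: "clinear (iter T n)"
proof (induction n)
  case 0
  show ?case by (rule clinearI) auto
next
  case (Suc n)
  then show ?case
    by (intro clinearI)
      (simp_all add: complex_pair.linear_add complex_pair.linear_scale cblin_simps)
qed

lemma bounded_linear_iter: "bounded_linear (iter T n)"
proof (induction n)
  case (Suc n)
  then show ?case
    using bounded_linear_compose[OF bounded_linear_cblinfun, of "iter T n" T] by (simp add: o_def)
qed (simp add: bounded_linear_ident id_def)

lemma iter_simps:
  "iter T n (x + y) = iter T n x + iter T n y"
  "iter T n (x - y) = iter T n x - iter T n y"
  "iter T n (c *\<^sub>C x) = c *\<^sub>C iter T n x"
  "iter T n 0 = 0"
  using clinear_iter[of n T]
  by (simp_all add: complex_pair.linear_add complex_pair.linear_diff complex_pair.linear_scale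
      complex_pair.linear_0)

lemma iter_Suc_image: "iter T (Suc n) ` M = T ` iter T n ` M"
  by (simp add: image_comp)

lemma iter_commute: "iter T n (T x) = T (iter T n x)"
  by (simp add: funpow_swap1)

lemma iter_invariant: "cblinfun_apply T ` M \<subseteq> M \<Longrightarrow> x \<in> M \<Longrightarrow> iter T n x \<in> M"
  by (induction n) auto

lemma iter_image_subspace: "csubspace M \<Longrightarrow> csubspace (iter T n ` M)"
  by (rule clinear_subspace_image[OF clinear_iter])

lemma iter_image_invariant: "cblinfun_apply T ` M \<subseteq> M \<Longrightarrow> T ` iter T n ` M \<subseteq> iter T n ` M"
  by (auto simp flip: iter_commute)

lemma iter_image_decreasing:
  assumes "cblinfun_apply T ` M \<subseteq> M" "m \<le> n" shows "iter T n ` M \<subseteq> iter T m ` M"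
proof -
  have "iter T n x = iter T m (iter T (n - m) x)" for x
    using assms(2) by (metis comp_apply funpow_add le_add_diff_inverse)
  then show ?thesis using iter_invariant[OF assms(1)] by auto
qed

lemma Weyl_on_iter_image:
  fixes T :: "'a::complex_banach \<Rightarrow>\<^sub>C\<^sub>L 'a"
  assumes M: "csubspace M" "closed M" "T ` M \<subseteq> M" and Weyl: "Weyl_on M T"
  shows "closed (iter T n ` M) \<and> Weyl_on (iter T n ` M) T"
proof (induction n)
  case 0
  then show ?case using M Weyl by simp
next
  case (Suc n)
  show ?case
    unfolding iter_Suc_image
    using Weyl_on_image[OF iter_image_subspace[OF M(1)] _ iter_image_invariant[OF M(3)]] Suc by blast
qed

lemma dim_0_imp_trivial: "csubspace D \<Longrightarrow> fin_dim D \<Longrightarrow> cdim D = 0 \<Longrightarrow> D = {0}"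
  by (rule fin_dim_basis[of D]) auto

lemma subspace_eq_of_dim_le:
  assumes "csubspace U" "csubspace W" "U \<subseteq> W" "fin_dim W" "cdim W \<le> cdim U"
  shows "U = W"
proof -
  obtain D where D: "csubspace D" "D \<subseteq> W" "D \<inter> U = {0}" "D \<boxplus> U = W"
    by (rule subspace_complement[OF assms(1-3)])
  have f: "fin_dim D" "fin_dim U" using D(2) assms(3,4) fin_dim_subset by auto
  have "cdim W = cdim D + cdim U" using dim_direct_sum[OF D(1) f(1) assms(1) f(2) D(3)] D(4) by simp
  then have "D = {0}" using assms(5) by (intro dim_0_imp_trivial[OF D(1) f(1)]) simp
  then show ?thesis using D(4) by simp
qed

lemma injective_Weyl_on_imp_bij_betw:
  fixes T :: "'a::complex_banach \<Rightarrow>\<^sub>C\<^sub>L 'a"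
  assumes M: "csubspace M" "T ` M \<subseteq> M" and Weyl: "Weyl_on M T"
    and inj: "\<And>x. x \<in> M \<Longrightarrow> T x = 0 \<Longrightarrow> x = 0"
  shows "bij_betw T M M"
proof -
  obtain D where D: "csubspace D" "fin_dim D" "D \<subseteq> M" "D \<inter> T ` M = {0}" "D \<boxplus> T ` M = M"
    "cdim D = cdim {x\<in>M. T x = 0}" by (rule Weyl_onE[OF M Weyl])
  have "{x\<in>M. T x = 0} = {0}"
    using inj csub_0[OF M(1)] by (auto simp: cblin_0)
  then have "cdim {x\<in>M. T x = 0} = 0" using complex_vector.dim_le_card[of "{0}" "{}"] by simp
  then have "D = {0}" using D(6) by (intro dim_0_imp_trivial[OF D(1,2)]) simp
  then have "M \<subseteq> T ` M" using D(5) by simp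
  then show ?thesis using inj by (simp add: bij_betw_subspace_iff[OF M])
qed

lemma canalytic_nonzero_near:
  assumes f: "canalytic_on f (ball 0 r)" "r > 0" and "f 0 \<noteq> 0"
  obtains s where "s > 0" "s \<le> r" "\<And>z. z \<in> ball 0 s \<Longrightarrow> f z \<noteq> 0"
proof -
  have "0 \<in> ball (0::complex) r" using f(2) by simp
  then have "isCont f 0"
    using f(1) unfolding canalytic_on_def by (blast intro: has_derivative_continuous)
  then obtain e where e: "e > 0" "\<And>z. dist z 0 < e \<Longrightarrow> f z \<noteq> 0"
    using continuous_at_avoid[of 0 f 0] assms(3) by (auto simp: dist_commute)
  show ?thesis by (rule that[of "min e r"]) (use e f(2) in auto)
qed

text \<open>The first case occurs if \<open>T\<close> is injective on some \<open>L p = T\<^sup>p M\<close>. Otherwise the family \<open>f\<close> of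
  eigenvectors extends a kernel vector in the intersection of all \<open>L p\<close>.\<close>

lemma Weyl_on_dichotomy:
  fixes T :: "'a::complex_banach \<Rightarrow>\<^sub>C\<^sub>L 'a"
  assumes M: "csubspace M" "closed M" "T ` M \<subseteq> M" and Weyl: "Weyl_on M T"
  obtains (bij) p where "bij_betw T (iter T p ` M) (iter T p ` M)"
    | (eigen) r f where "r > 0" "canalytic_on f (ball 0 r)" "\<forall>z\<in>ball 0 r. f z \<noteq> 0"
      "\<forall>z\<in>ball 0 r. T (f z) = z *\<^sub>C f z"
proof -
  define L where "L p = iter T p ` M" for p
  define K where "K = {x\<in>M. T x = 0}"
  have L: "csubspace (L p)" "T ` L p \<subseteq> L p" "closed (L p)" "Weyl_on (L p) T" for p
    unfolding L_def using iter_image_subspace[OF M(1)] iter_image_invariant[OF M(3)]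
      Weyl_on_iter_image[OF M Weyl] by blast+
  have LS: "L (Suc p) = T ` L p" for p unfolding L_def by (rule iter_Suc_image)
  have dec: "L n \<subseteq> L m" if "m \<le> n" for m n
    unfolding L_def by (rule iter_image_decreasing[OF M(3) that])
  have LM: "L p \<subseteq> M" for p using dec[of 0 p] by (simp add: L_def)
  have K: "csubspace K" unfolding K_def by (rule clinear_kernel_subspace[OF clinear_cblinfun M(1)])
  have fK: "fin_dim K" unfolding K_def by (rule Weyl_onE[OF M(1,3) Weyl])
  show ?thesis
  proof (cases "\<exists>p. K \<inter> L p \<subseteq> {0}")
    case True
    then obtain p where p: "K \<inter> L p \<subseteq> {0}" by blast
    have "bij_betw T (L p) (L p)"
      by (rule injective_Weyl_on_imp_bij_betw[OF L(1,2,4)]) (use p LM in \<open>auto simp: K_def\<close>)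
    then show ?thesis unfolding L_def by (rule bij)
  next
    case False
    \<comment> \<open>The dimensions of the decreasing spaces \<open>K \<inter> L q\<close> attain their minimum, after which the spaces are constant.\<close>
    obtain p where p: "\<And>q. cdim (K \<inter> L p) \<le> cdim (K \<inter> L q)"
      using ex_has_least_nat[of "\<lambda>_. True" 0 "\<lambda>p. cdim (K \<inter> L p)"] by auto
    have stab: "K \<inter> L k = K \<inter> L p" if "p \<le> k" for k
    proof (rule subspace_eq_of_dim_le)
      show "csubspace (K \<inter> L k)" "csubspace (K \<inter> L p)"
        using K L(1) by (auto intro: csub_inter)
      show "K \<inter> L k \<subseteq> K \<inter> L p" using dec[OF that] by blast
      show "fin_dim (K \<inter> L p)" using fK by (rule fin_dim_subset[rotated]) auto
    qed (rule p)
    define I where "I = (\<Inter>k. L k)"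
    have I: "csubspace I" "closed I"
      unfolding I_def using L(1,3) by (auto intro: complex_vector.subspace_Inter)
    \<comment> \<open>The preimages \<open>u k \<in> L k\<close> of \<open>y\<close> differ by elements of the stationary space, so \<open>u p\<close> lies in every \<open>L k\<close>.\<close>
    have "I \<subseteq> T ` I"
    proof
      fix y assume "y \<in> I"
      then have "y \<in> T ` L k" for k unfolding I_def LS[symmetric] by blast
      then have "\<forall>k. \<exists>u. u \<in> L k \<and> T u = y" by (metis imageE)
      then obtain u where u: "\<And>k. u k \<in> L k" "\<And>k. T (u k) = y" by metis
      have "u p \<in> L k" for k
      proof (cases "p \<le> k")
        case True
        have "u k - u p \<in> L p"
          using u(1)[of k] u(1)[of p] dec[OF True] csub_diff[OF L(1)] by blast
        moreover have "T (u k - u p) = 0" by (simp add: cblin_diff u(2))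
        ultimately have "u k - u p \<in> K \<inter> L p" using LM by (auto simp: K_def)
        then have "u k - u p \<in> L k" using stab[OF True] by blast
        then have "u k - (u k - u p) \<in> L k"
          using u(1)[of k] csub_diff[OF L(1)] by blast
        then show ?thesis by simp
      next
        case False
        then show ?thesis using u(1)[of p] dec[of k p] by auto
      qed
      then show "y \<in> T ` I" using u(2)[of p] unfolding I_def by blast
    qed
    moreover have "T ` I \<subseteq> I" using L(2) unfolding I_def by blast
    ultimately have TI: "T ` I = I" by blast
    obtain C where C: "C > 0" "\<And>y. y \<in> T ` I \<Longrightarrow> \<exists>x\<in>I. T x = y \<and> norm x \<le> C * norm y"
      using bounded_preimages[OF bounded_linear_cblinfun csubspace_imp_subspace[OF I(1)] I(2), of T]
        TI I(2) by metis
    then obtain g where g: "\<And>y. y \<in> I \<Longrightarrow> g y \<in> I \<and> T (g y) = y \<and> norm (g y) \<le> C * norm y"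
      unfolding TI by metis
    obtain x0 where x0: "x0 \<in> K" "x0 \<in> L p" "x0 \<noteq> 0" using False by blast
    have "x0 \<in> L k" for k
      using x0(1,2) stab[of k] dec[of k p] by (cases "p \<le> k") auto
    then have x0I: "x0 \<in> I" unfolding I_def by blast
    define x where "x n = (g ^^ n) x0" for n
    have xI: "x n \<in> I" for n by (induction n) (use x0I g in \<open>auto simp: x_def\<close>)
    have Tx: "T (x (Suc n)) = x n" for n using g[OF xI[of n]] by (simp add: x_def)
    have bd: "norm (x n) \<le> norm x0 * C ^ n" for n
    proof (induction n)
      case (Suc n)
      have "norm (x (Suc n)) \<le> C * norm (x n)" using g[OF xI[of n]] by (simp add: x_def)
      also have "\<dots> \<le> C * (norm x0 * C ^ n)" using Suc C(1) by simp
      finally show ?case by (simp add: mult_ac)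
    qed (simp add: x_def)
    define f where "f z = (\<Sum>n. z ^ n *\<^sub>C x n)" for z
    have fa: "canalytic_on f (ball 0 (1 / C))"
      unfolding f_def by (rule power_series_canalytic[OF bd C(1)])
    have fT: "T (f z) = z *\<^sub>C f z" if "z \<in> ball 0 (1 / C)" for z
      using power_series_solution[OF bounded_clinear_cblinfun Tx bd C(1), of z] that x0(1)
      by (simp add: f_def x_def K_def)
    have "f 0 \<noteq> 0" using x0(3) by (simp add: f_def power_series_0 x_def)
    then obtain s where s: "s > 0" "s \<le> 1 / C" "\<And>z. z \<in> ball 0 s \<Longrightarrow> f z \<noteq> 0"
      using canalytic_nonzero_near[OF fa] C(1) by auto
    have "ball 0 s \<subseteq> ball (0::complex) (1 / C)" using s(2) by auto
    then have "canalytic_on f (ball 0 s)" "\<forall>z\<in>ball 0 s. T (f z) = z *\<^sub>C f z"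
      using fa fT unfolding canalytic_on_def by blast+
    then show ?thesis using s eigen by blast
  qed
qed

section \<open>Generalized Drazin invertibility\<close>

text \<open>The polynomial \<open>t\<^sup>n - c\<^sup>n\<close> is divisible by \<open>t - c\<close>.\<close>

lemma shift_telescope:
  assumes Z: "csubspace Z" "cblinfun_apply T ` Z \<subseteq> Z"
  shows "x \<in> Z \<Longrightarrow> \<exists>u\<in>Z. T u - c *\<^sub>C u = iter T n x - c ^ n *\<^sub>C x"
proof (induction n arbitrary: x)
  case 0
  then show ?case using csub_0[OF Z(1)] by (force simp: cblin_0 scaleC_one)
next
  case (Suc n)
  have "T x \<in> Z" using Suc.prems Z(2) by blast
  then obtain u where u: "u \<in> Z" "T u - c *\<^sub>C u = iter T n (T x) - c ^ n *\<^sub>C T x"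
    using Suc.IH by blast
  have "T (u + c ^ n *\<^sub>C x) - c *\<^sub>C (u + c ^ n *\<^sub>C x)
      = (T u - c *\<^sub>C u) + (c ^ n *\<^sub>C T x - c ^ Suc n *\<^sub>C x)"
    by (simp add: cblin_simps scaleC_add_right scaleC_scaleC)
  also have "\<dots> = iter T (Suc n) x - c ^ Suc n *\<^sub>C x"
    unfolding u(2) by (simp add: iter_commute)
  finally show ?case
    using u(1) Suc.prems csub_add[OF Z(1)] csub_scale[OF Z(1)]
    by blast
qed

lemma iter_eigenvector: "cblinfun_apply T x = c *\<^sub>C x \<Longrightarrow> iter T n x = c ^ n *\<^sub>C x"
  by (induction n) (simp_all add: scaleC_one cblin_scaleC scaleC_scaleC mult.commute)

lemma nilpotent_shift_bij_betw:
  fixes T :: "'a::complex_normed_vector \<Rightarrow>\<^sub>C\<^sub>L 'a"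
  assumes Z: "csubspace Z" "T ` Z \<subseteq> Z" and nil: "\<And>x. x \<in> Z \<Longrightarrow> iter T p x = 0" and "c \<noteq> 0"
  shows "bij_betw (shifted T c) Z Z"
  unfolding bij_betw_subspace_iff[OF Z(1) shift_invariant[OF Z]]
proof (intro conjI ballI impI subsetI)
  fix x assume x: "x \<in> Z" "shifted T c x = 0"
  then have "iter T p x = c ^ p *\<^sub>C x" by (intro iter_eigenvector) (simp add: shift_apply)
  then show "x = 0" using nil[OF x(1)] \<open>c \<noteq> 0\<close> by simp
next
  fix x assume x: "x \<in> Z"
  obtain u where u: "u \<in> Z" "T u - c *\<^sub>C u = iter T p x - c ^ p *\<^sub>C x"
    using shift_telescope[OF Z x] by blast
  let ?v = "- inverse (c ^ p) *\<^sub>C u"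
  have "shifted T c ?v = - inverse (c ^ p) *\<^sub>C (T u - c *\<^sub>C u)"
    by (simp only: shift_apply[symmetric] cblin_scaleC)
  also have "\<dots> = x" using nil[OF x] \<open>c \<noteq> 0\<close> by (simp add: u(2) scaleC_scaleC scaleC_one)
  finally show "x \<in> shifted T c ` Z"
    using u(1) csub_scale[OF Z(1)] by blast
qed

lemma bij_betw_direct_sum:
  fixes T :: "'a::complex_normed_vector \<Rightarrow>\<^sub>C\<^sub>L 'a"
  assumes A: "csubspace A" "bij_betw T A A" and B: "csubspace B" "bij_betw T B B"
    and AB: "A \<inter> B = {0}"
  shows "bij_betw T (A \<boxplus> B) (A \<boxplus> B)"
proof -
  have im: "T ` A = A" "T ` B = B" using A(2) B(2) by (auto simp: bij_betw_def)
  have ker: "\<And>a. a \<in> A \<Longrightarrow> T a = 0 \<Longrightarrow> a = 0" "\<And>b. b \<in> B \<Longrightarrow> T b = 0 \<Longrightarrow> b = 0"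
    using A B bij_betw_subspace_iff[of A T] bij_betw_subspace_iff[of B T] im by auto
  have "T ` (A \<boxplus> B) \<subseteq> A \<boxplus> B"
  proof clarify
    fix a b assume "a \<in> A" "b \<in> B"
    then have "T (a + b) = T a + T b" "T a \<in> A" "T b \<in> B" using im by (auto simp: cblin_add)
    then show "\<exists>x y. T (a + b) = x + y \<and> x \<in> A \<and> y \<in> B" by blast
  qed
  moreover have "A \<boxplus> B \<subseteq> T ` (A \<boxplus> B)"
  proof clarify
    fix a b assume "a \<in> A" "b \<in> B"
    then have "a \<in> T ` A" "b \<in> T ` B" using im by simp_all
    then obtain a' b' where "a' \<in> A" "T a' = a" "b' \<in> B" "T b' = b" by (elim imageE) metis
    then show "a + b \<in> T ` (A \<boxplus> B)" by (intro image_eqI[of _ _ "a' + b'"]) (auto simp: cblin_add)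
  qed
  moreover have "x = 0" if x: "x \<in> A \<boxplus> B" "T x = 0" for x
  proof -
    obtain a b where ab: "x = a + b" "a \<in> A" "b \<in> B" using x(1) by blast
    then have "T a = T (- b)" using x(2) by (simp add: cblin_add cblin_neg eq_neg_iff_add_eq_0)
    moreover have "T a \<in> A" using im(1) ab(2) by blast
    moreover have "T (- b) \<in> B" using im(2) ab(3) csub_neg[OF B(1)] by blast
    ultimately have "T a = 0" using AB by auto
    moreover from this have "T b = 0" using x(2) ab(1) by (simp add: cblin_add)
    ultimately have "a = 0" "b = 0" using ker ab(2,3) by blast+
    then show ?thesis using ab(1) by simp
  qed
  ultimately show ?thesis
    using bij_betw_subspace_iff[OF csubspace_sum[OF A(1) B(1)], of T] by blast
qed

text \<open>Every \<open>x \<in> M\<close> has the same image under \<open>T\<^sup>p\<close> as some \<open>l \<in> T\<^sup>p M\<close>, because \<open>T\<^sup>p\<close> is bijective on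
  \<open>T\<^sup>p M\<close>; and \<open>T\<^sup>p M\<close> is closed as an operator range with a closed complement.\<close>

lemma iter_bij_decomposition:
  fixes T :: "'a::complex_banach \<Rightarrow>\<^sub>C\<^sub>L 'a"
  assumes M: "csubspace M" "closed M" "T ` M \<subseteq> M"
    and bij: "bij_betw T (iter T p ` M) (iter T p ` M)"
  defines "Z \<equiv> {x\<in>M. iter T p x = 0}"
  shows "csubspace Z" "closed Z" "T ` Z \<subseteq> Z" "iter T p ` M \<inter> Z = {0}" "iter T p ` M \<boxplus> Z = M"
    "closed (iter T p ` M)"
proof -
  let ?L = "iter T p ` M"
  have L: "csubspace ?L" by (rule iter_image_subspace[OF M(1)])
  have LM: "?L \<subseteq> M" using iter_invariant[OF M(3)] by blast
  show Z: "csubspace Z" unfolding Z_def by (rule clinear_kernel_subspace[OF clinear_iter M(1)])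
  have "closed {x. iter T p x = 0}"
    by (intro closed_Collect_eq bounded_linear.continuous_on[OF bounded_linear_iter] continuous_intros)
  moreover have "Z = M \<inter> {x. iter T p x = 0}" by (auto simp: Z_def)
  ultimately show cZ: "closed Z" using M(2) by auto
  show "T ` Z \<subseteq> Z" using M(3) by (auto simp: Z_def iter_commute cblin_0)
  have bp: "bij_betw (iter T p) ?L ?L" using bij by (rule bij_betw_funpow)
  have "x = 0" if x: "x \<in> ?L" "x \<in> Z" for x
  proof -
    have "iter T p x = iter T p 0" using x(2) by (simp add: Z_def iter_simps)
    then show ?thesis
      using bp x(1) csub_0[OF L] unfolding bij_betw_def inj_on_def by blast
  qed
  then show LZ: "?L \<inter> Z = {0}"
    using csub_0[OF L] csub_0[OF Z] by blast
  show sum: "?L \<boxplus> Z = M"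
  proof
    show "?L \<boxplus> Z \<subseteq> M" using LM csub_add[OF M(1)] by (auto simp: Z_def)
    show "M \<subseteq> ?L \<boxplus> Z"
    proof
      fix x assume x: "x \<in> M"
      then have "iter T p x \<in> iter T p ` ?L" using bp by (auto simp: bij_betw_def)
      then obtain l where l: "l \<in> ?L" "iter T p x = iter T p l" by blast
      then have "x - l \<in> Z" using x LM csub_diff[OF M(1)] by (auto simp: Z_def iter_simps)
      moreover have "x = l + (x - l)" by simp
      ultimately show "x \<in> ?L \<boxplus> Z" using l(1) by blast
    qed
  qed
  show "closed ?L"
    by (rule closed_image_of_closed_complement[OF bounded_linear_iter csubspace_imp_subspace[OF M(1)] M(2)
          csubspace_imp_subspace[OF Z] cZ]) (use LZ sum M(2) in auto)
qed

lemma quasinilpotent_on_iff: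
  fixes T :: "'a::complex_banach \<Rightarrow>\<^sub>C\<^sub>L 'a"
  assumes "csubspace N" "closed N" "T ` N \<subseteq> N"
  shows "quasinilpotent_on N T \<longleftrightarrow> (\<forall>c. c \<noteq> 0 \<longrightarrow> bij_betw (shifted T c) N N)"
  using invertible_on_iff_bij_betw[OF assms(1,2) shift_invariant[OF assms(1,3)]]
  by (auto simp: quasinilpotent_on_def spectrum_on_def)

lemma RedD:
  assumes "(M, N) \<in> Red T"
  shows "csubspace M" "closed M" "T ` M \<subseteq> M" "csubspace N" "closed N" "T ` N \<subseteq> N"
    "M \<inter> N = {0}" "M \<boxplus> N = UNIV"
  using assms by (auto simp: Red_def)

text \<open>The nilpotent part of \<open>T\<close> on \<open>M\<close> is joined to \<open>N\<close>. The new summand is closed, being the kernel of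
  \<open>T\<^sup>p\<close> composed with the bounded projection onto \<open>M\<close>.\<close>

lemma generalized_Drazin_of_bij_iter:
  fixes T :: "'a::complex_banach \<Rightarrow>\<^sub>C\<^sub>L 'a"
  assumes Red: "(M, N) \<in> Red T" and quasi: "quasinilpotent_on N T"
    and bij: "bij_betw T (iter T p ` M) (iter T p ` M)"
  shows "generalized_Drazin_invertible T"
proof -
  note R = RedD[OF Red]
  let ?L = "iter T p ` M" and ?Z = "{x\<in>M. iter T p x = 0}"
  note D = iter_bij_decomposition[OF R(1-3) bij]
  have L: "csubspace ?L" "T ` ?L \<subseteq> ?L"
    by (rule iter_image_subspace[OF R(1)], rule iter_image_invariant[OF R(3)])
  have LM: "?L \<subseteq> M" using iter_invariant[OF R(3)] by blast
  obtain P :: "'a \<Rightarrow>\<^sub>C\<^sub>L 'a" where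
    P: "\<And>x. P x \<in> M" "\<And>x. x - P x \<in> N" "\<And>x. x \<in> M \<Longrightarrow> P x = x" "\<And>x. x \<in> N \<Longrightarrow> P x = 0"
    using bounded_projection[OF R(1,2,4,5,7,8)] by blast
  let ?N = "?Z \<boxplus> N"
  have NP: "?N = {x. iter T p (P x) = 0}"
  proof
    show "?N \<subseteq> {x. iter T p (P x) = 0}" by (auto simp: cblin_add P(3,4))
    show "{x. iter T p (P x) = 0} \<subseteq> ?N"
    proof
      fix x assume "x \<in> {x. iter T p (P x) = 0}"
      then have "P x \<in> ?Z" using P(1) by simp
      moreover have "x = P x + (x - P x)" by simp
      ultimately show "x \<in> ?N" using P(2) by blast
    qed
  qed
  have N: "csubspace ?N" by (rule csubspace_sum[OF D(1) R(4)])
  have cN: "closed ?N"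
    unfolding NP by (intro closed_Collect_eq bounded_linear.continuous_on[OF bounded_linear_iter]
        continuous_intros)
  have ZN: "?Z \<inter> N = {0}"
    using R(7) csub_0[OF D(1)] csub_0[OF R(4)] by blast
  have TN: "T ` ?N \<subseteq> ?N"
  proof clarify
    fix z n assume "z \<in> M" "iter T p z = 0" "n \<in> N"
    then have "T (z + n) = T z + T n" "T z \<in> ?Z" "T n \<in> N" using D(3) R(6) by (auto simp: cblin_add)
    then show "\<exists>x y. T (z + n) = x + y \<and> x \<in> ?Z \<and> y \<in> N" by blast
  qed
  have "x = 0" if x: "x \<in> ?L" "x \<in> ?N" for x
  proof -
    have "P x = x" using P(3) x(1) LM by blast
    then have "iter T p x = 0" using x(2) unfolding NP by simp
    then have "x \<in> ?L \<inter> ?Z" using x(1) LM by blast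
    then show ?thesis using D(4) by blast
  qed
  then have LN: "?L \<inter> ?N = {0}"
    using csub_0[OF L(1)] csub_0[OF N] by blast
  have "x \<in> ?L \<boxplus> ?N" for x
  proof -
    have "P x \<in> ?L \<boxplus> ?Z" using P(1) D(5) by simp
    then obtain l z where lz: "P x = l + z" "l \<in> ?L" "z \<in> ?Z" by blast
    have "x = P x + (x - P x)" by simp
    then have "x = l + (z + (x - P x))" using lz(1) by (metis add.assoc)
    moreover have "z + (x - P x) \<in> ?N" using lz(3) P(2) by blast
    ultimately show ?thesis using lz(2) by blast
  qed
  then have "(?L, ?N) \<in> Red T"
    using L D(6) N cN TN LN unfolding Red_def by blast
  moreover have "invertible_on ?L T"
    using invertible_on_iff_bij_betw[OF L(1) D(6) L(2)] bij by blast
  moreover have "quasinilpotent_on ?N T"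
    unfolding quasinilpotent_on_iff[OF N cN TN]
  proof (intro allI impI)
    fix c :: complex assume c: "c \<noteq> 0"
    have "bij_betw (shifted T c) ?Z ?Z"
      by (rule nilpotent_shift_bij_betw[OF D(1,3) _ c]) auto
    moreover have "bij_betw (shifted T c) N N"
      using quasi c quasinilpotent_on_iff[OF R(4-6)] by blast
    ultimately show "bij_betw (shifted T c) ?N ?N"
      by (intro bij_betw_direct_sum D(1) R(4) ZN)
  qed
  ultimately show ?thesis unfolding generalized_Drazin_invertible_def by blast
qed

lemma Red_trivial: "(UNIV, {0}) \<in> Red T"
  unfolding Red_def by (auto simp: csub_UNIV csubspace_0 cblin_0)

lemma quasinilpotent_on_0: "quasinilpotent_on {0} (T :: 'a::complex_banach \<Rightarrow>\<^sub>C\<^sub>L 'a)"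
  by (subst quasinilpotent_on_iff) (auto simp: csubspace_0 cblin_0 bij_betw_def)

lemma generalized_Drazin_imp_punctured:
  fixes T :: "'a::complex_banach \<Rightarrow>\<^sub>C\<^sub>L 'a"
  assumes "generalized_Drazin_invertible T"
  obtains r where "r > 0" "\<And>c. c \<noteq> 0 \<Longrightarrow> cmod c < r \<Longrightarrow> bij (shifted T c)"
proof -
  obtain M N where MN: "(M, N) \<in> Red T" "invertible_on M T" "quasinilpotent_on N T"
    using assms by (auto simp: generalized_Drazin_invertible_def)
  note R = RedD[OF MN(1)]
  have "bij_betw T M M" using invertible_on_iff_bij_betw[OF R(1-3)] MN(2) by blast
  then obtain r where r: "r > 0" "\<And>c. cmod c < r \<Longrightarrow> bij_betw (shifted T c) M M"
    using bij_betw_perturb[OF R(1,2)] by blast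
  have "bij (shifted T c)" if c: "c \<noteq> 0" "cmod c < r" for c
  proof -
    have "bij_betw (shifted T c) N N"
      using MN(3) c(1) quasinilpotent_on_iff[OF R(4-6)] by blast
    then show ?thesis
      using bij_betw_direct_sum[OF R(1) r(2)[OF c(2)] R(4) _ R(7)] R(8) by simp
  qed
  then show ?thesis using that r(1) by blast
qed

section \<open>Browder operators\<close>

text \<open>Past the ascent the kernels, and past the descent the ranges, of the iterates no longer change;
  \<open>p + q\<close> is past both.\<close>

lemma finite_ascent_descent_iff:
  "ascent T < \<infinity> \<and> descent T < \<infinity> \<longleftrightarrow> (\<exists>p. bij_betw T (range (iter T p)) (range (iter T p)))"
proof
  assume a: "ascent T < \<infinity> \<and> descent T < \<infinity>"
  have "{p::nat. {x. iter T p x = 0} = {x. iter T (p + 1) x = 0}} \<noteq> {}"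
  proof
    assume "{p::nat. {x. iter T p x = 0} = {x. iter T (p + 1) x = 0}} = {}"
    then have "ascent T = \<infinity>" unfolding ascent_def by (simp only: image_empty Inf_empty top_enat_def)
    then show False using a by simp
  qed
  then obtain p where p: "{x. iter T p x = 0} = {x. iter T (p + 1) x = 0}" by blast
  have "{q::nat. range (iter T q) = range (iter T (q + 1))} \<noteq> {}"
  proof
    assume "{q::nat. range (iter T q) = range (iter T (q + 1))} = {}"
    then have "descent T = \<infinity>" unfolding descent_def by (simp only: image_empty Inf_empty top_enat_def)
    then show False using a by simp
  qed
  then obtain q where q: "range (iter T q) = range (iter T (q + 1))" by blast
  define m where "m = p + q"
  have ker: "iter T m x = 0" if "iter T (Suc m) x = 0" for x
  proof -
    have "iter T (p + 1) (iter T q x) = 0"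
      using that by (simp add: m_def funpow_add)
    then have "iter T p (iter T q x) = 0" using p by blast
    then show ?thesis by (simp add: m_def funpow_add)
  qed
  have ran: "range (iter T m) = range (iter T (Suc m))"
  proof -
    have "range (iter T m) = iter T p ` range (iter T q)"
      by (simp add: m_def funpow_add image_comp)
    also have "\<dots> = range (iter T (p + (q + 1)))"
      unfolding q by (simp only: funpow_add image_comp)
    also have "p + (q + 1) = Suc m" by (simp add: m_def)
    finally show ?thesis .
  qed
  have sub: "csubspace (range (iter T m))"
    by (rule iter_image_subspace[OF csub_UNIV])
  have inv: "T ` range (iter T m) = range (iter T m)"
    using ran iter_Suc_image[of m T UNIV] by simp
  have "bij_betw T (range (iter T m)) (range (iter T m))"
    unfolding bij_betw_subspace_iff[OF sub equalityD1[OF inv]]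
    using ker inv by auto
  then show "\<exists>p. bij_betw T (range (iter T p)) (range (iter T p))" by blast
next
  assume "\<exists>p. bij_betw T (range (iter T p)) (range (iter T p))"
  then obtain p where p: "bij_betw T (range (iter T p)) (range (iter T p))" by blast
  have sub: "csubspace (range (iter T p))"
    by (rule iter_image_subspace[OF csub_UNIV])
  have inv: "T ` range (iter T p) = range (iter T p)" using p by (simp add: bij_betw_def)
  then have q: "range (iter T p) = range (iter T (p + 1))" using iter_Suc_image[of p T UNIV] by simp
  have "iter T p x = 0" if "iter T (p + 1) x = 0" for x
    using p that unfolding bij_betw_subspace_iff[OF sub equalityD1[OF inv]] by auto
  then have k: "{x. iter T p x = 0} = {x. iter T (p + 1) x = 0}" by (auto simp: cblin_0)
  have "ascent T \<le> enat p" unfolding ascent_def using k by (intro INF_lower) blast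
  moreover have "descent T \<le> enat p" unfolding descent_def using q by (intro INF_lower) blast
  ultimately show "ascent T < \<infinity> \<and> descent T < \<infinity>"
    by (cases "ascent T"; cases "descent T") auto
qed

text \<open>For the Weyl property the criterion is applied to \<open>V = W = N(T\<^sup>p)\<close>: the complement \<open>R(T\<^sup>p)\<close> is mapped
  bijectively onto itself, and \<open>N(T\<^sup>p)\<close> is finite-dimensional because \<open>N(T)\<close> is.\<close>

lemma Browder_imp_Weyl_generalized_Drazin:
  fixes T :: "'a::complex_banach \<Rightarrow>\<^sub>C\<^sub>L 'a"
  assumes "Browder T"
  shows "Weyl_on UNIV T" "generalized_Drazin_invertible T"
proof -
  obtain p where p: "bij_betw T (range (iter T p)) (range (iter T p))"
    using assms finite_ascent_descent_iff[of T] by (auto simp: Browder_def)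
  show "generalized_Drazin_invertible T"
    using generalized_Drazin_of_bij_iter[OF Red_trivial quasinilpotent_on_0 p] .
  let ?L = "range (iter T p)" and ?Z = "{x. iter T p x = 0}"
  have L: "csubspace ?L" by (rule iter_image_subspace[OF csub_UNIV])
  have inv: "T ` ?L = ?L" using p by (simp add: bij_betw_def)
  have inj: "x = 0" if "x \<in> ?L" "T x = 0" for x
    using p that unfolding bij_betw_subspace_iff[OF L equalityD1[OF inv]] by blast
  have D: "csubspace ?Z" "T ` ?Z \<subseteq> ?Z" "?L \<inter> ?Z = {0}" "?L \<boxplus> ?Z = UNIV"
    using iter_bij_decomposition[OF csub_UNIV closed_UNIV _ p] by auto
  have fker: "fin_dim {x. T x = 0}"
    using assms by (simp add: Browder_def Fredholm_on_def upper_semi_Fredholm_on_def kernel_on_def)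
  have fZ: "fin_dim {x. iter T k x = 0}" for k
  proof (induction k)
    case 0
    then show ?case using fin_dim_0 by simp
  next
    case (Suc k)
    have "csubspace {x. iter T (Suc k) x = 0}"
      using clinear_kernel_subspace[OF clinear_iter csub_UNIV, of "Suc k" T] by simp
    then show ?case
    proof (rule fin_dim_of_kernel_image[OF clinear_cblinfun])
      show "fin_dim {x \<in> {x. iter T (Suc k) x = 0}. T x = 0}"
        using fker by (rule fin_dim_subset[rotated]) auto
      show "fin_dim (T ` {x. iter T (Suc k) x = 0})"
        using Suc by (rule fin_dim_subset[rotated]) (auto simp: iter_commute)
    qed
  qed
  have split: "x \<in> ?Z" if "T x \<in> ?Z" for x
  proof -
    have "x \<in> ?L \<boxplus> ?Z" using D(4) by simp
    then obtain l z where lz: "x = l + z" "l \<in> ?L" "z \<in> ?Z" by blast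
    have "T l = T x - T z" by (simp add: lz(1) cblin_add)
    moreover have "T x - T z \<in> ?Z"
      using that D(2) lz(3) csub_diff[OF D(1)] by blast
    moreover have "T l \<in> ?L" using inv lz(2) by blast
    ultimately have "T l \<in> ?L \<inter> ?Z" by (intro IntI) simp_all
    then have "T l = 0" unfolding D(3) by simp
    then have "l = 0" using inj lz(2) by blast
    then show ?thesis using lz by simp
  qed
  show "Weyl_on UNIV T"
  proof (rule Weyl_onI[where V = ?Z and W = ?Z])
    show "x \<in> ?Z" if "T x = 0" for x
      by (rule split) (simp add: that iter_simps)
    show "UNIV \<subseteq> range T \<boxplus> ?Z"
    proof
      fix x
      have "x \<in> ?L \<boxplus> ?Z" using D(4) by simp
      then obtain l z where lz: "x = l + z" "l \<in> T ` ?L" "z \<in> ?Z" unfolding inv by blast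
      then show "x \<in> range T \<boxplus> ?Z" by blast
    qed
    show "range T \<inter> ?Z \<subseteq> T ` ?Z" using split by blast
  qed (use D fZ in \<open>auto simp: csub_UNIV\<close>)
qed

lemma Browder_of_Weyl_bij_iter:
  assumes "Weyl_on UNIV T" "bij_betw T (range (iter T p)) (range (iter T p))"
  shows "Browder T"
  using assms finite_ascent_descent_iff[of T] by (auto simp: Browder_def Weyl_on_def)

section \<open>The single valued extension property\<close>

lemma canalytic_functional:
  assumes f: "canalytic_on f U"
  shows "(\<lambda>z. cblinfun_apply (\<phi> :: 'a::complex_normed_vector \<Rightarrow>\<^sub>C\<^sub>L complex) (f z)) holomorphic_on U"
proof (rule holomorphic_onI)
  fix z assume "z \<in> U"
  then obtain D where "(f has_derivative (\<lambda>h. h *\<^sub>C D)) (at z)"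
    using f unfolding canalytic_on_def by blast
  then have "((\<lambda>z. \<phi> (f z)) has_derivative (\<lambda>h. \<phi> (h *\<^sub>C D))) (at z)"
    by (rule bounded_linear.has_derivative[OF bounded_linear_cblinfun])
  moreover have "(\<lambda>h. \<phi> (h *\<^sub>C D)) = (*) (\<phi> D)"
    by (auto simp: cblin_scaleC scaleC_complex_def mult.commute)
  ultimately have "((\<lambda>z. \<phi> (f z)) has_field_derivative \<phi> D) (at z)"
    by (simp add: has_field_derivative_def)
  then show "(\<lambda>z. \<phi> (f z)) field_differentiable at z within U"
    by (metis field_differentiable_def has_field_derivative_at_within)
qed

text \<open>The scalar identity theorem for \<open>\<phi> \<circ> f\<close>, where \<open>\<phi>\<close> separates \<open>f w\<close> from \<open>0\<close>.\<close>

lemma canalytic_identity: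
  fixes f :: "complex \<Rightarrow> 'a::complex_normed_vector"
  assumes f: "canalytic_on f U" and U: "connected U" "z0 \<in> U" and r: "r > 0"
    and zero: "\<And>z. z \<in> U \<Longrightarrow> z \<noteq> z0 \<Longrightarrow> dist z0 z < r \<Longrightarrow> f z = 0" and w: "w \<in> U"
  shows "f w = 0"
proof (rule ccontr)
  assume "f w \<noteq> 0"
  then obtain \<phi> :: "'a \<Rightarrow>\<^sub>C\<^sub>L complex" where \<phi>: "\<phi> (f w) \<noteq> 0" by (rule functional_separates)
  have oU: "open U" using f by (simp add: canalytic_on_def)
  have "z0 islimpt (U \<inter> ball z0 r)"
    using oU U(2) r by (intro interior_limit_point) (simp add: interior_open)
  then have lim: "z0 islimpt (U \<inter> ball z0 r - {z0})" using islimpt_punctured by blast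
  have "\<phi> (f w) = 0"
    by (rule analytic_continuation[OF canalytic_functional[OF f] oU U(1) _ U(2) lim])
      (use zero w in \<open>auto simp: cblin_0\<close>)
  then show False using \<phi> by simp
qed

lemma SVEP_at_iff:
  "SVEP_at T z0 \<longleftrightarrow> (\<forall>U f. open U \<and> connected U \<and> z0 \<in> U \<and> canalytic_on f U \<and>
      (\<forall>z\<in>U. cblinfun_apply T (f z) = z *\<^sub>C f z) \<longrightarrow> (\<forall>z\<in>U. f z = 0))"
  unfolding SVEP_at_def by (simp add: shift_apply)

text \<open>A solution of \<open>T (f z) = z f z\<close> vanishes at all \<open>z \<noteq> z0\<close> near \<open>z0\<close> and hence everywhere.\<close>

lemma SVEP_at_of_punctured_injective:
  assumes r: "r > 0"
    and inj: "\<And>c x. c \<noteq> z0 \<Longrightarrow> dist z0 c < r \<Longrightarrow> cblinfun_apply T x = c *\<^sub>C x \<Longrightarrow> x = 0"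
  shows "SVEP_at T z0"
  unfolding SVEP_at_iff
proof (intro allI impI ballI)
  fix U f w
  assume "open U \<and> connected U \<and> z0 \<in> U \<and> canalytic_on f U \<and> (\<forall>z\<in>U. T (f z) = z *\<^sub>C f z)" "w \<in> U"
  then show "f w = 0"
    using inj by (intro canalytic_identity[of f U z0 r w] r) auto
qed

lemma bij_shift_injective:
  assumes "bij (shifted T c)" "cblinfun_apply T x = c *\<^sub>C x"
  shows "x = 0"
proof -
  have "shifted T c x = shifted T c 0"
    using assms(2) by (simp add: shift_apply cblin_0)
  then show ?thesis using assms(1) by (meson bij_is_inj injD)
qed

text \<open>A functional annihilating the range of the surjective operator \<open>T - c\<close> vanishes.\<close>

lemma bij_shift_adjoint_injective:
  assumes bij: "bij (shifted T c)"
    and eig: "cblinfun_apply (banach_adjoint T) \<phi> = c *\<^sub>C \<phi>"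
  shows "\<phi> = 0"
proof (rule cblinfun_eqI)
  fix y
  obtain x where y: "y = shifted T c x"
    using bij by (meson bij_pointE)
  have "\<phi> (T x) = c *\<^sub>C \<phi> x"
    using arg_cong[OF eig, of "\<lambda>\<psi>. cblinfun_apply \<psi> x"]
    by (simp add: banach_adjoint.rep_eq cblinfun_compose.rep_eq scaleC_cblinfun.rep_eq)
  then show "\<phi> y = cblinfun_apply 0 y"
    by (simp add: y shift_apply cblin_diff cblin_scaleC zero_cblinfun.rep_eq)
qed

lemma generalized_Drazin_imp_SVEP:
  fixes T :: "'a::complex_banach \<Rightarrow>\<^sub>C\<^sub>L 'a"
  assumes "generalized_Drazin_invertible (T - \<mu> *\<^sub>C id_cblinfun)"
  shows "SVEP_at T \<mu>" "SVEP_at (banach_adjoint T) \<mu>"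
proof -
  obtain r where r: "r > 0"
    "\<And>c. c \<noteq> 0 \<Longrightarrow> cmod c < r \<Longrightarrow> bij (cblinfun_apply ((T - \<mu> *\<^sub>C id_cblinfun) - c *\<^sub>C id_cblinfun))"
    using generalized_Drazin_imp_punctured[OF assms] by blast
  have bij: "bij (shifted T c)" if "c \<noteq> \<mu>" "dist \<mu> c < r" for c
    using r(2)[of "c - \<mu>"] that by (simp add: shift_shift dist_norm norm_minus_commute)
  show "SVEP_at T \<mu>"
    using r(1) by (rule SVEP_at_of_punctured_injective) (rule bij_shift_injective[OF bij])
  show "SVEP_at (banach_adjoint T) \<mu>"
    using r(1) by (rule SVEP_at_of_punctured_injective) (rule bij_shift_adjoint_injective[OF bij])
qed

lemma canalytic_translate:
  assumes "canalytic_on f (ball a r)" shows "canalytic_on (\<lambda>z. f (z - \<mu>)) (ball (a + \<mu>) r)"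
  unfolding canalytic_on_def
proof (intro conjI ballI)
  fix z assume "z \<in> ball (a + \<mu>) r"
  then have "z - \<mu> \<in> ball a r" by (simp add: dist_norm algebra_simps)
  then obtain D where "(f has_derivative (\<lambda>h. h *\<^sub>C D)) (at (z - \<mu>))"
    using assms unfolding canalytic_on_def by blast
  moreover have "((\<lambda>z. z - \<mu>) has_derivative (\<lambda>h. h)) (at z)"
    by (auto intro!: derivative_eq_intros)
  ultimately have "((\<lambda>z. f (z - \<mu>)) has_derivative (\<lambda>h. h *\<^sub>C D)) (at z)"
    using has_derivative_compose[of "\<lambda>z. z - \<mu>" "\<lambda>h. h" z UNIV f "\<lambda>h. h *\<^sub>C D"] by simp
  then show "\<exists>D. ((\<lambda>z. f (z - \<mu>)) has_derivative (\<lambda>h. h *\<^sub>C D)) (at z)" by blast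
qed simp

lemma canalytic_eigenvectors_imp_not_SVEP:
  assumes "r > 0" "canalytic_on f (ball 0 r)" "\<forall>z\<in>ball 0 r. f z \<noteq> 0"
    "\<forall>z\<in>ball 0 r. shifted T \<mu> (f z) = z *\<^sub>C f z"
  shows "\<not> SVEP_at T \<mu>"
proof
  assume S: "SVEP_at T \<mu>"
  have "T (f (z - \<mu>)) = z *\<^sub>C f (z - \<mu>)" if "z \<in> ball \<mu> r" for z
  proof -
    have "z - \<mu> \<in> ball 0 r" using that by (simp add: dist_norm norm_minus_commute)
    then have "T (f (z - \<mu>)) - \<mu> *\<^sub>C f (z - \<mu>) = (z - \<mu>) *\<^sub>C f (z - \<mu>)"
      using assms(4) by (simp add: shift_apply)
    then show ?thesis by (simp add: complex_vector.scale_left_diff_distrib)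
  qed
  then have "open (ball \<mu> r) \<and> connected (ball \<mu> r) \<and> \<mu> \<in> ball \<mu> r \<and>
      canalytic_on (\<lambda>z. f (z - \<mu>)) (ball \<mu> r) \<and> (\<forall>z\<in>ball \<mu> r. T (f (z - \<mu>)) = z *\<^sub>C f (z - \<mu>))"
    using canalytic_translate[OF assms(2), of \<mu>] assms(1) by simp
  then have "\<forall>z\<in>ball \<mu> r. f (z - \<mu>) = 0" by (rule S[unfolded SVEP_at_iff, THEN spec, THEN spec, THEN mp])
  then have "f (\<mu> - \<mu>) = 0" using assms(1) by (metis centre_in_ball)
  then show False using assms(1,3) by simp
qed

section \<open>From Weyl to Browder operators\<close>

text \<open>The eigenvectors of the second case of the dichotomy are excluded by bijectivity of \<open>T - c\<close>.\<close>

lemma Browder_of_Weyl_punctured: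
  fixes T :: "'a::complex_banach \<Rightarrow>\<^sub>C\<^sub>L 'a"
  assumes Weyl: "Weyl_on UNIV T" and r: "r > 0"
    and bij: "\<And>c. c \<noteq> 0 \<Longrightarrow> cmod c < r \<Longrightarrow> bij (shifted T c)"
  shows "Browder T"
proof (rule Weyl_on_dichotomy[OF csub_UNIV closed_UNIV _ Weyl])
  show "range T \<subseteq> UNIV" by simp
  show "Browder T" if "bij_betw T (range (iter T p)) (range (iter T p))" for p
    using Weyl that by (rule Browder_of_Weyl_bij_iter)
  fix s f
  assume s: "s > 0" "\<forall>z\<in>ball 0 s. f z \<noteq> 0" "\<forall>z\<in>ball 0 s. T (f z) = z *\<^sub>C f z"
  define c where "c = complex_of_real (min r s / 2)"
  have c: "c \<noteq> 0" "cmod c < r" "c \<in> ball 0 s" using r s(1) by (auto simp: c_def)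
  then have "f c = 0" using bij_shift_injective[OF bij] s(3) by blast
  then show "Browder T" using s(2) c(3) by blast
qed

text \<open>In the second case of the dichotomy on \<open>Y\<close> all \<open>T - z\<close> with \<open>z\<close> near \<open>0\<close> have a kernel. But for small
  \<open>c \<noteq> 0\<close> the operator \<open>T - c\<close> is Weyl on \<open>Y\<close>, hence on the whole space because \<open>T - c\<close> is bijective
  modulo \<open>Y\<close>, hence Browder, so that \<open>T - (c + d)\<close> is bijective for small \<open>d \<noteq> 0\<close>.\<close>

lemma Weyl_on_bij_iter_of_Browder:
  fixes T :: "'a::complex_banach \<Rightarrow>\<^sub>C\<^sub>L 'a"
  assumes WB: "\<And>c. Weyl_on UNIV (T - c *\<^sub>C id_cblinfun) \<Longrightarrow> Browder (T - c *\<^sub>C id_cblinfun)"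
    and Y: "csubspace Y" "closed Y" "T ` Y \<subseteq> Y" and Weyl: "Weyl_on Y T"
    and pre: "\<And>c x. c \<noteq> 0 \<Longrightarrow> T x - c *\<^sub>C x \<in> Y \<Longrightarrow> x \<in> Y"
    and sum: "\<And>c x. c \<noteq> 0 \<Longrightarrow> \<exists>u. x - (T u - c *\<^sub>C u) \<in> Y"
  obtains p where "bij_betw T (iter T p ` Y) (iter T p ` Y)"
proof (rule Weyl_on_dichotomy[OF Y Weyl])
  show ?thesis if "bij_betw T (iter T p ` Y) (iter T p ` Y)" for p
    using that by (rule \<open>\<And>p. bij_betw T (iter T p ` Y) (iter T p ` Y) \<Longrightarrow> thesis\<close>)
  fix s f
  assume s: "s > 0" "\<forall>z\<in>ball 0 s. f z \<noteq> 0" "\<forall>z\<in>ball 0 s. T (f z) = z *\<^sub>C f z"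
  obtain r where r: "r > 0" "\<And>c. cmod c < r \<Longrightarrow> Weyl_on Y (T - c *\<^sub>C id_cblinfun)"
    using Weyl_on_stable[OF Y Weyl] by blast
  define c where "c = complex_of_real (min r s / 2)"
  have c: "c \<noteq> 0" "cmod c < r" "cmod c < s" using r(1) s(1) by (auto simp: c_def)
  have "Weyl_on UNIV (T - c *\<^sub>C id_cblinfun)"
  proof (rule Weyl_on_extend[OF Y(1) shift_invariant[OF Y(1,3)] r(2)[OF c(2)]])
    show "x \<in> Y" if "shifted T c x \<in> Y" for x
      by (rule pre[OF c(1)]) (use that in \<open>simp add: shift_apply\<close>)
    have "x \<in> range (shifted T c) \<boxplus> Y" for x
    proof -
      obtain u where "x - (T u - c *\<^sub>C u) \<in> Y" using sum[OF c(1)] by blast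
      moreover have "x = shifted T c u + (x - (T u - c *\<^sub>C u))"
        by (simp add: shift_apply)
      ultimately show ?thesis by blast
    qed
    then show "range (shifted T c) \<boxplus> Y = UNIV" by blast
  qed
  then have "generalized_Drazin_invertible (T - c *\<^sub>C id_cblinfun)"
    using WB Browder_imp_Weyl_generalized_Drazin(2) by blast
  then obtain \<rho> where \<rho>: "\<rho> > 0"
    "\<And>d. d \<noteq> 0 \<Longrightarrow> cmod d < \<rho> \<Longrightarrow> bij (cblinfun_apply ((T - c *\<^sub>C id_cblinfun) - d *\<^sub>C id_cblinfun))"
    using generalized_Drazin_imp_punctured by blast
  define d where "d = complex_of_real (min \<rho> (s - cmod c) / 2)"
  have d: "d \<noteq> 0" "cmod d < \<rho>" "cmod d < s - cmod c" using \<rho>(1) c(3) by (auto simp: d_def)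
  have cd: "c + d \<in> ball 0 s" using d(3) norm_triangle_ineq[of c d] by simp
  have "bij (shifted T (c + d))"
    using \<rho>(2)[OF d(1,2)] by (simp only: shift_shift)
  then have "f (c + d) = 0" using bij_shift_injective s(3) cd by blast
  then show ?thesis using s(2) cd by blast
qed

section \<open>Poles of the resolvent\<close>

lemma bounded_bilinear_scaleC:
  "bounded_bilinear (\<lambda>c (x::'a::complex_normed_vector). c *\<^sub>C x)"
proof
  show "\<exists>K. \<forall>a (b::'a). norm (a *\<^sub>C b) \<le> norm a * norm b * K"
    by (intro exI[of _ 1]) (simp add: norm_scaleC)
qed (simp_all add: scaleC_add_left scaleC_add_right scaleR_scaleC scaleC_scaleC scaleC_complex_def
    mult_ac)

lemma circle_integral_zero:
  assumes h: "h holomorphic_on ball 0 R" and \<rho>: "0 < \<rho>" "\<rho> < R"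
  shows "integral {0..1} (\<lambda>t. circlepath 0 \<rho> t * h (circlepath 0 \<rho> t)) = 0"
proof -
  have "(h has_contour_integral 0) (circlepath 0 \<rho>)"
    using \<rho> by (intro Cauchy_theorem_disc_simple[OF h]) auto
  then have "((\<lambda>t. h (circlepath 0 \<rho> t) * vector_derivative (circlepath 0 \<rho>) (at t within {0..1}))
      has_integral 0) {0..1}"
    by (simp add: has_contour_integral_def)
  then have "((\<lambda>t. (2 * pi * \<i>) * (circlepath 0 \<rho> t * h (circlepath 0 \<rho> t))) has_integral 0) {0..1}"
  proof (rule has_integral_eq[rotated])
    fix t :: real assume "t \<in> {0..1}"
    then have "vector_derivative (circlepath 0 \<rho>) (at t within {0..1})
        = 2 * pi * \<i> * circlepath 0 \<rho> t"
      by (subst vector_derivative_circlepath01) (auto simp: circlepath)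
    then show "h (circlepath 0 \<rho> t) * vector_derivative (circlepath 0 \<rho>) (at t within {0..1})
        = (2 * pi * \<i>) * (circlepath 0 \<rho> t * h (circlepath 0 \<rho> t))"
      by simp
  qed
  then have "((\<lambda>t. inverse (2 * pi * \<i>) * ((2 * pi * \<i>) * (circlepath 0 \<rho> t * h (circlepath 0 \<rho> t))))
      has_integral (inverse (2 * pi * \<i>) * 0)) {0..1}"
    by (rule has_integral_mult_right)
  moreover have "inverse (complex_of_real (2 * pi) * \<i>) * (complex_of_real (2 * pi) * \<i> * y) = y" for y
  proof -
    have "complex_of_real (2 * pi) * \<i> \<noteq> 0" by simp
    then show ?thesis by (metis left_inverse mult.assoc mult_1)
  qed
  ultimately show ?thesis by (simp only: integral_unique mult_zero_right)
qed

lemma functional_eq_0_imp: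
  assumes "\<And>\<phi> :: 'a::complex_normed_vector \<Rightarrow>\<^sub>C\<^sub>L complex. \<phi> x = 0" shows "x = 0"
  using functional_separates[of x] assms by blast

text \<open>Bounded functionals commute with the integral and reduce the claim to Cauchy's theorem for scalar
  functions.\<close>

lemma circle_integral_zero_vector:
  fixes G :: "complex \<Rightarrow> 'a::complex_banach"
  assumes G: "canalytic_on G (ball 0 R)" and \<rho>: "0 < \<rho>" "\<rho> < R"
    and int: "(\<lambda>t. circlepath 0 \<rho> t *\<^sub>C G (circlepath 0 \<rho> t)) integrable_on {0..1}"
  shows "integral {0..1} (\<lambda>t. circlepath 0 \<rho> t *\<^sub>C G (circlepath 0 \<rho> t)) = 0"
proof (rule functional_eq_0_imp)
  fix \<phi> :: "'a \<Rightarrow>\<^sub>C\<^sub>L complex"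
  have "\<phi> (integral {0..1} (\<lambda>t. circlepath 0 \<rho> t *\<^sub>C G (circlepath 0 \<rho> t)))
      = integral {0..1} (\<lambda>t. circlepath 0 \<rho> t * \<phi> (G (circlepath 0 \<rho> t)))"
    using integral_linear[OF int bounded_linear_cblinfun[of \<phi>]]
    by (simp add: o_def cblin_scaleC scaleC_complex_def)
  then show "\<phi> (integral {0..1} (\<lambda>t. circlepath 0 \<rho> t *\<^sub>C G (circlepath 0 \<rho> t))) = 0"
    using circle_integral_zero[OF canalytic_functional[OF G] \<rho>] by simp
qed

lemma bounded_linear_eval: "bounded_linear (\<lambda>A. cblinfun_apply A x)"
proof (rule bounded_linear_intro[where K = "norm x"])
  fix A B :: "'a \<Rightarrow>\<^sub>C\<^sub>L 'b" and r :: real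
  show "cblinfun_apply (A + B) x = A x + B x" by (simp add: plus_cblinfun.rep_eq)
  show "cblinfun_apply (r *\<^sub>R A) x = r *\<^sub>R A x"
    by (simp add: scaleR_scaleC scaleC_cblinfun.rep_eq)
  show "norm (A x) \<le> norm A * norm x"
    using onorm[OF bounded_linear_cblinfun[of A], of x] by (simp add: norm_cblinfun.rep_eq)
qed

text \<open>If \<open>(w - S) G w = w\<^sup>p\<close> and \<open>G w = \<Sum> w\<^sup>n a\<^sub>n\<close>, comparing coefficients gives \<open>S a\<^sub>0 = 0\<close>,
  \<open>S a\<^sub>n\<^sub>+\<^sub>1 = a\<^sub>n\<close> for \<open>n + 1 < p\<close>, and \<open>S a\<^sub>p = a\<^sub>p\<^sub>-\<^sub>1 - 1\<close>. Thus \<open>S\<^sup>p\<close> annihilates \<open>a\<^sub>p\<^sub>-\<^sub>1\<close>, and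
  applying it to the last equation shows that \<open>A = - a\<^sub>p\<close> works. The coefficients are obtained as
  integrals over a circle, so that no expansion of \<open>G\<close> is needed; only the vanishing of the
  coefficient with index \<open>-1\<close> uses that \<open>G\<close> is analytic at \<open>0\<close>.\<close>

lemma pole_coefficients:
  fixes S :: "'a::complex_banach \<Rightarrow>\<^sub>C\<^sub>L 'a" and G :: "complex \<Rightarrow> 'a \<Rightarrow>\<^sub>C\<^sub>L 'a"
  assumes G: "canalytic_on G (ball 0 R)" and R: "R > 0" and p: "p \<ge> 1"
    and left: "\<And>w x. w \<noteq> 0 \<Longrightarrow> cmod w < R \<Longrightarrow> w *\<^sub>C G w x - S (G w x) = w ^ p *\<^sub>C x"
    and right: "\<And>w x. w \<noteq> 0 \<Longrightarrow> cmod w < R \<Longrightarrow> G w (w *\<^sub>C x - S x) = w ^ p *\<^sub>C x"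
  obtains A :: "'a \<Rightarrow>\<^sub>C\<^sub>L 'a" where "\<And>x. iter S p x = S (iter S p (A x))" "\<And>x. A (S x) = S (A x)"
proof -
  define \<rho> where "\<rho> = R / 2"
  have \<rho>: "0 < \<rho>" "\<rho> < R" using R by (auto simp: \<rho>_def)
  define \<gamma> where "\<gamma> = circlepath 0 \<rho>"
  have \<gamma>n: "cmod (\<gamma> t) = \<rho>" for t using \<rho>(1) by (simp add: \<gamma>_def circlepath norm_mult)
  then have \<gamma>0: "\<gamma> t \<noteq> 0" "cmod (\<gamma> t) < R" for t using \<rho> by (metis norm_zero less_irrefl, simp)
  have \<gamma>c: "continuous_on {0..1} \<gamma>"
    using path_circlepath[of 0 \<rho>] by (simp add: \<gamma>_def path_def)
  have Gc: "continuous_on {0..1} (\<lambda>t. G (\<gamma> t))"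
  proof (rule continuous_on_compose2[OF _ \<gamma>c])
    show "continuous_on (ball 0 R) G"
      using G unfolding canalytic_on_def
      by (intro continuous_at_imp_continuous_on) (blast intro: has_derivative_continuous)
    show "\<gamma> ` {0..1} \<subseteq> ball 0 R" using \<gamma>0(2) by auto
  qed
  \<comment> \<open>Up to a constant factor, \<open>I h\<close> is the contour integral of \<open>h w * G w / w\<close>, so \<open>h w = w\<^sup>-\<^sup>n\<close> gives the coefficient \<open>a\<^sub>n\<close>.\<close>
  define I where "I h = integral {0..1} (\<lambda>t. h (\<gamma> t) *\<^sub>C G (\<gamma> t))" for h :: "complex \<Rightarrow> complex"
  have int: "(\<lambda>t. h (\<gamma> t) *\<^sub>C G (\<gamma> t)) integrable_on {0..1}" if "continuous_on (- {0}) h" for h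
  proof (rule integrable_continuous_real)
    have "continuous_on {0..1} (\<lambda>t. h (\<gamma> t))"
      using \<gamma>0(1) by (intro continuous_on_compose2[OF that \<gamma>c]) auto
    then show "continuous_on {0..1} (\<lambda>t. h (\<gamma> t) *\<^sub>C G (\<gamma> t))"
      using Gc by (rule bounded_bilinear.continuous_on[OF bounded_bilinear_scaleC])
  qed
  have Ix: "integral {0..1} (\<lambda>t. h (\<gamma> t) *\<^sub>C G (\<gamma> t) x) = I h x \<and>
      (\<lambda>t. h (\<gamma> t) *\<^sub>C G (\<gamma> t) x) integrable_on {0..1}"
    if "continuous_on (- {0}) h" for h x
    using integral_linear[OF int[OF that] bounded_linear_eval[of x]]
      integrable_linear[OF int[OF that] bounded_linear_eval[of x]]
    by (simp add: o_def scaleC_cblinfun.rep_eq I_def)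
  \<comment> \<open>Integrated form of \<open>S (G w x) = w G w x - w\<^sup>p x\<close>.\<close>
  have SI: "S (I h x) = I (\<lambda>w. w * h w) x - integral {0..1} (\<lambda>t. h (\<gamma> t) * \<gamma> t ^ p) *\<^sub>C x"
    if h: "continuous_on (- {0}) h" for h x
  proof -
    have hw: "continuous_on (- {0}) (\<lambda>w. w * h w)" by (intro continuous_intros h)
    have c: "continuous_on {0..1} (\<lambda>t. h (\<gamma> t) * \<gamma> t ^ p)"
      using \<gamma>0(1) by (intro continuous_intros \<gamma>c continuous_on_compose2[OF h \<gamma>c]) auto
    then have ci: "(\<lambda>t. h (\<gamma> t) * \<gamma> t ^ p) integrable_on {0..1}" by (rule integrable_continuous_real)
    have ci': "integral {0..1} (\<lambda>t. (h (\<gamma> t) * \<gamma> t ^ p) *\<^sub>C x)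
        = integral {0..1} (\<lambda>t. h (\<gamma> t) * \<gamma> t ^ p) *\<^sub>C x \<and>
        (\<lambda>t. (h (\<gamma> t) * \<gamma> t ^ p) *\<^sub>C x) integrable_on {0..1}"
      using integral_linear[OF ci bounded_linear_scaleC_left[of x]]
        integrable_linear[OF ci bounded_linear_scaleC_left[of x]] by (simp add: o_def)
    have "S (I h x) = integral {0..1} (\<lambda>t. S (h (\<gamma> t) *\<^sub>C G (\<gamma> t) x))"
      using integral_linear[of "\<lambda>t. h (\<gamma> t) *\<^sub>C G (\<gamma> t) x" "{0..1}", OF _ bounded_linear_cblinfun[of S]]
        Ix[OF h, of x] by (simp add: o_def)
    also have "\<dots> = integral {0..1} (\<lambda>t. (\<gamma> t * h (\<gamma> t)) *\<^sub>C G (\<gamma> t) x - (h (\<gamma> t) * \<gamma> t ^ p) *\<^sub>C x)"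
    proof (rule integral_cong)
      fix t :: real
      have "S (G (\<gamma> t) x) = \<gamma> t *\<^sub>C G (\<gamma> t) x - \<gamma> t ^ p *\<^sub>C x"
        using left[OF \<gamma>0[of t], of x] by (simp add: algebra_simps)
      then show "S (h (\<gamma> t) *\<^sub>C G (\<gamma> t) x)
          = (\<gamma> t * h (\<gamma> t)) *\<^sub>C G (\<gamma> t) x - (h (\<gamma> t) * \<gamma> t ^ p) *\<^sub>C x"
        by (simp add: cblin_scaleC complex_vector.scale_right_diff_distrib scaleC_scaleC mult.commute)
    qed
    also have "\<dots> = I (\<lambda>w. w * h w) x - integral {0..1} (\<lambda>t. h (\<gamma> t) * \<gamma> t ^ p) *\<^sub>C x"
      using integral_diff[of "\<lambda>t. (\<gamma> t * h (\<gamma> t)) *\<^sub>C G (\<gamma> t) x" "{0..1}" "\<lambda>t. (h (\<gamma> t) * \<gamma> t ^ p) *\<^sub>C x"]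
        Ix[OF hw, of x] ci' by simp
    finally show ?thesis .
  qed
  have comm: "G w (S x) = S (G w x)" if "w \<noteq> 0" "cmod w < R" for w x
  proof -
    have "w *\<^sub>C G w x - G w (S x) = w ^ p *\<^sub>C x"
      using right[OF that, of x] by (simp add: cblin_diff cblin_scaleC)
    then have "w *\<^sub>C G w x - G w (S x) = w *\<^sub>C G w x - S (G w x)"
      using left[OF that, of x] by simp
    then show ?thesis by simp
  qed
  have IS: "I h (S x) = S (I h x)" if h: "continuous_on (- {0}) h" for h x
  proof -
    have "S (I h x) = integral {0..1} (\<lambda>t. S (h (\<gamma> t) *\<^sub>C G (\<gamma> t) x))"
      using integral_linear[of "\<lambda>t. h (\<gamma> t) *\<^sub>C G (\<gamma> t) x" "{0..1}", OF _ bounded_linear_cblinfun[of S]]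
        Ix[OF h, of x] by (simp add: o_def)
    also have "\<dots> = integral {0..1} (\<lambda>t. h (\<gamma> t) *\<^sub>C G (\<gamma> t) (S x))"
      using comm[OF \<gamma>0] by (simp add: cblin_scaleC)
    finally show ?thesis using Ix[OF h, of "S x"] by simp
  qed
  define a where "a n = I (\<lambda>w. inverse w ^ n)" for n
  have cinv: "continuous_on (- {0}) (\<lambda>w::complex. inverse w ^ n)" for n
    by (intro continuous_intros) auto
  have mono: "integral {0..1} (\<lambda>t. \<gamma> t ^ Suc k) = 0" for k
    using circle_integral_zero[of "\<lambda>w. w ^ k" R \<rho>] \<rho> by (simp add: \<gamma>_def holomorphic_on_power)
  have shift: "inverse (\<gamma> t) ^ n * \<gamma> t ^ (n + k) = \<gamma> t ^ k" for t n k
    using \<gamma>0(1)[of t] by (simp add: power_add field_simps)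
  have b0: "I (\<lambda>w. w * inverse w ^ 0) = 0"
    using circle_integral_zero_vector[OF G \<rho>] int[of "\<lambda>w. w"]
    by (simp add: I_def \<gamma>_def continuous_on_id)
  have a0: "S (a 0 x) = 0" for x
    using SI[OF cinv[of 0], of x] b0 mono[of "p - 1"] p
    by (simp add: a_def zero_cblinfun.rep_eq)
  have step: "I (\<lambda>w. w * inverse w ^ Suc n) = a n" for n
    unfolding I_def a_def using \<gamma>0(1) by (simp add: mult.assoc[symmetric])
  have aS: "S (a (Suc n) x) = a n x" if "Suc n < p" for n x
  proof -
    have "(\<lambda>t. inverse (\<gamma> t) ^ Suc n * \<gamma> t ^ p) = (\<lambda>t. \<gamma> t ^ Suc (p - Suc n - 1))"
      using shift[of _ "Suc n" "p - Suc n"] that by (auto simp: fun_eq_iff Suc_diff_Suc)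
    then show ?thesis
      using SI[OF cinv[of "Suc n"], of x] step[of n] mono[of "p - Suc n - 1"] by (simp add: a_def)
  qed
  have ap: "S (a p x) = a (p - 1) x - x" for x
  proof -
    have "(\<lambda>t. inverse (\<gamma> t) ^ p * \<gamma> t ^ p) = (\<lambda>t. 1)"
      using shift[of _ p 0] by (simp add: fun_eq_iff)
    then show ?thesis
      using SI[OF cinv[of p], of x] step[of "p - 1"] p by (simp add: a_def scaleC_one)
  qed
  have van: "n < p \<Longrightarrow> iter S (Suc n) (a n x) = 0" for n x
  proof (induction n)
    case 0
    then show ?case using a0 by simp
  next
    case (Suc n)
    have "iter S (Suc (Suc n)) (a (Suc n) x) = iter S (Suc n) (S (a (Suc n) x))"
      by (simp only: funpow_Suc_right o_def)
    also have "\<dots> = iter S (Suc n) (a n x)" using aS[OF Suc.prems] by simp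
    also have "\<dots> = 0" using Suc by simp
    finally show ?case .
  qed
  have "iter S p x = S (iter S p (cblinfun_apply (- a p) x))" for x
  proof -
    have "x = a (p - 1) x - S (a p x)" by (simp add: ap)
    then have "iter S p x = iter S p (a (p - 1) x) - iter S p (S (a p x))"
      by (metis iter_simps(2))
    moreover have "iter S p (a (p - 1) x) = 0" using van[of "p - 1" x] p by simp
    moreover have "cblinfun_apply (- a p) x = - a p x" by (simp add: uminus_cblinfun.rep_eq)
    moreover have "iter S p (- a p x) = - iter S p (a p x)"
      using iter_simps(2)[of p S 0 "a p x"] by (simp add: iter_simps(4))
    ultimately show ?thesis by (simp add: iter_commute cblin_neg)
  qed
  moreover have "cblinfun_apply (- a p) (S x) = S (cblinfun_apply (- a p) x)" for x
    using IS[OF cinv[of p], of x] by (simp add: uminus_cblinfun.rep_eq a_def cblin_neg)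
  ultimately show ?thesis by (rule that)
qed

lemma iter_commute_operator:
  fixes A S :: "'a::complex_normed_vector \<Rightarrow>\<^sub>C\<^sub>L 'a"
  assumes "\<And>x. cblinfun_apply A (S x) = cblinfun_apply S (A x)"
  shows "A (iter S n x) = iter S n (A x)"
  by (induction n) (simp_all add: assms)

text \<open>From \<open>S\<^sup>p = S\<^sup>p\<^sup>+\<^sup>1 A\<close>, where \<open>A\<close> commutes with \<open>S\<close>, the range of \<open>S\<^sup>p\<close> is mapped onto itself, and a
  vector \<open>S\<^sup>p x\<close> killed by \<open>S\<close> equals \<open>A (S\<^sup>p\<^sup>+\<^sup>1 x) = 0\<close>.\<close>

lemma bij_iter_of_pole:
  fixes S :: "'a::complex_banach \<Rightarrow>\<^sub>C\<^sub>L 'a" and G :: "complex \<Rightarrow> 'a \<Rightarrow>\<^sub>C\<^sub>L 'a"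
  assumes G: "canalytic_on G (ball 0 R)" and R: "R > 0" and p: "p \<ge> 1"
    and left: "\<And>w x. w \<noteq> 0 \<Longrightarrow> cmod w < R \<Longrightarrow> w *\<^sub>C G w x - S (G w x) = w ^ p *\<^sub>C x"
    and right: "\<And>w x. w \<noteq> 0 \<Longrightarrow> cmod w < R \<Longrightarrow> G w (w *\<^sub>C x - S x) = w ^ p *\<^sub>C x"
  shows "bij_betw S (range (iter S p)) (range (iter S p))"
proof -
  obtain A :: "'a \<Rightarrow>\<^sub>C\<^sub>L 'a" where A: "\<And>x. iter S p x = S (iter S p (A x))" "\<And>x. A (S x) = S (A x)"
    using pole_coefficients[OF assms] by blast
  have L: "csubspace (range (iter S p))" by (rule iter_image_subspace[OF csub_UNIV])
  have inv: "S ` range (iter S p) \<subseteq> range (iter S p)" by (rule iter_image_invariant) simp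
  show ?thesis
    unfolding bij_betw_subspace_iff[OF L inv]
  proof (intro conjI ballI impI subsetI)
    fix y assume "y \<in> range (iter S p)" "S y = 0"
    then obtain x where x: "y = iter S p x" by blast
    have "y = S (A (iter S p x))" using A(1)[of x] iter_commute_operator[of A S p x, OF A(2)] x by simp
    also have "\<dots> = A (S y)" by (simp add: A(2) x)
    finally show "y = 0" using \<open>S y = 0\<close> by (simp add: cblin_0)
  next
    fix y assume "y \<in> range (iter S p)"
    then obtain x where x: "y = iter S p x" by blast
    then have "y = S (iter S p (A x))" using A(1)[of x] by simp
    then show "y \<in> S ` range (iter S p)" by blast
  qed
qed

lemma invertible_on_UNIV_bij:
  fixes T :: "'a::complex_banach \<Rightarrow>\<^sub>C\<^sub>L 'a"
  shows "invertible_on UNIV T \<longleftrightarrow> bij (cblinfun_apply T)"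
  by (rule invertible_on_iff_bij_betw) (auto simp: csub_UNIV)

lemma bij_minus_swap:
  "bij (cblinfun_apply (z *\<^sub>C id_cblinfun - T)) \<longleftrightarrow> bij (shifted T z)"
proof -
  have "bij (cblinfun_apply (- A))" if "bij (cblinfun_apply A)" for A :: "'a \<Rightarrow>\<^sub>C\<^sub>L 'a"
  proof -
    have "cblinfun_apply (- A) = uminus \<circ> cblinfun_apply A" by (auto simp: uminus_cblinfun.rep_eq)
    then show ?thesis using that bij_comp[OF that bij_uminus] by simp
  qed
  from this[of "T - z *\<^sub>C id_cblinfun"] this[of "z *\<^sub>C id_cblinfun - T"] show ?thesis by auto
qed

lemma resolvent_inverse:
  fixes T :: "'a::complex_banach \<Rightarrow>\<^sub>C\<^sub>L 'a"
  assumes "bij (shifted T z)"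
  shows "resolvent T z o\<^sub>C\<^sub>L (z *\<^sub>C id_cblinfun - T) = id_cblinfun"
    "(z *\<^sub>C id_cblinfun - T) o\<^sub>C\<^sub>L resolvent T z = id_cblinfun"
proof -
  let ?A = "z *\<^sub>C id_cblinfun - T"
  obtain S where S: "S o\<^sub>C\<^sub>L ?A = id_cblinfun" "?A o\<^sub>C\<^sub>L S = id_cblinfun"
    using assms invertible_on_UNIV_bij[of ?A] invertible_on_UNIV_iff[of ?A] bij_minus_swap[of z T] by auto
  have uniq: "S' = S" if S': "S' o\<^sub>C\<^sub>L ?A = id_cblinfun" for S'
  proof (rule cblinfun_eqI)
    fix x
    have "S' (?A (S x)) = S x" using S' by (metis cblinfun_compose.rep_eq id_cblinfun.rep_eq)
    moreover have "?A (S x) = x" using S(2) by (metis cblinfun_compose.rep_eq id_cblinfun.rep_eq)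
    ultimately show "S' x = S x" by simp
  qed
  have "resolvent T z = S"
    unfolding resolvent_def
  proof (rule the_equality)
    show "S o\<^sub>C\<^sub>L ?A = id_cblinfun \<and> ?A o\<^sub>C\<^sub>L S = id_cblinfun" using S by (rule conjI)
    show "S' = S" if "S' o\<^sub>C\<^sub>L ?A = id_cblinfun \<and> ?A o\<^sub>C\<^sub>L S' = id_cblinfun" for S'
      by (rule uniq[OF conjunct1[OF that]])
  qed
  with S show "resolvent T z o\<^sub>C\<^sub>L ?A = id_cblinfun" "?A o\<^sub>C\<^sub>L resolvent T z = id_cblinfun"
    by (simp_all only:)
qed

lemma spectrum_iff:
  fixes T :: "'a::complex_banach \<Rightarrow>\<^sub>C\<^sub>L 'a"
  shows "z \<in> spectrum T \<longleftrightarrow> \<not> bij (shifted T z)"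
  by (simp add: spectrum_on_def invertible_on_UNIV_bij)

lemma bij_iter_of_resolvent_pole:
  fixes T :: "'a::complex_banach \<Rightarrow>\<^sub>C\<^sub>L 'a"
  assumes "\<mu> \<in> resolvent_poles T"
  defines "S \<equiv> T - \<mu> *\<^sub>C id_cblinfun"
  obtains p where "bij_betw S (range (iter S p)) (range (iter S p))"
proof -
  obtain r where r: "r > 0" "spectrum T \<inter> ball \<mu> r = {\<mu>}" and pole: "is_pole_vec (resolvent T) \<mu>"
    using assms(1) by (auto simp: resolvent_poles_def)
  obtain p s g where g: "s > 0" "p \<ge> 1" "canalytic_on g (ball \<mu> s)"
      "\<And>z. z \<in> ball \<mu> s - {\<mu>} \<Longrightarrow> resolvent T z = (1 / (z - \<mu>) ^ p) *\<^sub>C g z"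
    using pole unfolding is_pole_vec_def by blast
  define R where "R = min r s"
  have R: "R > 0" "R \<le> r" "R \<le> s" using r(1) g(1) by (auto simp: R_def)
  define G where "G w = g (w + \<mu>)" for w
  have "canalytic_on g (ball \<mu> R)"
    using g(3) R(3) unfolding canalytic_on_def by auto
  then have G: "canalytic_on G (ball 0 R)"
    using canalytic_translate[of g \<mu> R "- \<mu>"] by (simp add: G_def[abs_def])
  have *: "w *\<^sub>C G w x - S (G w x) = w ^ p *\<^sub>C x \<and> G w (w *\<^sub>C x - S x) = w ^ p *\<^sub>C x"
    if w: "w \<noteq> 0" "cmod w < R" for w x
  proof -
    let ?z = "w + \<mu>"
    have z: "?z \<in> ball \<mu> s - {\<mu>}" "?z \<in> ball \<mu> r" "?z \<noteq> \<mu>"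
      using w R by (auto simp: dist_norm)
    then have "?z \<notin> spectrum T" using r(2) by blast
    then have bij: "bij (shifted T ?z)" by (simp add: spectrum_iff)
    have "G w = w ^ p *\<^sub>C resolvent T ?z"
      using g(4)[OF z(1)] w(1) by (simp add: G_def scaleC_scaleC scaleC_one)
    then have Gx: "G w y = w ^ p *\<^sub>C resolvent T ?z y" for y by (simp add: scaleC_cblinfun.rep_eq)
    have Sx: "w *\<^sub>C y - S y = cblinfun_apply (?z *\<^sub>C id_cblinfun - T) y" for y
    proof -
      have "cblinfun_apply (?z *\<^sub>C id_cblinfun - T) y = ?z *\<^sub>C y - T y"
        by (simp only: minus_cblinfun.rep_eq scaleC_cblinfun.rep_eq id_cblinfun.rep_eq)
      then show ?thesis by (simp add: S_def shift_apply scaleC_add_left)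
    qed
    have res: "cblinfun_apply (?z *\<^sub>C id_cblinfun - T) (resolvent T ?z y) = y"
      "resolvent T ?z (cblinfun_apply (?z *\<^sub>C id_cblinfun - T) y) = y" for y
      using resolvent_inverse[OF bij] by (metis cblinfun_compose.rep_eq id_cblinfun.rep_eq)+
    show ?thesis unfolding Sx Gx by (simp only: cblin_scaleC res)
  qed
  have "bij_betw S (range (iter S p)) (range (iter S p))"
    by (rule bij_iter_of_pole[OF G R(1) g(2)]) (use * in auto)
  then show ?thesis by (rule that)
qed

lemma bounded_clinear_compose_left: "bounded_clinear (\<lambda>A. T o\<^sub>C\<^sub>L A)"
  unfolding bounded_clinear_def
proof (intro conjI allI bounded_linear_intro[where K = "norm T"])
  show "T o\<^sub>C\<^sub>L (A + B) = (T o\<^sub>C\<^sub>L A) + (T o\<^sub>C\<^sub>L B)" for A B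
    by (rule cblinfun_eqI) (simp add: cblinfun_compose.rep_eq plus_cblinfun.rep_eq cblin_add)
  show 1: "T o\<^sub>C\<^sub>L (c *\<^sub>C A) = c *\<^sub>C (T o\<^sub>C\<^sub>L A)" for c A
    by (rule cblinfun_eqI) (simp add: cblinfun_compose.rep_eq scaleC_cblinfun.rep_eq cblin_scaleC)
  show "T o\<^sub>C\<^sub>L (r *\<^sub>R A) = r *\<^sub>R (T o\<^sub>C\<^sub>L A)" for r A
    by (simp add: scaleR_scaleC 1)
  show "norm (T o\<^sub>C\<^sub>L A) \<le> norm A * norm T" for A
    using norm_cblinfun_compose[of T A] by (simp add: mult.commute)
qed

text \<open>Let \<open>U = T - \<mu>\<close>, let \<open>P\<close> be the projection onto \<open>R(U\<^sup>m)\<close> along \<open>N(U\<^sup>m)\<close>, let \<open>A\<close> be the inverse of \<open>U\<close>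
  on \<open>R(U\<^sup>m)\<close> composed with \<open>P\<close>, and let \<open>q\<close> be the nilpotency order of \<open>U\<close> on \<open>N(U\<^sup>m)\<close>. The resolvent
  is then \<open>w\<^sup>-\<^sup>q g w\<close> at \<open>\<mu> + w\<close>, where the coefficients of \<open>g\<close> are \<open>U\<^sup>q\<^sup>-\<^sup>1\<^sup>-\<^sup>n (1 - P)\<close> for \<open>n < q\<close> and
  \<open>- A\<^sup>n\<^sup>-\<^sup>q\<^sup>+\<^sup>1\<close> for \<open>n \<ge> q\<close>. That \<open>\<mu>\<close> is in the spectrum makes \<open>N(U\<^sup>m)\<close> nonzero, so \<open>q \<ge> 1\<close> and the leading
  coefficient does not vanish.\<close>

lemma resolvent_pole_of_bij_iter:
  fixes T :: "'a::complex_banach \<Rightarrow>\<^sub>C\<^sub>L 'a"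
  defines "S \<equiv> \<lambda>\<mu>. T - \<mu> *\<^sub>C id_cblinfun"
  assumes spec: "\<mu> \<in> spectrum T" and bij: "bij_betw (S \<mu>) (range (iter (S \<mu>) m)) (range (iter (S \<mu>) m))"
  shows "\<mu> \<in> resolvent_poles T"
proof -
  define U where "U = S \<mu>"
  let ?L = "range (iter U m)" and ?Z = "{x. iter U m x = 0}"
  have bijU: "bij_betw U ?L ?L" using bij by (simp add: U_def)
  have L: "csubspace ?L" by (rule iter_image_subspace[OF csub_UNIV])
  have D: "csubspace ?Z" "closed ?Z" "U ` ?Z \<subseteq> ?Z" "?L \<inter> ?Z = {0}" "?L \<boxplus> ?Z = UNIV" "closed ?L"
    using iter_bij_decomposition[OF csub_UNIV closed_UNIV _ bijU] by auto
  obtain P :: "'a \<Rightarrow>\<^sub>C\<^sub>L 'a" where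
    P: "\<And>x. P x \<in> ?L" "\<And>x. x - P x \<in> ?Z" "\<And>x. x \<in> ?L \<Longrightarrow> P x = x" "\<And>x. x \<in> ?Z \<Longrightarrow> P x = 0"
    using bounded_projection[OF L D(6,1,2,4,5)] by blast
  have "invertible_on ?L U"
    using invertible_on_iff_bij_betw[OF L D(6)] bijU by (simp add: bij_betw_def)
  then obtain V where V: "bounded_operator_on ?L V" "\<And>x. x \<in> ?L \<Longrightarrow> V (U x) = x" "\<And>x. x \<in> ?L \<Longrightarrow> U (V x) = x"
    unfolding invertible_on_def by blast
  obtain K where K: "\<And>x. x \<in> ?L \<Longrightarrow> norm (V x) \<le> K * norm x"
    using V(1) unfolding bounded_operator_on_def by blast
  have VL: "\<And>x. x \<in> ?L \<Longrightarrow> V x \<in> ?L" "\<And>x y. x \<in> ?L \<Longrightarrow> y \<in> ?L \<Longrightarrow> V (x + y) = V x + V y"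
      "\<And>c x. x \<in> ?L \<Longrightarrow> V (c *\<^sub>C x) = c *\<^sub>C V x"
    using V(1) unfolding bounded_operator_on_def by blast+
  have "norm (V (P x)) \<le> norm x * (\<bar>K\<bar> * norm P)" for x
  proof -
    have "norm (V (P x)) \<le> \<bar>K\<bar> * norm (P x)"
      using K[OF P(1)[of x]] by (meson abs_ge_self mult_right_mono norm_ge_zero order_trans)
    also have "\<dots> \<le> \<bar>K\<bar> * (norm P * norm x)"
      using onorm[OF bounded_linear_cblinfun[of P], of x]
      by (intro mult_left_mono) (auto simp: norm_cblinfun.rep_eq)
    finally show ?thesis by (simp add: mult_ac)
  qed
  then have "bounded_clinear (\<lambda>x. V (P x))"
    unfolding bounded_clinear_def
    by (intro conjI allI bounded_linear_intro[where K = "\<bar>K\<bar> * norm P"])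
      (use P(1) VL in \<open>auto simp: cblin_add cblin_scaleC scaleR_scaleC\<close>)
  then obtain A :: "'a \<Rightarrow>\<^sub>C\<^sub>L 'a" where A: "\<And>x. A x = V (P x)"
    using bounded_clinear_CBlinfun_apply by metis
  have UA: "U (A x) = P x" and AL: "A x \<in> ?L" for x using P(1) V(3) VL(1) by (auto simp: A)
  have Zne: "\<exists>x\<in>?Z. x \<noteq> 0"
  proof (rule ccontr)
    assume "\<not> ?thesis"
    then have "?Z = {0}" using csub_0[OF D(1)] by blast
    then have "?L = UNIV" using D(5) by simp
    then have "bij (cblinfun_apply U)" using bijU by simp
    then show False using spec by (simp add: spectrum_iff U_def S_def)
  qed
  define q where "q = (LEAST q. \<forall>x\<in>?Z. iter U q x = 0)"
  have q: "\<forall>x\<in>?Z. iter U q x = 0"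
    unfolding q_def by (rule LeastI[of _ m]) simp
  have "q \<noteq> 0" using q Zne by (metis funpow_0)
  then obtain k where k: "q = Suc k" using not0_implies_Suc by blast
  have "\<not> (\<forall>x\<in>?Z. iter U k x = 0)"
    using not_less_Least[of k "\<lambda>q. \<forall>x\<in>?Z. iter U q x = 0"] k unfolding q_def by simp
  then obtain z0 where z0: "z0 \<in> ?Z" "iter U k z0 \<noteq> 0" by blast
  define B where "B n = ((\<lambda>F. U o\<^sub>C\<^sub>L F) ^^ n) (id_cblinfun - P)" for n
  define E where "E n = ((\<lambda>F. A o\<^sub>C\<^sub>L F) ^^ n) A" for n
  have Bx: "B n x = iter U n (x - P x)" for n x
    by (induction n) (simp_all add: B_def minus_cblinfun.rep_eq id_cblinfun.rep_eq cblinfun_compose.rep_eq)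
  \<comment> \<open>The summand \<open>1\<close> lets \<open>C ^ n\<close> also dominate the finitely many coefficients \<open>B n\<close>.\<close>
  define C where "C = 1 + norm A"
  have C: "C \<ge> 1" "C > 0" "norm A \<le> C" by (auto simp: C_def add_pos_nonneg)
  have En: "norm (E n) \<le> C * C ^ n" for n
  proof (induction n)
    case (Suc n)
    have "norm (E (Suc n)) \<le> norm A * norm (E n)" using norm_cblinfun_compose by (simp add: E_def)
    also have "\<dots> \<le> C * (C * C ^ n)" using C Suc by (intro mult_mono) auto
    finally show ?case by simp
  qed (simp add: E_def C)
  define y where "y n = (if n < q then B (k - n) else - E (n - q))" for n
  define M where "M = C + (\<Sum>n<q. norm (B n))"
  have yn: "norm (y n) \<le> M * C ^ n" for n
  proof (cases "n < q")
    case True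
    have "norm (B (k - n)) \<le> (\<Sum>n<q. norm (B n))"
      by (rule member_le_sum) (use True k in auto)
    also have "\<dots> \<le> M" using C by (simp add: M_def)
    also have "\<dots> \<le> M * C ^ n"
      using C sum_nonneg[of "{..<q}" "\<lambda>n. norm (B n)"] by (intro mult_le_cancel_left1[THEN iffD2]) (auto simp: M_def)
    finally show ?thesis using True by (simp add: y_def)
  next
    case False
    have "norm (y n) \<le> C * C ^ (n - q)" using En False by (simp add: y_def)
    also have "\<dots> \<le> M * C ^ n"
      using C sum_nonneg[of "{..<q}" "\<lambda>n. norm (B n)"]
      by (intro mult_mono power_increasing) (auto simp: M_def)
    finally show ?thesis .
  qed
  define g where "g w = (\<Sum>n. w ^ n *\<^sub>C y n)" for w
  have ga: "canalytic_on g (ball 0 (1 / C))"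
    unfolding g_def by (rule power_series_canalytic[OF yn C(2)])
  have g0: "g 0 \<noteq> 0"
  proof
    assume "g 0 = 0"
    then have "cblinfun_apply (B k) z0 = 0" by (simp add: g_def power_series_0 y_def k zero_cblinfun.rep_eq)
    then show False using z0 P(4)[OF z0(1)] by (simp add: Bx)
  qed
  have y0: "U o\<^sub>C\<^sub>L y 0 = 0"
  proof (rule cblinfun_eqI)
    fix x
    have "iter U q (x - P x) = 0" using q P(2) by blast
    then show "cblinfun_apply (U o\<^sub>C\<^sub>L y 0) x = cblinfun_apply 0 x"
      by (simp add: y_def k cblinfun_compose.rep_eq Bx zero_cblinfun.rep_eq)
  qed
  \<comment> \<open>The coefficient relations of \<open>U\<close> fail only at the index \<open>k = q - 1\<close>, where the two families meet.\<close>
  have ystep: "(U o\<^sub>C\<^sub>L y (Suc n)) - y n = (if n = k then - id_cblinfun else 0)" for n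
  proof -
    consider "n < k" | "n = k" | "n > k" by linarith
    then show ?thesis
    proof cases
      case 1
      then have "B (k - n) = U o\<^sub>C\<^sub>L B (k - Suc n)"
        unfolding B_def by (metis Suc_diff_Suc comp_apply funpow.simps(2))
      then show ?thesis using 1 k by (simp add: y_def)
    next
      case 2
      have "(U o\<^sub>C\<^sub>L (- A)) - (id_cblinfun - P) = - id_cblinfun"
        by (rule cblinfun_eqI)
          (simp add: cblinfun_compose.rep_eq minus_cblinfun.rep_eq uminus_cblinfun.rep_eq
            id_cblinfun.rep_eq cblin_neg UA)
      then show ?thesis using 2 k by (simp add: y_def B_def E_def)
    next
      case 3
      then obtain j where j: "n = Suc (k + j)" using less_imp_Suc_add by blast
      have "U o\<^sub>C\<^sub>L E (Suc j) = E j"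
      proof (rule cblinfun_eqI)
        fix x
        have "E j x \<in> ?L" using AL by (cases j) (simp_all add: E_def cblinfun_compose.rep_eq)
        then show "cblinfun_apply (U o\<^sub>C\<^sub>L E (Suc j)) x = E j x"
          using UA P(3) by (simp add: E_def cblinfun_compose.rep_eq)
      qed
      moreover have "U o\<^sub>C\<^sub>L (- F) = - (U o\<^sub>C\<^sub>L F)" for F :: "'a \<Rightarrow>\<^sub>C\<^sub>L 'a"
        by (rule cblinfun_eqI) (simp add: cblinfun_compose.rep_eq uminus_cblinfun.rep_eq cblin_neg)
      ultimately show ?thesis using j k by (simp add: y_def Suc_diff_le)
    qed
  qed
  have gU: "(U o\<^sub>C\<^sub>L g w) - w *\<^sub>C g w = - (w ^ q *\<^sub>C id_cblinfun)" if "cmod w < 1 / C" for w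
  proof -
    have "(\<lambda>n. w ^ Suc n *\<^sub>C ((U o\<^sub>C\<^sub>L y (Suc n)) - y n)) sums
        (\<Sum>n\<in>{k}. w ^ Suc n *\<^sub>C ((U o\<^sub>C\<^sub>L y (Suc n)) - y n))"
      by (rule sums_finite) (auto simp: ystep)
    then have "(\<Sum>n. w ^ Suc n *\<^sub>C ((U o\<^sub>C\<^sub>L y (Suc n)) - y n)) = - (w ^ q *\<^sub>C id_cblinfun)"
      by (simp add: sums_iff ystep k)
    then show ?thesis
      using power_series_shift[OF bounded_clinear_compose_left yn C(2) that, of U] y0
      by (simp add: g_def)
  qed
  have "generalized_Drazin_invertible U"
    by (rule generalized_Drazin_of_bij_iter[OF Red_trivial quasinilpotent_on_0 bijU])
  then obtain r where r: "r > 0" "\<And>c. c \<noteq> 0 \<Longrightarrow> cmod c < r \<Longrightarrow> bij (shifted U c)"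
    using generalized_Drazin_imp_punctured by blast
  have bijT: "bij (shifted T z)" if "z \<noteq> \<mu>" "dist \<mu> z < r" for z
    using r(2)[of "z - \<mu>"] that by (simp add: U_def S_def shift_shift dist_norm norm_minus_commute)
  have "spectrum T \<inter> ball \<mu> r = {\<mu>}"
    using spec bijT r(1) by (auto simp: spectrum_iff) metis
  moreover have "is_pole_vec (resolvent T) \<mu>"
    unfolding is_pole_vec_def
  proof (intro exI conjI ballI)
    define R where "R = min r (1 / C)"
    show "R > 0" using r(1) C by (simp add: R_def)
    show "q \<ge> 1" using k by simp
    have "canalytic_on g (ball 0 R)"
      using ga unfolding canalytic_on_def R_def by auto
    then show "canalytic_on (\<lambda>z. g (z - \<mu>)) (ball \<mu> R)"
      using canalytic_translate[of g 0 R \<mu>] by simp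
    show "g (\<mu> - \<mu>) \<noteq> 0" using g0 by simp
    fix z assume z: "z \<in> ball \<mu> R - {\<mu>}"
    then have w: "z - \<mu> \<noteq> 0" "cmod (z - \<mu>) < 1 / C" "dist \<mu> z < r"
      by (auto simp: R_def dist_norm norm_minus_commute)
    have bz: "bij (shifted T z)" using bijT w by auto
    show "resolvent T z = (1 / (z - \<mu>) ^ q) *\<^sub>C g (z - \<mu>)"
    proof (rule cblinfun_eqI)
      fix x
      let ?v = "(1 / (z - \<mu>) ^ q) *\<^sub>C g (z - \<mu>) x"
      have "U (g (z - \<mu>) x) - (z - \<mu>) *\<^sub>C g (z - \<mu>) x = - ((z - \<mu>) ^ q *\<^sub>C x)"
        using arg_cong[OF gU[OF w(2)], of "\<lambda>F. cblinfun_apply F x"]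
        by (simp add: minus_cblinfun.rep_eq uminus_cblinfun.rep_eq scaleC_cblinfun.rep_eq
            id_cblinfun.rep_eq cblinfun_compose.rep_eq)
      then have "cblinfun_apply (z *\<^sub>C id_cblinfun - T) (g (z - \<mu>) x) = (z - \<mu>) ^ q *\<^sub>C x"
        by (simp add: U_def S_def minus_cblinfun.rep_eq scaleC_cblinfun.rep_eq id_cblinfun.rep_eq
            complex_vector.scale_left_diff_distrib algebra_simps)
      then have "cblinfun_apply (z *\<^sub>C id_cblinfun - T) ?v = x"
        using w(1) by (simp add: cblin_scaleC scaleC_scaleC scaleC_one)
      then have "resolvent T z x = resolvent T z (cblinfun_apply (z *\<^sub>C id_cblinfun - T) ?v)" by simp
      also have "\<dots> = ?v"
        using resolvent_inverse(1)[OF bz] by (metis cblinfun_compose.rep_eq id_cblinfun.rep_eq)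
      finally show "resolvent T z x = cblinfun_apply ((1 / (z - \<mu>) ^ q) *\<^sub>C g (z - \<mu>)) x"
        by (simp add: scaleC_cblinfun.rep_eq)
    qed
  qed
  ultimately show ?thesis using spec r(1) by (auto simp: resolvent_poles_def)
qed

section \<open>The equivalences\<close>

lemma Weyl_imp_pseudo_B_Weyl:
  fixes T :: "'a::complex_banach \<Rightarrow>\<^sub>C\<^sub>L 'a"
  assumes "Weyl_on UNIV T" shows "pseudo_B_Weyl T"
  unfolding pseudo_B_Weyl_def using assms Red_trivial quasinilpotent_on_0 by blast

lemma Weyl_imp_B_Weyl: "Weyl_on UNIV T \<Longrightarrow> B_Weyl T"
  unfolding B_Weyl_def by (intro exI[of _ 0]) simp

lemma generalized_Drazin_imp_pseudo_B_Weyl: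
  fixes T :: "'a::complex_banach \<Rightarrow>\<^sub>C\<^sub>L 'a"
  assumes "generalized_Drazin_invertible T" shows "pseudo_B_Weyl T"
proof -
  obtain M N where MN: "(M, N) \<in> Red T" "invertible_on M T" "quasinilpotent_on N T"
    using assms by (auto simp: generalized_Drazin_invertible_def)
  note R = RedD[OF MN(1)]
  have "Weyl_on M T"
    using bij_betw_imp_Weyl_on[OF R(1,2)] invertible_on_iff_bij_betw[OF R(1-3)] MN(2) by blast
  then show ?thesis unfolding pseudo_B_Weyl_def using MN by blast
qed

lemma B_Weyl_of_bij_iter:
  fixes T :: "'a::complex_banach \<Rightarrow>\<^sub>C\<^sub>L 'a"
  assumes bij: "bij_betw T (range (iter T p)) (range (iter T p))"
  shows "B_Weyl T"
proof -
  have L: "csubspace (range (iter T p))" by (rule iter_image_subspace[OF csub_UNIV])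
  have cl: "closed (range (iter T p))"
    using iter_bij_decomposition(6)[OF csub_UNIV closed_UNIV _ bij] by simp
  then show ?thesis unfolding B_Weyl_def using bij_betw_imp_Weyl_on[OF L cl bij] by blast
qed

text \<open>For \<open>c \<noteq> 0\<close> the quotient by \<open>M\<close> is \<open>N\<close>, on which \<open>T - c\<close> is bijective by quasi-nilpotency.\<close>

lemma generalized_Drazin_of_pseudo_B_Weyl:
  fixes T :: "'a::complex_banach \<Rightarrow>\<^sub>C\<^sub>L 'a"
  assumes WB: "\<And>c. Weyl_on UNIV (T - c *\<^sub>C id_cblinfun) \<Longrightarrow> Browder (T - c *\<^sub>C id_cblinfun)"
    and "pseudo_B_Weyl T"
  shows "generalized_Drazin_invertible T"
proof -
  obtain M N where MN: "(M, N) \<in> Red T" "Weyl_on M T" "quasinilpotent_on N T"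
    using assms(2) by (auto simp: pseudo_B_Weyl_def)
  note R = RedD[OF MN(1)]
  have bijN: "bij_betw (shifted T c) N N" if "c \<noteq> 0" for c
    using MN(3) that quasinilpotent_on_iff[OF R(4-6)] by blast
  have split: "\<exists>m n. x = m + n \<and> m \<in> M \<and> n \<in> N" for x
  proof -
    have "x \<in> M \<boxplus> N" using R(8) by simp
    then show ?thesis by blast
  qed
  obtain p where "bij_betw T (iter T p ` M) (iter T p ` M)"
  proof (rule Weyl_on_bij_iter_of_Browder[OF WB R(1-3) MN(2)])
    fix c :: complex and x assume c: "c \<noteq> 0" and x: "T x - c *\<^sub>C x \<in> M"
    note b = bijN[OF c, unfolded bij_betw_subspace_iff[OF R(4) shift_invariant[OF R(4,6)]]]
    obtain m n where mn: "x = m + n" "m \<in> M" "n \<in> N" using split by blast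
    have "T n - c *\<^sub>C n = (T x - c *\<^sub>C x) - (T m - c *\<^sub>C m)"
      by (simp add: mn(1) cblin_add scaleC_add_right)
    moreover have "T m - c *\<^sub>C m \<in> M"
      using shift_invariant[OF R(1,3), of c] mn(2) by (auto simp: shift_apply)
    ultimately have "T n - c *\<^sub>C n \<in> M" using x csub_diff[OF R(1)] by simp
    moreover have "T n - c *\<^sub>C n \<in> N"
      using shift_invariant[OF R(4,6), of c] mn(3) by (auto simp: shift_apply)
    ultimately have "T n - c *\<^sub>C n = 0" using R(7) by blast
    then have "n = 0" using b mn(3) by (simp add: shift_apply)
    then show "x \<in> M" using mn by simp
  next
    fix c :: complex and x assume c: "c \<noteq> 0"
    obtain m n where mn: "x = m + n" "m \<in> M" "n \<in> N" using split by blast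
    have "n \<in> shifted T c ` N"
      using bijN[OF c] mn(3) by (simp add: bij_betw_def)
    then obtain u where "n = T u - c *\<^sub>C u" by (auto simp: shift_apply)
    then show "\<exists>u. x - (T u - c *\<^sub>C u) \<in> M" using mn by (intro exI[of _ u]) simp
  qed
  then show ?thesis by (rule generalized_Drazin_of_bij_iter[OF MN(1,3)])
qed

text \<open>On the quotient by \<open>R(T\<^sup>n)\<close> the operator \<open>T\<close> is nilpotent, so for \<open>c \<noteq> 0\<close> the operator \<open>T - c\<close> is
  bijective there.\<close>

lemma bij_iter_of_B_Weyl:
  fixes T :: "'a::complex_banach \<Rightarrow>\<^sub>C\<^sub>L 'a"
  assumes WB: "\<And>c. Weyl_on UNIV (T - c *\<^sub>C id_cblinfun) \<Longrightarrow> Browder (T - c *\<^sub>C id_cblinfun)"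
    and "B_Weyl T"
  obtains p where "bij_betw T (range (iter T p)) (range (iter T p))"
proof -
  obtain n where n: "closed (range (iter T n))" "Weyl_on (range (iter T n)) T"
    using assms(2) by (auto simp: B_Weyl_def)
  let ?Y = "range (iter T n)"
  have Y: "csubspace ?Y" "T ` ?Y \<subseteq> ?Y"
    by (rule iter_image_subspace[OF csub_UNIV], rule iter_image_invariant) simp
  obtain p where p: "bij_betw T (iter T p ` ?Y) (iter T p ` ?Y)"
  proof (rule Weyl_on_bij_iter_of_Browder[OF WB Y(1) n(1) Y(2) n(2)])
    fix c :: complex and x assume c: "c \<noteq> 0" and x: "T x - c *\<^sub>C x \<in> ?Y"
    have Yk: "iter T k x - c ^ k *\<^sub>C x \<in> ?Y" for k
    proof (induction k)
      case 0
      then show ?case using csub_0[OF Y(1)] by (simp add: scaleC_one)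
    next
      case (Suc k)
      have "iter T (Suc k) x - c ^ Suc k *\<^sub>C x = T (iter T k x - c ^ k *\<^sub>C x) + c ^ k *\<^sub>C (T x - c *\<^sub>C x)"
        by (simp add: cblin_simps complex_vector.scale_right_diff_distrib scaleC_scaleC mult.commute)
      moreover have "T (iter T k x - c ^ k *\<^sub>C x) \<in> ?Y" using Suc Y(2) by blast
      moreover have "c ^ k *\<^sub>C (T x - c *\<^sub>C x) \<in> ?Y" using x by (rule csub_scale[OF Y(1)])
      ultimately show ?case using csub_add[OF Y(1)] by metis
    qed
    have "iter T n x - (iter T n x - c ^ n *\<^sub>C x) \<in> ?Y"
      by (rule csub_diff[OF Y(1) rangeI Yk])
    then have "c ^ n *\<^sub>C x \<in> ?Y" by simp
    then have "inverse (c ^ n) *\<^sub>C c ^ n *\<^sub>C x \<in> ?Y" by (rule csub_scale[OF Y(1)])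
    then show "x \<in> ?Y" using c by (simp add: scaleC_scaleC scaleC_one)
  next
    fix c :: complex and x assume c: "c \<noteq> 0"
    obtain u where u: "T u - c *\<^sub>C u = iter T n x - c ^ n *\<^sub>C x"
      using shift_telescope[OF csub_UNIV, of T x c n] by auto
    let ?v = "- inverse (c ^ n) *\<^sub>C u"
    have "T ?v - c *\<^sub>C ?v = - inverse (c ^ n) *\<^sub>C (T u - c *\<^sub>C u)"
      by (simp only: cblin_scaleC complex_vector.scale_right_diff_distrib scaleC_scaleC mult.commute)
    also have "\<dots> = x - inverse (c ^ n) *\<^sub>C iter T n x"
      using c by (simp add: u complex_vector.scale_right_diff_distrib scaleC_scaleC scaleC_one)
    finally have "x - (T ?v - c *\<^sub>C ?v) = iter T n (inverse (c ^ n) *\<^sub>C x)"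
      by (simp add: iter_simps)
    then show "\<exists>u. x - (T u - c *\<^sub>C u) \<in> ?Y" by (metis rangeI)
  qed
  have "iter T p ` ?Y = range (iter T (p + n))" by (simp add: funpow_add image_comp)
  then show ?thesis using p that by metis
qed

lemma Browders_theorem_iff:
  fixes T :: "'a::complex_banach \<Rightarrow>\<^sub>C\<^sub>L 'a"
  shows "Browders_theorem T \<longleftrightarrow>
    (\<forall>\<mu>. Weyl_on UNIV (T - \<mu> *\<^sub>C id_cblinfun) \<longrightarrow> Browder (T - \<mu> *\<^sub>C id_cblinfun))"
  unfolding Browders_theorem_def Weyl_spectrum_def Browder_spectrum_def
  using Browder_imp_Weyl_generalized_Drazin(1) by blast

lemma generalized_Browders_theorem_iff:
  fixes T :: "'a::complex_banach \<Rightarrow>\<^sub>C\<^sub>L 'a"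
  shows "generalized_Browders_theorem T \<longleftrightarrow>
    (\<forall>\<mu>. B_Weyl (T - \<mu> *\<^sub>C id_cblinfun) \<longrightarrow> \<mu> \<in> spectrum T \<longrightarrow> \<mu> \<in> resolvent_poles T)"
proof -
  have "B_Weyl (T - \<mu> *\<^sub>C id_cblinfun)" if "\<mu> \<notin> spectrum T" for \<mu>
    using that bij_betw_imp_Weyl_on[OF csub_UNIV closed_UNIV]
    by (intro Weyl_imp_B_Weyl) (simp add: spectrum_iff)
  moreover have "B_Weyl (T - \<mu> *\<^sub>C id_cblinfun)" if "\<mu> \<in> resolvent_poles T" for \<mu>
    using bij_iter_of_resolvent_pole[OF that] B_Weyl_of_bij_iter by blast
  ultimately show ?thesis
    unfolding generalized_Browders_theorem_def B_Weyl_spectrum_def by blast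
qed

lemma gD_spectrum_eq_iff:
  fixes T :: "'a::complex_banach \<Rightarrow>\<^sub>C\<^sub>L 'a"
  shows "gD_spectrum T = gDW_spectrum T \<longleftrightarrow>
    (\<forall>\<mu>. pseudo_B_Weyl (T - \<mu> *\<^sub>C id_cblinfun) \<longrightarrow> generalized_Drazin_invertible (T - \<mu> *\<^sub>C id_cblinfun))"
  unfolding gD_spectrum_def gDW_spectrum_def
  using generalized_Drazin_imp_pseudo_B_Weyl by blast

lemma Browder_of_Weyl_generalized_Drazin:
  fixes T :: "'a::complex_banach \<Rightarrow>\<^sub>C\<^sub>L 'a"
  assumes "Weyl_on UNIV T" "generalized_Drazin_invertible T"
  shows "Browder T"
proof -
  obtain r where "r > 0" "\<And>c. c \<noteq> 0 \<Longrightarrow> cmod c < r \<Longrightarrow> bij (shifted T c)"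
    using generalized_Drazin_imp_punctured[OF assms(2)] by blast
  then show ?thesis by (rule Browder_of_Weyl_punctured[OF assms(1)])
qed

lemma generalized_Drazin_of_SVEP:
  fixes T :: "'a::complex_banach \<Rightarrow>\<^sub>C\<^sub>L 'a"
  assumes "pseudo_B_Weyl (T - \<mu> *\<^sub>C id_cblinfun)" and SVEP: "SVEP_at T \<mu>"
  shows "generalized_Drazin_invertible (T - \<mu> *\<^sub>C id_cblinfun)"
proof -
  let ?S = "T - \<mu> *\<^sub>C id_cblinfun"
  obtain M N where MN: "(M, N) \<in> Red ?S" "Weyl_on M ?S" "quasinilpotent_on N ?S"
    using assms(1) by (auto simp: pseudo_B_Weyl_def)
  note R = RedD[OF MN(1)]
  show ?thesis
  proof (rule Weyl_on_dichotomy[OF R(1-3) MN(2)])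
    show "generalized_Drazin_invertible ?S" if "bij_betw ?S (iter ?S p ` M) (iter ?S p ` M)" for p
      by (rule generalized_Drazin_of_bij_iter[OF MN(1,3) that])
    show "generalized_Drazin_invertible ?S" if "r > 0" "canalytic_on f (ball 0 r)"
      "\<forall>z\<in>ball 0 r. f z \<noteq> 0" "\<forall>z\<in>ball 0 r. ?S (f z) = z *\<^sub>C f z" for r f
      using canalytic_eigenvectors_imp_not_SVEP[OF that] SVEP by blast
  qed
qed

theorem theorem2p2:
  fixes T :: "'a::complex_banach \<Rightarrow>\<^sub>C\<^sub>L 'a"
  shows "(Browders_theorem T \<longleftrightarrow> generalized_Browders_theorem T) \<and>
    (generalized_Browders_theorem T \<longleftrightarrow>
      (\<forall>\<mu>. \<mu> \<notin> gDW_spectrum T \<longrightarrow> SVEP_at T \<mu> \<and> SVEP_at (banach_adjoint T) \<mu>)) \<and>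
    ((\<forall>\<mu>. \<mu> \<notin> gDW_spectrum T \<longrightarrow> SVEP_at T \<mu> \<and> SVEP_at (banach_adjoint T) \<mu>) \<longleftrightarrow>
      gD_spectrum T = gDW_spectrum T)"
proof -
  let ?S = "\<lambda>\<mu>. T - \<mu> *\<^sub>C id_cblinfun"
  let ?B = "\<forall>\<mu>. Weyl_on UNIV (?S \<mu>) \<longrightarrow> Browder (?S \<mu>)"
  let ?G = "\<forall>\<mu>. B_Weyl (?S \<mu>) \<longrightarrow> \<mu> \<in> spectrum T \<longrightarrow> \<mu> \<in> resolvent_poles T"
  let ?V = "\<forall>\<mu>. \<mu> \<notin> gDW_spectrum T \<longrightarrow> SVEP_at T \<mu> \<and> SVEP_at (banach_adjoint T) \<mu>"
  let ?D = "\<forall>\<mu>. pseudo_B_Weyl (?S \<mu>) \<longrightarrow> generalized_Drazin_invertible (?S \<mu>)"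
  have WB: "Browder (?S \<mu> - c *\<^sub>C id_cblinfun)"
    if ?B "Weyl_on UNIV (?S \<mu> - c *\<^sub>C id_cblinfun)" for \<mu> c
    using that by (simp only: shift_shift)
  have "?G" if ?B
  proof (intro allI impI)
    fix \<mu> assume B: "B_Weyl (?S \<mu>)" and spec: "\<mu> \<in> spectrum T"
    obtain p where "bij_betw (?S \<mu>) (range (iter (?S \<mu>) p)) (range (iter (?S \<mu>) p))"
      using bij_iter_of_B_Weyl[OF WB[OF \<open>?B\<close>] B] by blast
    then show "\<mu> \<in> resolvent_poles T" by (rule resolvent_pole_of_bij_iter[OF spec])
  qed
  moreover have "?B" if ?G
  proof (intro allI impI)
    fix \<mu> assume W: "Weyl_on UNIV (?S \<mu>)"
    show "Browder (?S \<mu>)"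
    proof (cases "\<mu> \<in> spectrum T")
      case True
      then have "\<mu> \<in> resolvent_poles T" using \<open>?G\<close> Weyl_imp_B_Weyl[OF W] by blast
      then show ?thesis
        using bij_iter_of_resolvent_pole Browder_of_Weyl_bij_iter[OF W] by blast
    next
      case False
      then show ?thesis
        by (intro Browder_of_Weyl_bij_iter[OF W, of 0]) (simp add: spectrum_iff)
    qed
  qed
  moreover have "?D" if ?B
    using generalized_Drazin_of_pseudo_B_Weyl[OF WB[OF \<open>?B\<close>]] by blast
  moreover have "?B" if ?D
    using that Weyl_imp_pseudo_B_Weyl Browder_of_Weyl_generalized_Drazin by blast
  moreover have "?V" if ?D
    using that generalized_Drazin_imp_SVEP[of T] by (auto simp: gDW_spectrum_def)
  moreover have "?D" if ?V
    using that generalized_Drazin_of_SVEP[of T] by (auto simp: gDW_spectrum_def)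
  ultimately show ?thesis
    unfolding Browders_theorem_iff generalized_Browders_theorem_iff gD_spectrum_eq_iff by blast
qed

end
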